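(* Assume $a$ is (WD) or (SD) with degeneracy constant $K$, and let $T>0$. If $y$ is a mild solution of $$\begin{cases} y_{tt}(t,x)+(ay_{xx})_{xx}(t,x)=0, & (t,x)\in(0,+\infty)\times(0,1),\\ y(t,0)=y(t,1)=y_x(t,1)=0, & t>0,\\ y_x(t,0)=0\text{ if }a\text{ is (WD)},\quad(ay_{xx})(t,0)=0\text{ if }a\text{ is (SD)}, & t>0,\\ y(0,x)=y_T^0(x),\ y_t(0,x)=y_T^1(x), & x\in(0,1),\end{cases}$$ then $$a(1)\int_0^Ty_{xx}^2(t,1)\,dt\le4\left(T\max\left\{1,\frac{6+K}2+\frac{4K}{(1-K)^2}\right\}+\max\left\{\frac1{a(1)(2-K)},1\right\}\right)E_y(0)$$ if $a$ is (WD), and $$a(1)\int_0^Ty_{xx}^2(t,1)\,dt\le4\left(T\max\left\{1,\frac{6+K}2+\frac{\max_{x\in[0,1]}|a'(x)|}{a(1)(2-K)}\right\}+\max\left\{\frac1{a(1)(2-K)},1\right\}\right)E_y(0)$$ if $a$ is (SD).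
   Context: Degeneracy. $a$ is weakly degenerate (WD) if $a\in C[0,1]\cap C^1(0,1]$, $a(0)=0$, $a>0$ on $(0,1]$ and $K:=\sup_{x\in(0,1]}\frac{x|a'(x)|}{a(x)}\in(0,1)$; $a$ is strongly degenerate (SD) if $a\in C^1[0,1]$, $a(0)=0$, $a>0$ on $(0,1]$ and $K\in[1,2)$. Spaces. If $a$ is (WD), $H^2_{a,0}(0,1)$ is the set of $u\in H^1_0(0,1)$ with $u'$ absolutely continuous on $[0,1]$, $u'(0)=u'(1)=0$, $\sqrt a u''\in L^2(0,1)$. If $a$ is (SD), it is the set of $u\in H^1_0(0,1)$ with $u'$ locally absolutely continuous on $(0,1]$, $u'(1)=0$, $\sqrt a u''\in L^2(0,1)$. $\mathcal H_0:=H^2_{a,0}(0,1)\times L^2(0,1)$ with $\|(u,v)\|^2_{\mathcal H_0}=\int_0^1 a(u'')^2dx+\int_0^1v^2dx$. $D(A)$ is the set of $u\in H^2_{a,0}(0,1)$ with $au''\in H^2(0,1)$ and, if $a$ is (SD), $(au'')(0)=0$; $Au:=(au'')''$; $\mathcal A(u,v):=(v,-Au)$ on $D(\mathcal A):=D(A)\times H^2_{a,0}(0,1)$ generates a contraction semigroup $(T(t))_{t\ge0}$ on $\mathcal H_0$. The mild solution with data $(y_T^0,y_T^1)\in\mathcal H_0$ is the first component of $(y(t),y_t(t))=T(t)(y_T^0,y_T^1)$; it is classical if the data are in $D(\mathcal A)$. For mild solutions the trace $y_{xx}(\cdot,1)\in L^2(0,T)$ is the $L^2(0,T)$-limit of the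 traces of classical solutions whose data converge in $\mathcal H_0$. Energy: $E_y(t):=\frac12\int_0^1(y_t^2(t,x)+a(x)y_{xx}^2(t,x))dx$. *)

theory Defs
  imports "HOL-Analysis.Analysis"
begin

text \<open>
  A function on \<open>[0,1]\<close> is a function \<open>real \<Rightarrow> real\<close> of which only the values on \<open>[0,1]\<close>
  matter; the derivative at \<open>0\<close> and \<open>1\<close> is one-sided.  At points where the derivative does not
  exist the value of \<open>deriv01\<close> is arbitrary, so it is only used almost everywhere, or where the
  derivative exists.
\<close>

definition deriv01 :: "(real \<Rightarrow> real) \<Rightarrow> real \<Rightarrow> real" where
  "deriv01 f x = vector_derivative f (at x within {0..1})"

definition abs_cont_on :: "real \<Rightarrow> real \<Rightarrow> (real \<Rightarrow> real) \<Rightarrow> bool" where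
  "abs_cont_on c d f \<longleftrightarrow>
     (\<forall>\<epsilon>>0. \<exists>\<delta>>0. \<forall>(n::nat) (l::nat \<Rightarrow> real) (r::nat \<Rightarrow> real).
        (\<forall>i<n. c \<le> l i \<and> l i \<le> r i \<and> r i \<le> d) \<longrightarrow>
        (\<forall>i<n. \<forall>j<n. i \<noteq> j \<longrightarrow> {l i<..<r i} \<inter> {l j<..<r j} = {}) \<longrightarrow>
        (\<Sum>i<n. r i - l i) < \<delta> \<longrightarrow>
        (\<Sum>i<n. \<bar>f (r i) - f (l i)\<bar>) < \<epsilon>)"

definition degeneracy_const :: "(real \<Rightarrow> real) \<Rightarrow> real" where
  "degeneracy_const a = (SUP x\<in>{0<..1}. x * \<bar>deriv01 a x\<bar> / a x)"

definition weakly_degenerate :: "(real \<Rightarrow> real) \<Rightarrow> bool" where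
  "weakly_degenerate a \<longleftrightarrow>
     continuous_on {0..1} a \<and>
     (\<forall>x\<in>{0<..1}. a differentiable (at x within {0..1})) \<and> continuous_on {0<..1} (deriv01 a) \<and>
     a 0 = 0 \<and> (\<forall>x\<in>{0<..1}. 0 < a x) \<and>
     bdd_above ((\<lambda>x. x * \<bar>deriv01 a x\<bar> / a x) ` {0<..1}) \<and>
     0 < degeneracy_const a \<and> degeneracy_const a < 1"

definition strongly_degenerate :: "(real \<Rightarrow> real) \<Rightarrow> bool" where
  "strongly_degenerate a \<longleftrightarrow>
     (\<forall>x\<in>{0..1}. a differentiable (at x within {0..1})) \<and> continuous_on {0..1} (deriv01 a) \<and>
     a 0 = 0 \<and> (\<forall>x\<in>{0<..1}. 0 < a x) \<and>
     bdd_above ((\<lambda>x. x * \<bar>deriv01 a x\<bar> / a x) ` {0<..1}) \<and>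
     1 \<le> degeneracy_const a \<and> degeneracy_const a < 2"

text \<open>
  Elements of \<open>L\<^sup>2\<close> are represented by functions, so statements about elements of \<open>L\<^sup>2\<close> and of
  the energy space \<open>H0 a\<close> are made up to a difference of norm \<open>0\<close>.
\<close>

definition L2_on :: "real set \<Rightarrow> (real \<Rightarrow> real) set" where
  "L2_on X = {f. f \<in> borel_measurable (lebesgue_on X) \<and> integrable (lebesgue_on X) (\<lambda>x. (f x)\<^sup>2)}"

abbreviation L2 :: "(real \<Rightarrow> real) set" where
  "L2 \<equiv> L2_on {0<..<1}"

definition L2_limit_on :: "real set \<Rightarrow> (nat \<Rightarrow> real \<Rightarrow> real) \<Rightarrow> (real \<Rightarrow> real) \<Rightarrow> bool" where
  "L2_limit_on X f g \<longleftrightarrow>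
     (\<forall>n. f n \<in> L2_on X) \<and> g \<in> L2_on X \<and>
     (\<lambda>n. LINT t|lebesgue_on X. (f n t - g t)\<^sup>2) \<longlonglongrightarrow> 0"

text \<open>
  Sobolev functions on \<open>(0,1)\<close> are represented by their continuous representative on \<open>[0,1]\<close>:
  \<open>H\<^sup>1(0,1)\<close> consists of the absolutely continuous functions whose derivative is in \<open>L\<^sup>2\<close>,
  \<open>H\<^sup>2(0,1)\<close> of those whose derivative is in \<open>H\<^sup>1(0,1)\<close>.
\<close>

definition H1 :: "(real \<Rightarrow> real) set" where
  "H1 = {u. abs_cont_on 0 1 u \<and> deriv01 u \<in> L2}"

definition H10 :: "(real \<Rightarrow> real) set" where
  "H10 = {u \<in> H1. u 0 = 0 \<and> u 1 = 0}"

definition H2 :: "(real \<Rightarrow> real) set" where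
  "H2 = {u \<in> H1. deriv01 u \<in> H1}"

definition H2a0 :: "(real \<Rightarrow> real) \<Rightarrow> (real \<Rightarrow> real) set" where
  "H2a0 a = {u \<in> H10.
     (weakly_degenerate a \<longrightarrow>
        abs_cont_on 0 1 (deriv01 u) \<and> deriv01 u 0 = 0 \<and> deriv01 u 1 = 0) \<and>
     (strongly_degenerate a \<longrightarrow>
        (\<forall>c\<in>{0<..<1}. abs_cont_on c 1 (deriv01 u)) \<and> deriv01 u 1 = 0) \<and>
     (\<lambda>x. sqrt (a x) * deriv01 (deriv01 u) x) \<in> L2}"

type_synonym state = "(real \<Rightarrow> real) \<times> (real \<Rightarrow> real)"

definition H0 :: "(real \<Rightarrow> real) \<Rightarrow> state set" where
  "H0 a = H2a0 a \<times> L2"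

definition H0_norm :: "(real \<Rightarrow> real) \<Rightarrow> state \<Rightarrow> real" where
  "H0_norm a z = sqrt ((LINT x|lebesgue_on {0<..<1}. a x * (deriv01 (deriv01 (fst z)) x)\<^sup>2)
                     + (LINT x|lebesgue_on {0<..<1}. (snd z x)\<^sup>2))"

definition lincomb :: "real \<Rightarrow> state \<Rightarrow> real \<Rightarrow> state \<Rightarrow> state" where
  "lincomb \<alpha> z \<beta> w = ((\<lambda>x. \<alpha> * fst z x + \<beta> * fst w x), (\<lambda>x. \<alpha> * snd z x + \<beta> * snd w x))"

definition H0_dist :: "(real \<Rightarrow> real) \<Rightarrow> state \<Rightarrow> state \<Rightarrow> real" where
  "H0_dist a z w = H0_norm a (lincomb 1 z (-1) w)"

definition H0_eq :: "(real \<Rightarrow> real) \<Rightarrow> state \<Rightarrow> state \<Rightarrow> bool" where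
  "H0_eq a z w \<longleftrightarrow> H0_dist a z w = 0"

text \<open>
  The requirement that \<open>a u''\<close> lies in \<open>H\<^sup>2(0,1)\<close> concerns its class modulo null sets, and
  \<open>(a u'')(0)\<close> is the value at \<open>0\<close> of the continuous representative \<open>p\<close>.  (The pointwise product
  \<open>a 0 * u'' 0\<close> would be \<open>0\<close> in any case.)
\<close>

definition dom_A :: "(real \<Rightarrow> real) \<Rightarrow> (real \<Rightarrow> real) set" where
  "dom_A a = {u \<in> H2a0 a. \<exists>p\<in>H2.
     (AE x in lebesgue_on {0<..<1}. p x = a x * deriv01 (deriv01 u) x) \<and>
     (strongly_degenerate a \<longrightarrow> p 0 = 0)}"

definition op_A :: "(real \<Rightarrow> real) \<Rightarrow> (real \<Rightarrow> real) \<Rightarrow> real \<Rightarrow> real" where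
  "op_A a u = deriv01 (deriv01 (\<lambda>x. a x * deriv01 (deriv01 u) x))"

definition dom_cA :: "(real \<Rightarrow> real) \<Rightarrow> state set" where
  "dom_cA a = dom_A a \<times> H2a0 a"

definition op_cA :: "(real \<Rightarrow> real) \<Rightarrow> state \<Rightarrow> state" where
  "op_cA a z = (snd z, \<lambda>x. - op_A a (fst z) x)"

definition contraction_semigroup :: "(real \<Rightarrow> real) \<Rightarrow> (real \<Rightarrow> state \<Rightarrow> state) \<Rightarrow> bool" where
  "contraction_semigroup a S \<longleftrightarrow>
     (\<forall>t\<ge>0. \<forall>z\<in>H0 a. S t z \<in> H0 a) \<and>
     (\<forall>t\<ge>0. \<forall>z\<in>H0 a. \<forall>w\<in>H0 a. \<forall>\<alpha> \<beta>.
        H0_eq a (S t (lincomb \<alpha> z \<beta> w)) (lincomb \<alpha> (S t z) \<beta> (S t w))) \<and>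
     (\<forall>z\<in>H0 a. H0_eq a (S 0 z) z) \<and>
     (\<forall>s\<ge>0. \<forall>t\<ge>0. \<forall>z\<in>H0 a. H0_eq a (S (s + t) z) (S s (S t z))) \<and>
     (\<forall>t\<ge>0. \<forall>z\<in>H0 a. H0_norm a (S t z) \<le> H0_norm a z) \<and>
     (\<forall>z\<in>H0 a. ((\<lambda>t. H0_dist a (S t z) z) \<longlongrightarrow> 0) (at_right 0))"

text \<open>
  The infinitesimal generator of \<open>S\<close> is exactly the operator \<open>op_cA a\<close> with domain \<open>dom_cA a\<close>
  (both understood modulo \<open>H0_eq a\<close>).
\<close>

definition generated_by_cA :: "(real \<Rightarrow> real) \<Rightarrow> (real \<Rightarrow> state \<Rightarrow> state) \<Rightarrow> bool" where
  "generated_by_cA a S \<longleftrightarrow>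
     (\<forall>z\<in>H0 a. \<forall>w\<in>H0 a.
        ((\<lambda>t. H0_dist a (lincomb (1 / t) (S t z) (- 1 / t) z) w) \<longlongrightarrow> 0) (at_right 0) \<longleftrightarrow>
        (\<exists>\<zeta>\<in>dom_cA a. H0_eq a \<zeta> z \<and> H0_eq a (op_cA a \<zeta>) w))"

text \<open>
  \<open>y t\<close> and \<open>yt t\<close> are the two components \<open>y(t,\<cdot>)\<close> and \<open>y\<^sub>t(t,\<cdot>)\<close> of the semigroup orbit of the
  initial data.  The boundary conditions are part of \<open>H2a0 a\<close> and \<open>dom_A a\<close>.
\<close>

definition mild_solution ::
  "(real \<Rightarrow> real) \<Rightarrow> state \<Rightarrow> (real \<Rightarrow> real \<Rightarrow> real) \<Rightarrow> (real \<Rightarrow> real \<Rightarrow> real) \<Rightarrow> bool" where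
  "mild_solution a z y yt \<longleftrightarrow>
     z \<in> H0 a \<and>
     (\<exists>S. contraction_semigroup a S \<and> generated_by_cA a S \<and>
          (\<forall>t\<ge>0. (y t, yt t) \<in> H0 a \<and> H0_eq a (y t, yt t) (S t z)))"

definition classical_solution ::
  "(real \<Rightarrow> real) \<Rightarrow> state \<Rightarrow> (real \<Rightarrow> real \<Rightarrow> real) \<Rightarrow> (real \<Rightarrow> real \<Rightarrow> real) \<Rightarrow> bool" where
  "classical_solution a z y yt \<longleftrightarrow> z \<in> dom_cA a \<and> mild_solution a z y yt"

text \<open>
  \<open>w\<close> is the trace \<open>y\<^sub>x\<^sub>x(\<cdot>,1)\<close> on \<open>(0,T)\<close> of the mild solution with initial data \<open>z\<close>.  For a
  classical solution the trace is the pointwise value of \<open>y\<^sub>x\<^sub>x\<close>, which is continuous near \<open>x = 1\<close>.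
\<close>

definition trace_yxx ::
  "(real \<Rightarrow> real) \<Rightarrow> real \<Rightarrow> state \<Rightarrow> (real \<Rightarrow> real) \<Rightarrow> bool" where
  "trace_yxx a T z w \<longleftrightarrow>
     (\<exists>\<zeta> Y Yt. (\<forall>n. classical_solution a (\<zeta> n) (Y n) (Yt n)) \<and>
        (\<lambda>n::nat. H0_dist a (\<zeta> n) z) \<longlonglongrightarrow> 0 \<and>
        L2_limit_on {0<..<T} (\<lambda>n t. deriv01 (deriv01 (Y n t)) 1) w)"

definition energy ::
  "(real \<Rightarrow> real) \<Rightarrow> (real \<Rightarrow> real \<Rightarrow> real) \<Rightarrow> (real \<Rightarrow> real \<Rightarrow> real) \<Rightarrow> real \<Rightarrow> real" where
  "energy a y yt t =
     1/2 * (LINT x|lebesgue_on {0<..<1}. (yt t x)\<^sup>2 + a x * (deriv01 (deriv01 (y t)) x)\<^sup>2)"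

end

(* The estimate comes from the multiplier x^2 y_x.  For data in the domain of the generator, the
   derivative of phi(t) = int_0^1 y_t x^2 y_x dx is a(1) y_xx(t,1)^2 / 2 plus integrals which the
   degeneracy bound x |a'| <= K a and pointwise bounds for y_x (Cauchy-Schwarz with a(x) >= a(1) x^K)
   control by the energy.  As the semigroup is contractive, integrating over (0,T) and bounding phi(0)
   and phi(T) by the energy gives the estimate for classical solutions; it passes to mild ones by
   density, the trace being defined as an L^2 limit.

   The regularity behind the integrations by parts is that an absolutely continuous function is
   differentiable almost everywhere and is recovered from its derivative.  Differentiability follows
   from two nested Vitali coverings. *)

theory Submission
  imports Defs
begin

section \<open>Absolutely continuous functions and the fundamental theorem of calculus\<close>

text \<open>In the strongly degenerate case u' may be unbounded at 0; what is available there is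
  u'(x)^2 <= C \<open>W x\<close>, with \<open>W x\<close> at most x^(-K). The weight x^2 is matched
  to this: each boundary term at e that has to be estimated contains e |u'(e)| or e^2 / a(e), so it
  is at most of order e^(1 - K/2) and vanishes because K < 2. The number (6 + K) / 2 comes from the
  terms quadratic in u''; the summand next to it bounds the integral of |a'| u'^2, the point where
  the weak and the strong estimate part; 1 / (a(1) (2 - K)) comes from the double integral that
  controls u' in L2 by the energy. A second obstacle is that states are functions, while the
  semigroup laws hold up to energy seminorm 0. So \<open>S t z\<close> itself need not lie in
  \<open>dom_cA a\<close>; some representative does, and trace, multiplier form and norm must be
  shown not to depend on the representative. Moreover the generator is given by a right-hand limit
  at time 0, from which linearity and contraction have to produce a two-sided derivative at every
  time.\<close>

definition increment :: "(real \<Rightarrow> real) \<Rightarrow> real set \<Rightarrow> real" where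
  "increment f k = f (Sup k) - f (Inf k)"

text \<open>Intervals of a division are indexed by themselves and those of a tagged division by
  pairs, so the enumeration by numbers in \<open>abs_cont_on\<close> is traded for an arbitrary
  finite index set.\<close>

lemma abs_cont_on_finite:
  assumes ac: "abs_cont_on c d f" and e: "0 < \<epsilon>"
  shows "\<exists>\<delta>>0. \<forall>(A :: 'i set) l r. finite A \<longrightarrow> (\<forall>i\<in>A. c \<le> l i \<and> l i \<le> r i \<and> r i \<le> d) \<longrightarrow>
       (\<forall>i\<in>A. \<forall>j\<in>A. i \<noteq> j \<longrightarrow> {l i<..<r i} \<inter> {l j<..<r j} = {}) \<longrightarrow>
       (\<Sum>i\<in>A. r i - l i) < \<delta> \<longrightarrow> (\<Sum>i\<in>A. \<bar>f (r i) - f (l i)\<bar>) < \<epsilon>"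
proof -
  obtain \<delta> where d0: "0 < \<delta>" and D0: "\<forall>(n::nat) (l::nat \<Rightarrow> real) (r::nat \<Rightarrow> real).
        (\<forall>i<n. c \<le> l i \<and> l i \<le> r i \<and> r i \<le> d) \<longrightarrow>
        (\<forall>i<n. \<forall>j<n. i \<noteq> j \<longrightarrow> {l i<..<r i} \<inter> {l j<..<r j} = {}) \<longrightarrow>
        (\<Sum>i<n. r i - l i) < \<delta> \<longrightarrow>
        (\<Sum>i<n. \<bar>f (r i) - f (l i)\<bar>) < \<epsilon>"
    using ac[unfolded abs_cont_on_def, THEN spec, THEN mp, OF e] by (elim exE conjE) (rule that)
  note D = D0[THEN spec, THEN spec, THEN spec, THEN mp, THEN mp, THEN mp]
  show ?thesis
  proof (intro exI[of _ \<delta>] conjI[OF d0] allI impI)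
    fix A :: "'i set" and l r :: "'i \<Rightarrow> real"
    assume A: "finite A" and lr: "\<forall>i\<in>A. c \<le> l i \<and> l i \<le> r i \<and> r i \<le> d"
      and dj: "\<forall>i\<in>A. \<forall>j\<in>A. i \<noteq> j \<longrightarrow> {l i<..<r i} \<inter> {l j<..<r j} = {}"
      and s: "(\<Sum>i\<in>A. r i - l i) < \<delta>"
    obtain h where h: "bij_betw h {..<card A} A"
      using ex_bij_betw_nat_finite[OF A] by (auto simp: atLeast0LessThan)
    have mem: "h i \<in> A" if "i < card A" for i
      using h that by (auto simp: bij_betw_def)
    have neq: "h i \<noteq> h j" if "i < card A" "j < card A" "i \<noteq> j" for i j
      using h that by (auto simp: bij_betw_def inj_on_def)
    have "(\<Sum>i<card A. \<bar>f (r (h i)) - f (l (h i))\<bar>) < \<epsilon>"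
    proof (rule D)
      show "(\<Sum>i<card A. r (h i) - l (h i)) < \<delta>"
        using s sum.reindex_bij_betw[OF h, of "\<lambda>i. r i - l i"] by simp
    qed (use mem neq lr dj in auto)
    then show "(\<Sum>i\<in>A. \<bar>f (r i) - f (l i)\<bar>) < \<epsilon>"
      using sum.reindex_bij_betw[OF h, of "\<lambda>i. \<bar>f (r i) - f (l i)\<bar>"] by simp
  qed
qed

lemma abs_cont_on_division:
  assumes ac: "abs_cont_on c d f" and e: "0 < \<epsilon>"
  obtains \<delta> where "0 < \<delta>"
    "\<And>D. D division_of \<Union>D \<Longrightarrow> \<Union>D \<subseteq> {c..d} \<Longrightarrow> sum (measure lborel) D < \<delta> \<Longrightarrow>
       (\<Sum>k\<in>D. \<bar>increment f k\<bar>) < \<epsilon>"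
proof -
  obtain \<delta> where d0: "0 < \<delta>" and D0:
    "\<forall>(A :: real set set) l r. finite A \<longrightarrow> (\<forall>i\<in>A. c \<le> l i \<and> l i \<le> r i \<and> r i \<le> d) \<longrightarrow>
       (\<forall>i\<in>A. \<forall>j\<in>A. i \<noteq> j \<longrightarrow> {l i<..<r i} \<inter> {l j<..<r j} = {}) \<longrightarrow>
       (\<Sum>i\<in>A. r i - l i) < \<delta> \<longrightarrow> (\<Sum>i\<in>A. \<bar>f (r i) - f (l i)\<bar>) < \<epsilon>"
    using abs_cont_on_finite[OF ac e] by (elim exE conjE) (rule that)
  note D = D0[THEN spec, THEN spec, THEN spec, THEN mp, THEN mp, THEN mp, THEN mp]
  show thesis
  proof (rule that[OF d0])
    fix D assume div: "D division_of \<Union>D" and sub: "\<Union>D \<subseteq> {c..d}" and s: "sum (measure lborel) D < \<delta>"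
    have k: "\<exists>a b. a \<le> b \<and> k = {a..b}" if "k \<in> D" for k
      using division_ofD(3,4)[OF div that] by (metis atLeastatMost_empty_iff2 box_real(2))
    show "(\<Sum>k\<in>D. \<bar>increment f k\<bar>) < \<epsilon>"
      unfolding increment_def
    proof (rule D)
      show "finite D" using div by blast
      show "\<forall>k\<in>D. c \<le> Inf k \<and> Inf k \<le> Sup k \<and> Sup k \<le> d"
      proof
        fix k assume "k \<in> D"
        then show "c \<le> Inf k \<and> Inf k \<le> Sup k \<and> Sup k \<le> d" using k[of k] sub by fastforce
      qed
      have "{Inf k<..<Sup k} \<inter> {Inf k'<..<Sup k'} = {}" if "k \<in> D" "k' \<in> D" "k \<noteq> k'" for k k'
        using k[OF that(1)] k[OF that(2)] division_ofD(5)[OF div that] by auto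
      then show "\<forall>k\<in>D. \<forall>k'\<in>D. k \<noteq> k' \<longrightarrow> {Inf k<..<Sup k} \<inter> {Inf k'<..<Sup k'} = {}" by blast
      have "(\<Sum>k\<in>D. Sup k - Inf k) = sum (measure lborel) D"
        by (rule sum.cong) (use k in fastforce)+
      then show "(\<Sum>k\<in>D. Sup k - Inf k) < \<delta>" using s by simp
    qed
  qed
qed

lemma sum_increment_division:
  assumes "c \<le> d" "D division_of {c..d}"
  shows "sum (increment f) D = f d - f c"
proof -
  \<comment> \<open>Operativity forces the value 0 on the empty interval, where \<open>Sup\<close>
    and \<open>Inf\<close> of reals are unspecified.\<close>
  let ?g = "\<lambda>k. if k = {} then 0 else increment f k"
  have 1: "operative_real plus 0 ?g"
  proof unfold_locales
    fix a b :: real assume "b \<le> a"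
    then show "?g {a..b} = 0" by (cases "a = b") (simp_all add: increment_def)
  next
    fix a b e :: real assume "a < e" "e < b"
    then show "?g {a..e} + ?g {e..b} = ?g {a..b}" by (simp add: increment_def)
  qed
  interpret operative_real plus 0 ?g
    rewrites "comm_monoid_set.F (+) 0 = sum"
     apply (rule 1)
    apply (simp only: sum_def)
    done
  have 2: "sum (\<lambda>k. if k = {} then 0 else increment f k) D = (if {c..d} = {} then 0 else increment f {c..d})"
    by (rule division[of D c d, unfolded box_real, OF assms(2)])
  have 3: "sum (\<lambda>k. if k = {} then 0 else increment f k) D = sum (increment f) D"
    by (rule sum.cong) (use division_ofD(3)[OF assms(2)] in simp_all)
  have 4: "increment f {c..d} = f d - f c"
    using assms(1) unfolding increment_def  by (simp only: cSup_atLeastAtMost cInf_atLeastAtMost)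
  have 5: "{c..d} \<noteq> {}" using assms(1) by (simp only: atLeastatMost_empty_iff simp_thms)
  show ?thesis
    using trans[OF 3[symmetric] 2] unfolding if_not_P[OF 5] 4 .
qed

text \<open>The difference of the two sums is the sum of the increments over the gaps between the intervals of \<open>G\<close>.\<close>

lemma abs_cont_on_refine:
  assumes ac: "abs_cont_on c d f" and e: "0 < \<epsilon>" and cd: "c \<le> d"
  obtains \<delta> where "0 < \<delta>"
    "\<And>F G. F division_of \<Union>F \<Longrightarrow> \<Union>F \<subseteq> {c..d} \<Longrightarrow> G division_of \<Union>G \<Longrightarrow>
       (\<And>J. J \<in> G \<Longrightarrow> interior J \<noteq> {} \<and> (\<exists>I\<in>F. J \<subseteq> I)) \<Longrightarrow>
       sum (measure lborel) F - sum (measure lborel) G < \<delta> \<Longrightarrow>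
       \<bar>sum (increment f) F - sum (increment f) G\<bar> < \<epsilon>"
proof -
  obtain \<delta> where d0: "0 < \<delta>" and D: "\<And>D. D division_of \<Union>D \<Longrightarrow> \<Union>D \<subseteq> {c..d} \<Longrightarrow>
       sum (measure lborel) D < \<delta> \<Longrightarrow> (\<Sum>k\<in>D. \<bar>increment f k\<bar>) < \<epsilon>"
    using abs_cont_on_division[OF ac e] by metis
  show thesis
  proof (rule that[OF d0])
    fix F G assume F: "F division_of \<Union>F" "\<Union>F \<subseteq> {c..d}" and G: "G division_of \<Union>G"
      and GF: "\<And>J. J \<in> G \<Longrightarrow> interior J \<noteq> {} \<and> (\<exists>I\<in>F. J \<subseteq> I)"
      and s: "sum (measure lborel) F - sum (measure lborel) G < \<delta>"
    obtain P where P: "F \<subseteq> P" "P division_of {c..d}"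
      using partial_division_extend[OF F(1) division_of_self[of c d] ] cd F(2)
      by (metis atLeastatMost_empty_iff2 box_real(2) linorder_not_le)
    \<comment> \<open>The members of \<open>P\<close> outside \<open>F\<close> are kept, so whatever
      completes \<open>?Q0\<close> to a division of [c,d] has the total length of \<open>F\<close>
      minus that of \<open>G\<close>, and carries the difference of the increments.\<close>
    let ?Q0 = "G \<union> (P - F)"
    have dj: "interior J \<inter> interior K = {}" if "J \<in> G" "K \<in> P - F" for J K
    proof -
      obtain I where "I \<in> F" "J \<subseteq> I" using GF \<open>J \<in> G\<close> by blast
      then show ?thesis
        using division_ofD(5)[OF P(2), of I K] that P(1) interior_mono[of J I] by blast
    qed
    have Q0: "?Q0 division_of \<Union>?Q0"
      unfolding division_of_def
    proof (intro conjI ballI impI)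
      show "finite ?Q0" using G P by blast
      fix K1 assume "K1 \<in> ?Q0"
      then show "K1 \<subseteq> \<Union>?Q0" "K1 \<noteq> {}" "\<exists>a b. K1 = cbox a b"
        using division_ofD(3,4)[OF G] division_ofD(3,4)[OF P(2)] by blast+
      fix K2 assume K2: "K2 \<in> ?Q0" "K1 \<noteq> K2"
      then show "interior K1 \<inter> interior K2 = {}"
        using \<open>K1 \<in> ?Q0\<close> dj division_ofD(5)[OF G, of K1 K2] division_ofD(5)[OF P(2), of K1 K2] by blast
    qed simp
    have "\<Union>?Q0 \<subseteq> {c..d}"
      using GF F(2) division_ofD(6)[OF P(2)] by blast
    then obtain Q where Q: "?Q0 \<subseteq> Q" "Q division_of {c..d}"
      using partial_division_extend[OF Q0 division_of_self[of c d]] cd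
      by (metis atLeastatMost_empty_iff2 box_real(2) linorder_not_le)
    have fin: "finite P" "finite Q" "finite G" "finite F" using P Q G F by blast+
    have GP: "G \<inter> (P - F) = {}"
      using dj GF by blast
    have split: "sum h P = sum h F + sum h (P - F)"
      "sum h Q = sum h G + sum h (P - F) + sum h (Q - ?Q0)" for h :: "real set \<Rightarrow> real"
      using sum.subset_diff[OF P(1) fin(1), of h] sum.subset_diff[OF Q(1) fin(2), of h]
        sum.union_disjoint[OF fin(3) _ GP, of h] fin by (auto simp: algebra_simps)
    have "sum (measure lborel) (Q - ?Q0) = sum (measure lborel) F - sum (measure lborel) G"
      using split[of "measure lborel"] additive_content_division[of P c d] additive_content_division[of Q c d] P Q
      by simp
    moreover have "sum (increment f) F - sum (increment f) G = sum (increment f) (Q - ?Q0)"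
      using split[of "increment f"] sum_increment_division[OF cd] P Q by fastforce
    moreover have "(Q - ?Q0) division_of \<Union>(Q - ?Q0)"
      using division_of_subset[OF division_of_union_self[OF Q(2)]] by blast
    moreover have "\<Union>(Q - ?Q0) \<subseteq> {c..d}" using Q by blast
    ultimately have "(\<Sum>k\<in>Q - ?Q0. \<bar>increment f k\<bar>) < \<epsilon>" "sum (increment f) F - sum (increment f) G = sum (increment f) (Q - ?Q0)"
      using D s by auto
    then show "\<bar>sum (increment f) F - sum (increment f) G\<bar> < \<epsilon>"
      using sum_abs[of "increment f" "Q - ?Q0"] by linarith
  qed
qed

text \<open>For the gauge integral everything lies in the choice of the gauge. A tag outside
  \<open>N\<close> gets a ball on which the linear approximation is accurate; a tag in
  \<open>N\<close> gets an open set \<open>U\<close> of measure below the \<delta> of absolute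
  continuity, so the increments over the intervals tagged in \<open>N\<close> sum to less than e/2.
  Integrability of the derivative is part of the conclusion.\<close>

lemma fundamental_theorem_of_calculus_abs_cont:
  fixes f :: "real \<Rightarrow> real"
  assumes ac: "abs_cont_on c d f" and cd: "c \<le> d" and N: "negligible N"
    and der: "\<And>x. x \<in> {c..d} - N \<Longrightarrow> (f has_vector_derivative f' x) (at x within {c..d})"
  shows "(f' has_integral (f d - f c)) {c..d}"
proof -
  define g where "g x = (if x \<in> N then 0 else f' x)" for x
  have "(g has_integral (f d - f c)) {c..d}"
    unfolding box_real[symmetric] has_integral
  proof (intro allI impI)
    fix e :: real assume e: "0 < e"
    \<comment> \<open>The summand 1 keeps the denominator positive when c = d.\<close>
    define e' where "e' = e / (2 * (d - c + 1))"
    have e': "0 < e'" "e' * (d - c) < e / 2" using e cd by (auto simp: e'_def field_simps)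
    obtain \<delta> where d0: "0 < \<delta>" and D0:
      "\<forall>(A :: (real \<times> real set) set) l r. finite A \<longrightarrow> (\<forall>i\<in>A. c \<le> l i \<and> l i \<le> r i \<and> r i \<le> d) \<longrightarrow>
         (\<forall>i\<in>A. \<forall>j\<in>A. i \<noteq> j \<longrightarrow> {l i<..<r i} \<inter> {l j<..<r j} = {}) \<longrightarrow>
         (\<Sum>i\<in>A. r i - l i) < \<delta> \<longrightarrow> (\<Sum>i\<in>A. \<bar>f (r i) - f (l i)\<bar>) < e / 2"
      using abs_cont_on_finite[OF ac half_gt_zero[OF e]] by (elim exE conjE) (rule that)
    note D = D0[THEN spec, THEN spec, THEN spec, THEN mp, THEN mp, THEN mp, THEN mp]
    have "N \<in> sets lebesgue" using N negligible_imp_sets by blast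
    then obtain U where U: "open U" "N \<subseteq> U" "(U - N) \<in> lmeasurable" "emeasure lebesgue (U - N) < ennreal \<delta>"
      using sets_lebesgue_outer_open d0 by blast
    have UU: "U \<in> lmeasurable" "measure lebesgue U < \<delta>"
    proof -
      have "U = (U - N) \<union> N" using U by blast
      moreover have "N \<in> lmeasurable" "measure lebesgue N = 0"
        using N negligible_imp_measurable negligible_imp_measure0 by blast+
      ultimately show "U \<in> lmeasurable" using U(3) by (metis fmeasurable.Un)
      have "measure lebesgue U = measure lebesgue (U - N)"
        using N U(2) \<open>U \<in> lmeasurable\<close> by (simp add: measure_Diff_null_set negligible_iff_null_sets)
      then show "measure lebesgue U < \<delta>"
        using U(3,4) d0 by (metis emeasure_eq_measure2 ennreal_less_iff measure_nonneg)
    qed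
    have "\<exists>\<eta>>0. \<forall>y\<in>{c..d}. \<bar>y - x\<bar> < \<eta> \<longrightarrow> \<bar>f y - f x - f' x * (y - x)\<bar> \<le> e' * \<bar>y - x\<bar>"
      if "x \<in> {c..d} - N" for x
      using der[OF that] e'(1) unfolding has_vector_derivative_def has_derivative_within_alt
      by (auto simp: algebra_simps)
    then obtain \<eta> where \<eta>: "\<And>x. x \<in> {c..d} - N \<Longrightarrow> 0 < \<eta> x"
      "\<And>x y. x \<in> {c..d} - N \<Longrightarrow> y \<in> {c..d} \<Longrightarrow> \<bar>y - x\<bar> < \<eta> x \<Longrightarrow> \<bar>f y - f x - f' x * (y - x)\<bar> \<le> e' * \<bar>y - x\<bar>"
      by metis
    define \<gamma> where "\<gamma> x = (if x \<in> N then U else if x \<in> {c..d} then ball x (\<eta> x) else UNIV)" for x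
    show "\<exists>\<gamma>. gauge \<gamma> \<and> (\<forall>\<D>. \<D> tagged_division_of cbox c d \<and> \<gamma> fine \<D> \<longrightarrow>
              norm ((\<Sum>(x, k)\<in>\<D>. measure lborel k *\<^sub>R g x) - (f d - f c)) < e)"
    proof (intro exI conjI allI impI)
      show "gauge \<gamma>"
        unfolding gauge_def \<gamma>_def using U \<eta>(1) by auto
      fix p assume p: "p tagged_division_of cbox c d \<and> \<gamma> fine p"
      then have pt: "p tagged_division_of {c..d}" and fine: "\<And>x k. (x, k) \<in> p \<Longrightarrow> k \<subseteq> \<gamma> x"
        by (auto simp: fine_def)
      note pD = tagged_division_ofD[OF pt]
      have k: "\<exists>a b. a \<le> x \<and> x \<le> b \<and> c \<le> a \<and> b \<le> d \<and> k = {a..b}" if kp: "(x, k) \<in> p" for x k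
      proof -
        obtain a b where "k = {a..b}" using pD(4)[OF kp] by auto
        then show ?thesis using pD(2,3)[OF kp] by auto
      qed
      define A where "A = {t \<in> p. fst t \<in> N}"
      have fin: "finite p" "finite A" using pD(1) by (auto simp: A_def)
      let ?h = "\<lambda>t. measure lborel (snd t) * g (fst t) - (f (Sup (snd t)) - f (Inf (snd t)))"
      have "(\<Sum>(x, k)\<in>p. measure lborel k *\<^sub>R g x) - (f d - f c) = (\<Sum>t\<in>p. ?h t)"
        using additive_tagged_division_1[OF cd pt, of f]
        by (simp add: sum_subtractf case_prod_beta)
      also have "\<dots> = (\<Sum>t\<in>A. ?h t) + (\<Sum>t\<in>p - A. ?h t)"
        using sum.subset_diff[of A p ?h] fin by (auto simp: A_def)
      finally have eq: "(\<Sum>(x, k)\<in>p. measure lborel k *\<^sub>R g x) - (f d - f c) = (\<Sum>t\<in>A. ?h t) + (\<Sum>t\<in>p - A. ?h t)" .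
      have "(\<Sum>t\<in>A. \<bar>f (Sup (snd t)) - f (Inf (snd t))\<bar>) < e / 2"
      proof (rule D)
        show "\<forall>t\<in>A. c \<le> Inf (snd t) \<and> Inf (snd t) \<le> Sup (snd t) \<and> Sup (snd t) \<le> d"
        proof
          fix t assume "t \<in> A"
          then show "c \<le> Inf (snd t) \<and> Inf (snd t) \<le> Sup (snd t) \<and> Sup (snd t) \<le> d"
            using k[of "fst t" "snd t"] by (auto simp: A_def)
        qed
        have "{Inf (snd t)<..<Sup (snd t)} \<inter> {Inf (snd t')<..<Sup (snd t')} = {}"
          if "t \<in> A" "t' \<in> A" "t \<noteq> t'" for t t'
        proof -
          have tt: "(fst t, snd t) \<in> p" "(fst t', snd t') \<in> p" using that by (auto simp: A_def)
          show ?thesis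
            using pD(5)[OF tt] that k[OF tt(1)] k[OF tt(2)] by (auto simp: prod_eq_iff)
        qed
        then show "\<forall>t\<in>A. \<forall>t'\<in>A. t \<noteq> t' \<longrightarrow> {Inf (snd t)<..<Sup (snd t)} \<inter> {Inf (snd t')<..<Sup (snd t')} = {}"
          by blast
        have "(\<Sum>t\<in>A. Sup (snd t) - Inf (snd t)) = (\<Sum>t\<in>A. measure lborel (snd t))"
        proof (rule sum.cong[OF refl])
          fix t assume "t \<in> A"
          then show "Sup (snd t) - Inf (snd t) = measure lborel (snd t)"
            using k[of "fst t" "snd t"] by (auto simp: A_def)
        qed
        also have "\<dots> = (\<Sum>(x,k)\<in>A. measure lborel k)" by (simp add: case_prod_beta)
        also have "\<dots> \<le> measure lebesgue U"
        proof -
          have Ap: "A tagged_partial_division_of {c..d}"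
            using pt tagged_partial_division_subset[of p "{c..d}" A] by (auto simp: tagged_division_of_def A_def)
          have At: "A tagged_division_of (\<Union>{k. \<exists>x. (x, k) \<in> A})"
            using tagged_partial_division_of_Union_self[OF Ap] by (simp add: image_def Bex_def)
          then have div: "snd ` A division_of (\<Union>{k. \<exists>x. (x, k) \<in> A})"
            by (rule division_of_tagged_division)
          \<comment> \<open>Two different tags can share an interval only if its interior is empty;
            its length is then 0, so passing from tagged intervals to the set of intervals does not
            change the sum.\<close>
          have "(\<Sum>(x,k)\<in>A. measure lborel k) = sum (measure lborel) (snd ` A)"
            by (rule sum.over_tagged_division_lemma[OF At]) (simp add: content_eq_0_interior)
          also have "\<dots> = sum (measure lebesgue) (snd ` A)"
          proof (rule sum.cong[OF refl])
            fix k' assume "k' \<in> snd ` A"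
            then obtain a b where "k' = {a..b}" using k by (force simp: A_def)
            then show "measure lborel k' = measure lebesgue k'" by simp
          qed
          also have "\<dots> = measure lebesgue (\<Union>{k. \<exists>x. (x, k) \<in> A})"
            by (rule content_division[OF div])
          also have "\<dots> \<le> measure lebesgue U"
          proof (rule measure_mono_fmeasurable)
            show "\<Union>{k. \<exists>x. (x, k) \<in> A} \<subseteq> U"
            proof -
              have "k \<subseteq> U" if "(x,k) \<in> A" for x k
                using fine[of x k] that by (auto simp: A_def \<gamma>_def)
              then show ?thesis by blast
            qed
            show "\<Union>{k. \<exists>x. (x, k) \<in> A} \<in> sets lebesgue"
              using lmeasurable_division[OF div] by blast
          qed (use UU in auto)
          finally show ?thesis .
        qed
        also have "\<dots> < \<delta>" using UU by simp
        finally show "(\<Sum>t\<in>A. Sup (snd t) - Inf (snd t)) < \<delta>" .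
      qed (use fin in auto)
      moreover have "\<bar>\<Sum>t\<in>A. ?h t\<bar> \<le> (\<Sum>t\<in>A. \<bar>f (Sup (snd t)) - f (Inf (snd t))\<bar>)"
      proof -
        have "(\<Sum>t\<in>A. \<bar>?h t\<bar>) = (\<Sum>t\<in>A. \<bar>f (Sup (snd t)) - f (Inf (snd t))\<bar>)"
          by (rule sum.cong) (auto simp: A_def g_def)
        then show ?thesis using sum_abs[of ?h A] by simp
      qed
      moreover have "\<bar>\<Sum>t\<in>p - A. ?h t\<bar> \<le> e' * (d - c)"
      proof -
        have "\<bar>\<Sum>t\<in>p - A. ?h t\<bar> \<le> (\<Sum>t\<in>p - A. e' * measure lborel (snd t))"
        proof (rule order_trans[OF sum_abs], rule sum_mono)
          fix t assume t: "t \<in> p - A"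
          obtain x k' where tx: "t = (x, k')" by force
          then obtain a b where ab: "a \<le> x" "x \<le> b" "c \<le> a" "b \<le> d" "k' = {a..b}"
            using k t by blast
          have xN: "x \<in> {c..d} - N" using t tx ab by (auto simp: A_def)
          have sb: "{a..b} \<subseteq> ball x (\<eta> x)" using fine[of x k'] t tx ab xN by (auto simp: \<gamma>_def)
          moreover have "a \<in> {a..b}" "b \<in> {a..b}" using ab by auto
          ultimately have "a \<in> ball x (\<eta> x)" "b \<in> ball x (\<eta> x)" by (blast intro: subsetD)+
          then have "\<bar>f a - f x - f' x * (a - x)\<bar> \<le> e' * \<bar>a - x\<bar>" "\<bar>f b - f x - f' x * (b - x)\<bar> \<le> e' * \<bar>b - x\<bar>"
            using \<eta>(2)[OF xN, of a] \<eta>(2)[OF xN, of b] ab by (simp_all add: dist_real_def)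
          then have "\<bar>(b - a) * f' x - (f b - f a)\<bar> \<le> e' * (b - a)"
            using ab by (auto simp: algebra_simps abs_le_iff)
          then show "\<bar>?h t\<bar> \<le> e' * measure lborel (snd t)"
            using tx ab xN by (simp add: g_def)
        qed
        also have "\<dots> \<le> (\<Sum>t\<in>p. e' * measure lborel (snd t))"
          by (rule sum_mono2) (use fin e' in auto)
        also have "\<dots> = e' * (d - c)"
          using additive_content_tagged_division[of p c d] pt cd
          by (simp add: sum_distrib_left[symmetric] case_prod_beta)
        finally show ?thesis .
      qed
      ultimately show "norm ((\<Sum>(x, k)\<in>p. measure lborel k *\<^sub>R g x) - (f d - f c)) < e"
        unfolding eq using e'(2) by simp
    qed
  qed
  then show ?thesis
    by (rule has_integral_spike[OF N, rotated]) (auto simp: g_def)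
qed

section \<open>Differentiability almost everywhere\<close>

definition slope :: "(real \<Rightarrow> real) \<Rightarrow> real \<Rightarrow> real \<Rightarrow> real" where
  "slope f x y = (f y - f x) / (y - x)"

lemma slope_commute: "slope f x y = slope f y x"
  using minus_divide_divide[of "f y - f x" "y - x"] by (simp only: slope_def minus_diff_eq)

text \<open>If the slopes stay bounded and no rational gap separates their lower from their upper
  limit, both limits agree and are finite, which is differentiability. Rational levels keep the
  exceptional set a countable union.\<close>

lemma not_differentiable_slope_cases:
  fixes f :: "real \<Rightarrow> real"
  assumes "\<not> f differentiable (at x)"
  shows "(\<forall>N::nat. \<exists>\<^sub>F y in at x. N < \<bar>slope f x y\<bar>) \<or>
    (\<exists>p q :: rat. p < q \<and> (\<exists>\<^sub>F y in at x. slope f x y < of_rat p) \<and> (\<exists>\<^sub>F y in at x. of_rat q < slope f x y))"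
proof (rule ccontr)
  assume neg: "\<not> ?thesis"
  then obtain N :: nat where N: "\<forall>\<^sub>F y in at x. \<bar>slope f x y\<bar> \<le> N"
    by (auto simp: not_frequently not_less)
  define L where "L = Liminf (at x) (\<lambda>y. ereal (slope f x y))"
  define M where "M = Limsup (at x) (\<lambda>y. ereal (slope f x y))"
  have LM: "L \<le> M" unfolding L_def M_def by (rule Liminf_le_Limsup) simp
  have "M \<le> L"
  proof (rule ccontr)
    assume "\<not> M \<le> L"
    then have "L < M" by simp
    then obtain p :: rat where p: "L < real_of_rat p" "real_of_rat p < M"
      using ereal_dense3 by blast
    then obtain q :: rat where q: "real_of_rat p < ereal (real_of_rat q)" "real_of_rat q < M"
      using ereal_dense3 by blast
    have "\<exists>\<^sub>F y in at x. slope f x y < of_rat p"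
    proof (rule ccontr)
      assume "\<not> ?thesis"
      then have "\<forall>\<^sub>F y in at x. ereal (of_rat p) \<le> ereal (slope f x y)"
        by (simp add: not_frequently not_less)
      then have "ereal (of_rat p) \<le> L" unfolding L_def by (rule Liminf_bounded)
      then show False using p by simp
    qed
    moreover have "\<exists>\<^sub>F y in at x. of_rat q < slope f x y"
    proof (rule ccontr)
      assume "\<not> ?thesis"
      then have "\<forall>\<^sub>F y in at x. ereal (slope f x y) \<le> ereal (of_rat q)"
        by (simp add: not_frequently not_less)
      then have "M \<le> ereal (of_rat q)" unfolding M_def by (rule Limsup_bounded)
      then show False using q by simp
    qed
    moreover have "p < q" using q(1) by (simp add: of_rat_less)
    ultimately show False using neg by blast
  qed
  with LM have "L = M" by simp
  then have lim: "((\<lambda>y. ereal (slope f x y)) \<longlongrightarrow> L) (at x)"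
    by (intro Liminf_eq_Limsup) (use \<open>L = M\<close> in \<open>simp_all add: L_def M_def\<close>)
  have "- ereal N \<le> L"
    unfolding L_def by (rule Liminf_bounded) (use N in eventually_elim, auto)
  moreover have "M \<le> ereal N"
    unfolding M_def by (rule Limsup_bounded) (use N in eventually_elim, auto)
  ultimately obtain l where "L = ereal l" using \<open>L = M\<close> by (cases L) auto
  then have "((\<lambda>y. slope f x y) \<longlongrightarrow> l) (at x)" using lim by simp
  then have "(f has_field_derivative l) (at x)"
    by (simp add: has_field_derivative_iff slope_def)
  then show False using assms real_differentiable_def by blast
qed

text \<open>The number \<open>s\<close> is the Lebesgue outer measure of \<open>E\<close>. It lets
  the exceptional sets of slopes be treated before anything is known about their measurability;
  boundedness makes the infimum range over a nonempty set.\<close>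

lemma outer_measure_approx:
  fixes E :: "'a::euclidean_space set"
  assumes "bounded E"
  obtains s where "0 \<le> s" "\<And>T. T \<in> lmeasurable \<Longrightarrow> E \<subseteq> T \<Longrightarrow> s \<le> measure lebesgue T"
    "\<And>e. 0 < e \<Longrightarrow> \<exists>U. open U \<and> U \<in> lmeasurable \<and> E \<subseteq> U \<and> measure lebesgue U < s + e"
proof
  let ?M = "measure lebesgue ` {T \<in> lmeasurable. E \<subseteq> T}"
  define s where "s = Inf ?M"
  obtain r where r: "E \<subseteq> cbox (-r) r" using bounded_subset_cbox_symmetric[OF assms] by metis
  have ne: "?M \<noteq> {}" using r lmeasurable_cbox by blast
  have bdd: "bdd_below ?M" by (rule bdd_belowI[of _ 0]) auto
  show "0 \<le> s" unfolding s_def by (rule cInf_greatest[OF ne]) auto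
  show "s \<le> measure lebesgue T" if "T \<in> lmeasurable" "E \<subseteq> T" for T
    unfolding s_def by (rule cInf_lower[OF _ bdd]) (use that in auto)
  show "\<exists>U. open U \<and> U \<in> lmeasurable \<and> E \<subseteq> U \<and> measure lebesgue U < s + e" if e: "0 < e" for e
  proof -
    have "Inf ?M < s + e/2" using e by (simp add: s_def)
    then obtain T where T: "T \<in> lmeasurable" "E \<subseteq> T" "measure lebesgue T < s + e/2"
      using cInf_lessD[OF ne] by blast
    obtain U where U: "open U" "T \<subseteq> U" "(U - T) \<in> lmeasurable" "emeasure lebesgue (U - T) < ennreal (e/2)"
      using sets_lebesgue_outer_open[of T "e/2"] T(1) e by (auto simp: fmeasurableD)
    have UT: "U = T \<union> (U - T)" using U by blast
    have "U \<in> lmeasurable" using T(1) U(3) UT by (metis fmeasurable.Un)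
    moreover have "measure lebesgue (U - T) < e/2"
      using U(3,4) e by (simp add: emeasure_eq_measure2 ennreal_less_iff)
    moreover have "measure lebesgue U \<le> measure lebesgue T + measure lebesgue (U - T)"
      using UT measure_Un_le[of T lebesgue "U - T"] T(1) U(3) by (metis fmeasurableD)
    ultimately show ?thesis using U T by (intro exI[of _ U]) auto
  qed
qed

text \<open>The Vitali theorem gives countably many disjoint intervals that cover \<open>E\<close>
  up to a null set. They all lie in \<open>U\<close>, which has finite measure, so finitely many of
  them exhaust the union up to \<eta>; the remaining ones and the null set form \<open>W\<close>.
  Finiteness is what makes the family a division, to which absolute continuity applies.\<close>

lemma Vitali_intervals:
  fixes E :: "real set" and P :: "real \<Rightarrow> real \<Rightarrow> bool"
  assumes P: "\<And>x e. x \<in> E \<Longrightarrow> 0 < e \<Longrightarrow> \<exists>l r. l < r \<and> P l r \<and> l \<le> x \<and> x \<le> r \<and> r - l < e"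
    and U: "U \<in> lmeasurable" "\<And>l r. l < r \<Longrightarrow> P l r \<Longrightarrow> {l..r} \<subseteq> U" and \<eta>: "0 < \<eta>"
  shows "\<exists>F W. F division_of \<Union>F \<and> W \<in> lmeasurable \<and> E \<subseteq> \<Union>F \<union> W \<and> measure lebesgue W < \<eta> \<and>
    (\<forall>k\<in>F. \<exists>l r. l < r \<and> P l r \<and> k = {l..r})"
proof -
  let ?K = "{(l, r). l < r \<and> P l r}"
  let ?a = "\<lambda>(l, r). (l + r) / 2 :: real" and ?r = "\<lambda>(l, r). (r - l) / 2 :: real"
  have cb: "cball (?a i) (?r i) = {fst i..snd i}" for i
    by (cases i) (auto simp: cball_eq_atLeastAtMost field_simps)
  have KE: "\<exists>i. i \<in> ?K \<and> x \<in> cball (?a i) (?r i) \<and> ?r i < e" if x: "x \<in> E" and e: "0 < e" for x e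
  proof -
    obtain l r where "l < r" "P l r" "l \<le> x" "x \<le> r" "r - l < e" using P[OF x e] by blast
    then show ?thesis unfolding cb by (intro exI[of _ "(l, r)"]) simp
  qed
  have rpos: "0 < ?r i" if "i \<in> ?K" for i using that by auto
  obtain C where C: "countable C" "C \<subseteq> ?K"
    "pairwise (\<lambda>i j. disjnt (cball (?a i) (?r i)) (cball (?a j) (?r j))) C"
    "negligible (E - (\<Union>i\<in>C. cball (?a i) (?r i)))"
    by (rule Vitali_covering_theorem_cballs[of ?K ?r E ?a, OF rpos KE])
  define D where "D = (\<lambda>i. {fst i..snd i}) ` C"
  have Dk: "\<exists>l r. l < r \<and> P l r \<and> k = {l..r}" if kD: "k \<in> D" for k
  proof -
    obtain i where i: "k = {fst i..snd i}" "i \<in> C" by (rule imageE[OF kD[unfolded D_def]])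
    then have "i \<in> ?K" using C(2) by (intro subsetD[OF C(2)])
    then show ?thesis using i(1) by (intro exI[of _ "fst i"] exI[of _ "snd i"]) (simp add: case_prod_beta)
  qed
  have Ddj: "k \<inter> k' = {}" if kD: "k \<in> D" "k' \<in> D" "k \<noteq> k'" for k k'
  proof -
    obtain i where i: "k = {fst i..snd i}" "i \<in> C" by (rule imageE[OF kD(1)[unfolded D_def]])
    obtain j where j: "k' = {fst j..snd j}" "j \<in> C" by (rule imageE[OF kD(2)[unfolded D_def]])
    have "i \<noteq> j" using kD(3) i(1) j(1) by blast
    from pairwiseD[OF C(3) i(2) j(2) this] show ?thesis unfolding cb disjnt_def i(1) j(1) .
  qed
  have DU: "\<Union>D \<subseteq> U" using Dk U(2) by blast
  have Dm: "k \<in> lmeasurable" if "k \<in> D" for k using Dk[OF that] by auto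
  have cD: "countable D" unfolding D_def using C(1) by blast
  have B: "measure lebesgue (\<Union>D') \<le> measure lebesgue U" if "D' \<subseteq> D" "finite D'" for D'
  proof (rule measure_mono_fmeasurable[OF _ _ U(1)])
    show "\<Union>D' \<subseteq> U" using that DU by blast
    show "\<Union>D' \<in> sets lebesgue" using that Dm by (intro sets.finite_Union) (auto dest: fmeasurableD)
  qed
  obtain F where F: "F \<subseteq> D" "finite F" "measure lebesgue (\<Union>D) - \<eta> < measure lebesgue (\<Union>F)"
    using measure_countable_Union_approachable[OF cD \<eta> Dm B] by metis
  have UD: "\<Union>D \<in> sets lebesgue" using cD Dm by (intro sets.countable_Union) (auto dest: fmeasurableD)
  then have UD': "\<Union>D \<in> lmeasurable" using fmeasurableI2[OF U(1) DU] by blast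
  have UF: "\<Union>F \<in> sets lebesgue" using F Dm by (intro sets.finite_Union) (auto dest: fmeasurableD)
  have FD: "\<Union>F \<subseteq> \<Union>D" using F by blast
  have UF': "\<Union>F \<in> lmeasurable" using fmeasurableI2[OF UD' FD] UF by blast
  let ?N = "E - \<Union>D"
  have N: "negligible ?N" using C(4) unfolding cb D_def by simp
  show ?thesis
  proof (intro exI[of _ F] exI[of _ "(\<Union>D - \<Union>F) \<union> ?N"] conjI)
    show "F division_of \<Union>F"
      unfolding division_of_def
    proof (intro conjI ballI impI)
      show "finite F" by fact
      fix k assume k: "k \<in> F"
      then show "k \<subseteq> \<Union>F" by blast
      obtain l r where "l < r" "k = {l..r}" using Dk k F by blast
      then show "k \<noteq> {}" "\<exists>a b. k = cbox a b" by auto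
      fix k' assume "k' \<in> F" "k \<noteq> k'"
      then have "k \<inter> k' = {}" using Ddj k F by blast
      then show "interior k \<inter> interior k' = {}" using interior_subset by blast
    qed simp
    show Wm: "(\<Union>D - \<Union>F) \<union> ?N \<in> lmeasurable"
      using UD' UF' negligible_imp_measurable[OF N] by blast
    show "E \<subseteq> \<Union>F \<union> ((\<Union>D - \<Union>F) \<union> ?N)" by blast
    have "measure lebesgue ((\<Union>D - \<Union>F) \<union> ?N) \<le> measure lebesgue (\<Union>D - \<Union>F) + measure lebesgue ?N"
      by (rule measure_Un_le) (use UD UF negligible_imp_sets[OF N] in auto)
    also have "\<dots> = measure lebesgue (\<Union>D) - measure lebesgue (\<Union>F)"
      using measurable_measure_Diff[OF UD' UF FD] negligible_imp_measure0[OF N] by simp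
    also have "\<dots> < \<eta>" using F by simp
    finally show "measure lebesgue ((\<Union>D - \<Union>F) \<union> ?N) < \<eta>" .
    show "\<forall>k\<in>F. \<exists>l r. l < r \<and> P l r \<and> k = {l..r}" using Dk F(1) by blast
  qed
qed

text \<open>The nearby point may lie on either side of \<open>x\<close>. As the slope is symmetric
  in its arguments, one condition on the interval serves both sides, and \<open>x\<close> is one of
  its endpoints.\<close>

lemma frequently_slope_interval:
  fixes x :: real
  assumes freq: "\<exists>\<^sub>F y in at x. Q (slope f x y)" and U: "open U" "x \<in> U" and e: "0 < e"
  shows "\<exists>l r. l < r \<and> (Q (slope f l r) \<and> {l..r} \<subseteq> U) \<and> l \<le> x \<and> x \<le> r \<and> r - l < e"
proof -
  obtain \<epsilon> where \<epsilon>: "0 < \<epsilon>" "ball x \<epsilon> \<subseteq> U" using U openE by blast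
  have "\<forall>\<^sub>F y in at x. dist y x < min \<epsilon> e \<and> y \<noteq> x"
    using \<epsilon> e by (auto simp: eventually_at intro!: exI[of _ "min \<epsilon> e"])
  then obtain y where y: "Q (slope f x y)" "dist y x < min \<epsilon> e" "y \<noteq> x"
    using frequently_ex[OF frequently_eventually_frequently[OF freq]] by blast
  have sub: "{min x y..max x y} \<subseteq> U"
  proof -
    have "{min x y..max x y} \<subseteq> ball x \<epsilon>" using y by (auto simp: dist_real_def)
    then show ?thesis using \<epsilon> by blast
  qed
  show ?thesis
  proof (cases "x < y")
    case True
    then show ?thesis using y sub by (intro exI[of _ x] exI[of _ y]) (auto simp: dist_real_def)
  next
    case False
    then show ?thesis using y sub slope_commute[of f x y] by (intro exI[of _ y] exI[of _ x]) (auto simp: dist_real_def)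
  qed
qed

lemma sum_content_division_eq_measure:
  fixes F :: "real set set"
  assumes "F division_of \<Union>F"
  shows "sum (measure lborel) F = measure lebesgue (\<Union>F)" "\<Union>F \<in> lmeasurable"
proof -
  have "sum (measure lborel) F = sum (measure lebesgue) F"
  proof (rule sum.cong[OF refl])
    fix k' assume "k' \<in> F"
    then obtain a b where "k' = cbox a b" using division_ofD(4)[OF assms] by blast
    then show "measure lborel k' = measure lebesgue k'" by simp
  qed
  then show "sum (measure lborel) F = measure lebesgue (\<Union>F)"
    using content_division[OF assms] by simp
  show "\<Union>F \<in> lmeasurable" using lmeasurable_division[OF assms] .
qed

text \<open>
  Cover \<open>E\<close> by intervals of slope below \<open>p\<close> inside a slightly larger open set, and then cover \<open>E\<close>
  again by intervals of slope above \<open>q\<close> inside the first ones.  Both families have nearly the same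
  total length, so by absolute continuity nearly the same total increment; no decomposition into
  monotone functions is needed.
\<close>

lemma abs_cont_on_slope_gap_negligible:
  assumes ac: "abs_cont_on c d f" and cd: "c \<le> d" and pq: "p < q"
    and E: "E \<subseteq> {c<..<d}"
      "\<And>x. x \<in> E \<Longrightarrow> (\<exists>\<^sub>F y in at x. slope f x y < p) \<and> (\<exists>\<^sub>F y in at x. q < slope f x y)"
  shows "negligible E"
proof -
  have "bounded E" using E(1) bounded_subset bounded_Ioo by blast
  then obtain s where s: "0 \<le> s" "\<And>T. T \<in> lmeasurable \<Longrightarrow> E \<subseteq> T \<Longrightarrow> s \<le> measure lebesgue T"
    "\<And>e. 0 < e \<Longrightarrow> \<exists>U. open U \<and> U \<in> lmeasurable \<and> E \<subseteq> U \<and> measure lebesgue U < s + e"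
    using outer_measure_approx by metis
  have key: "(q - p) * s \<le> \<epsilon> * (1 + 3 * \<bar>p\<bar> + 2 * (q - p))" if \<epsilon>: "0 < \<epsilon>" for \<epsilon>
  proof -
    obtain \<delta> where d0: "0 < \<delta>" and D: "\<And>F G. F division_of \<Union>F \<Longrightarrow> \<Union>F \<subseteq> {c..d} \<Longrightarrow> G division_of \<Union>G \<Longrightarrow>
       (\<And>J. J \<in> G \<Longrightarrow> interior J \<noteq> {} \<and> (\<exists>I\<in>F. J \<subseteq> I)) \<Longrightarrow>
       sum (measure lborel) F - sum (measure lborel) G < \<delta> \<Longrightarrow>
       \<bar>sum (increment f) F - sum (increment f) G\<bar> < \<epsilon>"
      using abs_cont_on_refine[OF ac \<epsilon> cd] by metis
    \<comment> \<open>The length of \<open>F\<close> is below s + \<eta>, and that of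
      \<open>G\<close> is above s - 2 \<eta>, since \<open>W\<close> and \<open>W'\<close> are lost.
      The lengths thus differ by less than 3 \<eta> < \<delta>, as the comparison of increments
      demands; the bound by \<epsilon> absorbs the remaining errors.\<close>
    define \<eta> where "\<eta> = min \<epsilon> (\<delta> / 4)"
    have \<eta>: "0 < \<eta>" "\<eta> \<le> \<epsilon>" "3 * \<eta> < \<delta>" using \<epsilon> d0 by (auto simp: \<eta>_def)
    obtain U0 where U0: "open U0" "U0 \<in> lmeasurable" "E \<subseteq> U0" "measure lebesgue U0 < s + \<eta>"
      using s(3)[OF \<eta>(1)] by blast
    define U where "U = U0 \<inter> {c<..<d}"
    have U: "open U" "U \<in> lmeasurable" "E \<subseteq> U" "U \<subseteq> {c..d}"
      using U0 E by (auto simp: U_def intro: fmeasurable_Int_fmeasurable)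
    have Us: "measure lebesgue U < s + \<eta>"
      using measure_mono_fmeasurable[of U U0 lebesgue] U0 U by (auto simp: U_def dest: fmeasurableD)
    have cov: "\<exists>l r. l < r \<and> (slope f l r < p \<and> {l..r} \<subseteq> U) \<and> l \<le> x \<and> x \<le> r \<and> r - l < e" if x: "x \<in> E" and e: "0 < e" for x e
    proof -
      have "\<exists>\<^sub>F y in at x. slope f x y < p" "x \<in> U" using E(2)[OF x] U x by blast+
      from frequently_slope_interval[of "\<lambda>t. t < p", OF this(1) U(1) this(2) e] show ?thesis .
    qed
    have "\<exists>F W. F division_of \<Union>F \<and>
      W \<in> lmeasurable \<and>
      E \<subseteq> \<Union>F \<union> W \<and>
      measure lebesgue W < \<eta> \<and>
      (\<forall>k\<in>F. \<exists>l r. l < r \<and> (slope f l r < p \<and> {l..r} \<subseteq> U) \<and> k = {l..r})"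
      by (rule Vitali_intervals[where U = U]) (use cov U(2) \<eta>(1) in blast)+
    then obtain F W where F: "F division_of \<Union>F" "W \<in> lmeasurable" "E \<subseteq> \<Union>F \<union> W" "measure lebesgue W < \<eta>"
      "\<forall>k\<in>F. \<exists>l r. l < r \<and> (slope f l r < p \<and> {l..r} \<subseteq> U) \<and> k = {l..r}"
      by (elim exE conjE) (rule that)
    \<comment> \<open>Passing to interiors loses only endpoints. Every remaining point of
      \<open>E\<close> has a neighbourhood inside a single interval of \<open>F\<close>, where the
      second covering can be chosen.\<close>
    define V where "V = (\<Union>I\<in>F. interior I)"
    have V: "open V" "V \<subseteq> U" using F(5) interior_subset by (fastforce simp: V_def)+
    have finF: "finite F" by (rule division_ofD(1)[OF F(1)])
    have bd: "negligible (\<Union>F - V)"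
    proof -
      have "\<Union>F - V \<subseteq> (\<Union>I\<in>F. I - interior I)" by (auto simp: V_def)
      moreover have "negligible (I - interior I)" if IF: "I \<in> F" for I
      proof -
        obtain l r where "I = {l..r}" using bspec[OF F(5) IF] by blast
        then have "I - interior I \<subseteq> {l, r}" by auto
        then show ?thesis by (rule negligible_subset[rotated]) (rule negligible_finite, simp)
      qed
      moreover have "negligible (\<Union>I\<in>F. I - interior I)"
        by (rule negligible_Union) (use finF calculation(2) in auto)
      ultimately show ?thesis using negligible_subset by blast
    qed
    have cov': "\<exists>l r. l < r \<and> (q < slope f l r \<and> (\<exists>I\<in>F. {l..r} \<subseteq> interior I)) \<and> l \<le> x \<and> x \<le> r \<and> r - l < e"
        if x: "x \<in> E \<inter> V" and e: "0 < e" for x e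
      proof -
        obtain I where I: "I \<in> F" "x \<in> interior I" using x unfolding V_def by blast
        have "\<exists>\<^sub>F y in at x. q < slope f x y" using E(2)[of x] x by simp
        from frequently_slope_interval[of "\<lambda>t. q < t", OF this open_interior I(2) e] show ?thesis
          using I(1) by blast
      qed
    have subU: "{l..r} \<subseteq> U" if "q < slope f l r \<and> (\<exists>I\<in>F. {l..r} \<subseteq> interior I)" for l r
      using that V(2) unfolding V_def by blast
    have "\<exists>G W'. G division_of \<Union>G \<and>
      W' \<in> lmeasurable \<and>
      E \<inter> V \<subseteq> \<Union>G \<union> W' \<and>
      measure lebesgue W' < \<eta> \<and>
      (\<forall>k\<in>G. \<exists>l r. l < r \<and> (q < slope f l r \<and> (\<exists>I\<in>F. {l..r} \<subseteq> interior I)) \<and> k = {l..r})"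
      by (rule Vitali_intervals[where U = U]) (use cov' U(2) subU \<eta>(1) in blast)+
    then obtain G W' where G: "G division_of \<Union>G" "W' \<in> lmeasurable" "E \<inter> V \<subseteq> \<Union>G \<union> W'" "measure lebesgue W' < \<eta>"
      "\<forall>k\<in>G. \<exists>l r. l < r \<and> (q < slope f l r \<and> (\<exists>I\<in>F. {l..r} \<subseteq> interior I)) \<and> k = {l..r}"
      by (elim exE conjE) (rule that)
    note mF = sum_content_division_eq_measure[OF F(1)] and mG = sum_content_division_eq_measure[OF G(1)]
    have "s \<le> measure lebesgue (\<Union>G \<union> (W \<union> (W' \<union> (\<Union>F - V))))"
    proof (rule s(2))
      show "\<Union>G \<union> (W \<union> (W' \<union> (\<Union>F - V))) \<in> lmeasurable"
        by (intro fmeasurable.Un mG(2) F(2) G(2) negligible_imp_measurable[OF bd])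
      show "E \<subseteq> \<Union>G \<union> (W \<union> (W' \<union> (\<Union>F - V)))" using F(3) G(3) by blast
    qed
    also have "\<dots> \<le> measure lebesgue (\<Union>G) + measure lebesgue (W \<union> (W' \<union> (\<Union>F - V)))"
      by (intro measure_Un_le sets.Un fmeasurableD[OF mG(2)] fmeasurableD[OF F(2)] fmeasurableD[OF G(2)] negligible_imp_sets[OF bd])
    also have "measure lebesgue (W \<union> (W' \<union> (\<Union>F - V))) \<le> measure lebesgue W + measure lebesgue (W' \<union> (\<Union>F - V))"
      by (intro measure_Un_le sets.Un fmeasurableD[OF F(2)] fmeasurableD[OF G(2)] negligible_imp_sets[OF bd])
    also have "measure lebesgue (W' \<union> (\<Union>F - V)) \<le> measure lebesgue W' + measure lebesgue (\<Union>F - V)"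
      by (intro measure_Un_le sets.Un fmeasurableD[OF F(2)] fmeasurableD[OF G(2)] negligible_imp_sets[OF bd])
    finally have sG: "s < measure lebesgue (\<Union>G) + 2 * \<eta>"
      using negligible_imp_measure0[OF bd] F(4) G(4) by simp
    have FU: "\<Union>F \<subseteq> U" using F(5) by blast
    have GF: "\<Union>G \<subseteq> \<Union>F" using G(5) interior_subset by blast
    have "measure lebesgue (\<Union>F) \<le> measure lebesgue U"
      by (rule measure_mono_fmeasurable[OF FU fmeasurableD[OF mF(2)] U(2)])
    then have Fs: "measure lebesgue (\<Union>F) < s + \<eta>" using Us by simp
    have GleF: "measure lebesgue (\<Union>G) \<le> measure lebesgue (\<Union>F)"
      by (rule measure_mono_fmeasurable[OF GF fmeasurableD[OF mG(2)] mF(2)])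
    have "\<bar>sum (increment f) F - sum (increment f) G\<bar> < \<epsilon>"
    proof (rule D[OF F(1) _ G(1)])
      show "\<Union>F \<subseteq> {c..d}" using FU U by blast
      show "interior J \<noteq> {} \<and> (\<exists>I\<in>F. J \<subseteq> I)" if JG: "J \<in> G" for J
      proof -
        obtain l r I where "l < r" "J = {l..r}" "I \<in> F" "{l..r} \<subseteq> interior I" using bspec[OF G(5) JG] by blast
        then show ?thesis using interior_subset by auto
      qed
      show "sum (measure lborel) F - sum (measure lborel) G < \<delta>"
        using mF mG Fs sG \<eta> by simp
    qed
    moreover have "sum (increment f) F \<le> p * measure lebesgue (\<Union>F)"
    proof -
      have "sum (increment f) F \<le> sum (\<lambda>k. p * measure lborel k) F"
      proof (rule sum_mono)
        fix k assume "k \<in> F"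
        then obtain l r where "l < r" "slope f l r < p" "k = {l..r}" using F(5) by blast
        then show "increment f k \<le> p * measure lborel k"
          by (simp add: slope_def increment_def field_simps)
      qed
      then show ?thesis using mF by (simp add: sum_distrib_left[symmetric])
    qed
    moreover have "q * measure lebesgue (\<Union>G) \<le> sum (increment f) G"
    proof -
      have "sum (\<lambda>k. q * measure lborel k) G \<le> sum (increment f) G"
      proof (rule sum_mono)
        fix k assume "k \<in> G"
        then obtain l r where "l < r" "q < slope f l r" "k = {l..r}" using G(5) by blast
        then show "q * measure lborel k \<le> increment f k"
          by (simp add: slope_def increment_def field_simps)
      qed
      then show ?thesis using mG by (simp add: sum_distrib_left[symmetric])
    qed
    moreover have "p * measure lebesgue (\<Union>F) \<le> p * measure lebesgue (\<Union>G) + \<bar>p\<bar> * (3 * \<eta>)"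
    proof -
      have "p * (measure lebesgue (\<Union>F) - measure lebesgue (\<Union>G)) \<le> \<bar>p\<bar> * (3 * \<eta>)"
        by (rule mult_mono) (use GleF Fs sG \<eta> in auto)
      then show ?thesis by (simp add: algebra_simps)
    qed
    ultimately have "(q - p) * measure lebesgue (\<Union>G) \<le> \<epsilon> + \<bar>p\<bar> * (3 * \<eta>)"
      by (simp add: algebra_simps)
    moreover have "(q - p) * s \<le> (q - p) * (measure lebesgue (\<Union>G) + 2 * \<eta>)"
      using sG pq by (intro mult_left_mono) auto
    moreover have "\<bar>p\<bar> * (3 * \<eta>) \<le> \<bar>p\<bar> * (3 * \<epsilon>)" "(q - p) * (2 * \<eta>) \<le> (q - p) * (2 * \<epsilon>)"
      by (rule mult_left_mono, use \<eta>(2) pq in simp, use pq in simp)+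
    ultimately show ?thesis by (simp add: algebra_simps)
  qed
  have "(q - p) * s \<le> 0"
  proof (rule field_le_epsilon)
    fix e :: real assume e: "0 < e"
    define B where "B = 1 + 3 * \<bar>p\<bar> + 2 * (q - p)"
    have B: "0 < B" using pq unfolding B_def by (simp add: add_pos_nonneg)
    have "(q - p) * s \<le> (e / B) * B"
      using key[OF divide_pos_pos[OF e B]] by (simp only: B_def)
    also have "\<dots> = e" using B by simp
    finally show "(q - p) * s \<le> 0 + e" by simp
  qed
  then have "s = 0" using s(1) pq by (simp add: mult_le_0_iff)
  have "\<exists>T. E \<subseteq> T \<and> T \<in> lmeasurable \<and> measure lebesgue T < e" if "0 < e" for e
    using s(3)[OF that] \<open>s = 0\<close> by auto
  then show ?thesis
    unfolding negligible_outer by blast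
qed

text \<open>A division of total length below \<delta> has total increment below 1, so if all its
  slopes exceed N in absolute value its length is below 1/N. Absolute continuity speaks of short
  families only, hence the localisation to balls of length \<delta>/2, from which negligibility is
  glued together.\<close>

lemma abs_cont_on_infinite_slope_negligible:
  assumes ac: "abs_cont_on c d f" and E: "E \<subseteq> {c<..<d}"
      "\<And>x (N::nat). x \<in> E \<Longrightarrow> (\<exists>\<^sub>F y in at x. real N < \<bar>slope f x y\<bar>)"
  shows "negligible E"
proof -
  obtain \<delta> where d0: "0 < \<delta>" and D: "\<And>D. D division_of \<Union>D \<Longrightarrow> \<Union>D \<subseteq> {c..d} \<Longrightarrow>
       sum (measure lborel) D < \<delta> \<Longrightarrow> (\<Sum>k\<in>D. \<bar>increment f k\<bar>) < 1"
    using abs_cont_on_division[OF ac zero_less_one] by metis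
  have loc: "negligible (E \<inter> ball z (\<delta>/4))" for z
    unfolding negligible_outer_le
  proof (intro allI impI)
    fix e :: real assume e: "0 < e"
    obtain N :: nat where N: "1 < real N * (e/2)" 
      using reals_Archimedean3[OF half_gt_zero[OF e]] by blast
    then have N0: "0 < N" by (cases N) auto
    define U where "U = ball z (\<delta>/4) \<inter> {c<..<d}"
    have U: "open U" "U \<in> lmeasurable" "U \<subseteq> {c..d}" "U \<subseteq> ball z (\<delta>/4)"
      by (auto simp: U_def intro: fmeasurable_Int_fmeasurable)
    have cov: "\<exists>l r. l < r \<and> (real N < \<bar>slope f l r\<bar> \<and> {l..r} \<subseteq> U) \<and> l \<le> x \<and> x \<le> r \<and> r - l < e'"
      if x: "x \<in> E \<inter> ball z (\<delta>/4)" and e': "0 < e'" for x e'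
    proof -
      have "\<exists>\<^sub>F y in at x. real N < \<bar>slope f x y\<bar>" "x \<in> U" using E x unfolding U_def by blast+
      from frequently_slope_interval[of "\<lambda>t. real N < \<bar>t\<bar>", OF this(1) U(1) this(2) e'] show ?thesis .
    qed
    have "\<exists>F W. F division_of \<Union>F \<and>
      W \<in> lmeasurable \<and>
      E \<inter> ball z (\<delta>/4) \<subseteq> \<Union>F \<union> W \<and>
      measure lebesgue W < e/2 \<and>
      (\<forall>k\<in>F. \<exists>l r. l < r \<and> (real N < \<bar>slope f l r\<bar> \<and> {l..r} \<subseteq> U) \<and> k = {l..r})"
      by (rule Vitali_intervals[where U = U]) (use cov U(2) half_gt_zero[OF e] in blast)+
    then obtain F W where F: "F division_of \<Union>F" "W \<in> lmeasurable" "E \<inter> ball z (\<delta>/4) \<subseteq> \<Union>F \<union> W" "measure lebesgue W < e/2"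
      "\<forall>k\<in>F. \<exists>l r. l < r \<and> (real N < \<bar>slope f l r\<bar> \<and> {l..r} \<subseteq> U) \<and> k = {l..r}"
      by (elim exE conjE) (rule that)
    note mF = sum_content_division_eq_measure[OF F(1)]
    have FU: "\<Union>F \<subseteq> U" using F(5) by blast
    have "measure lebesgue (\<Union>F) \<le> measure lebesgue (ball z (\<delta>/4))"
      by (rule measure_mono_fmeasurable[OF subset_trans[OF FU U(4)] fmeasurableD[OF mF(2)] lmeasurable_ball])
    also have "\<dots> < \<delta>" using d0 by (simp add: ball_eq_greaterThanLessThan)
    finally have "(\<Sum>k\<in>F. \<bar>increment f k\<bar>) < 1"
      using D[OF F(1)] FU U mF by simp
    moreover have "real N * measure lebesgue (\<Union>F) \<le> (\<Sum>k\<in>F. \<bar>increment f k\<bar>)"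
    proof -
      have "(\<Sum>k\<in>F. real N * measure lborel k) \<le> (\<Sum>k\<in>F. \<bar>increment f k\<bar>)"
      proof (rule sum_mono)
        fix k assume "k \<in> F"
        then obtain l r where "l < r" "real N < \<bar>slope f l r\<bar>" "k = {l..r}" using F(5) by blast
        then show "real N * measure lborel k \<le> \<bar>increment f k\<bar>"
          by (simp add: slope_def increment_def field_simps)
      qed
      then show ?thesis using mF by (simp add: sum_distrib_left[symmetric])
    qed
    ultimately have "real N * measure lebesgue (\<Union>F) < real N * (e/2)" using N by simp
    then have "measure lebesgue (\<Union>F) < e/2" using N0 by simp
    moreover have "measure lebesgue (\<Union>F \<union> W) \<le> measure lebesgue (\<Union>F) + measure lebesgue W"
      by (intro measure_Un_le fmeasurableD[OF mF(2)] fmeasurableD[OF F(2)])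
    ultimately show "\<exists>T. E \<inter> ball z (\<delta>/4) \<subseteq> T \<and> T \<in> lmeasurable \<and> measure lebesgue T \<le> e"
      using F(3,4) fmeasurable.Un[OF mF(2) F(2)] by (intro exI[of _ "\<Union>F \<union> W"]) simp
  qed
  show ?thesis
  proof (rule iffD2[OF locally_negligible_alt], rule ballI)
    fix x assume "x \<in> E"
    show "\<exists>U. openin (top_of_set E) U \<and> x \<in> U \<and> negligible U"
    proof (intro exI conjI)
      show "openin (top_of_set E) (E \<inter> ball x (\<delta>/4))" by (rule openin_open_Int[OF open_ball])
      show "x \<in> E \<inter> ball x (\<delta>/4)" using \<open>x \<in> E\<close> d0 by simp
      show "negligible (E \<inter> ball x (\<delta>/4))" by (rule loc)
    qed
  qed
qed

theorem abs_cont_on_differentiable_ae: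
  assumes ac: "abs_cont_on c d f" and cd: "c \<le> d"
  shows "negligible {x \<in> {c<..<d}. \<not> f differentiable (at x)}"
proof -
  let ?I = "{x \<in> {c<..<d}. \<forall>N::nat. \<exists>\<^sub>F y in at x. N < \<bar>slope f x y\<bar>}"
  let ?J = "\<lambda>(p, q). {x \<in> {c<..<d}. (\<exists>\<^sub>F y in at x. slope f x y < of_rat p) \<and> (\<exists>\<^sub>F y in at x. of_rat q < slope f x y)}"
  let ?R = "{(p, q). (p::rat) < q}"
  have "{x \<in> {c<..<d}. \<not> f differentiable (at x)} \<subseteq> ?I \<union> \<Union>(?J ` ?R)"
    using not_differentiable_slope_cases[of f] by fastforce
  moreover have "negligible ?I"
    by (rule abs_cont_on_infinite_slope_negligible[OF ac]) auto
  moreover have "negligible (\<Union>(?J ` ?R))"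
  proof (rule negligible_countable_Union)
    show "countable (?J ` ?R)" by (rule countable_image) (rule countableI_type)
    fix S assume "S \<in> ?J ` ?R"
    then obtain p q :: rat where "p < q" and S: "S = ?J (p, q)" by auto
    then have "real_of_rat p < real_of_rat q" by (simp add: of_rat_less)
    then show "negligible S"
      by (rule abs_cont_on_slope_gap_negligible[OF ac cd]) (auto simp: S)
  qed
  ultimately show ?thesis using negligible_Un negligible_subset by blast
qed

section \<open>Calculus of absolutely continuous functions and square integrability\<close>

text \<open>Common source of the closure properties: for congruence, linear combinations, products
  and functions with continuous derivative, the increments are bounded by those of two functions
  already known.\<close>

lemma abs_cont_on_dominated:
  assumes f: "abs_cont_on c d f" and g: "abs_cont_on c d g" and AB: "0 \<le> A" "0 \<le> B"
    and le: "\<And>x y. c \<le> x \<Longrightarrow> x \<le> y \<Longrightarrow> y \<le> d \<Longrightarrow> \<bar>k y - k x\<bar> \<le> A * \<bar>f y - f x\<bar> + B * \<bar>g y - g x\<bar>"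
  shows "abs_cont_on c d k"
  unfolding abs_cont_on_def
proof (intro allI impI)
  fix \<epsilon> :: real assume \<epsilon>: "0 < \<epsilon>"
  \<comment> \<open>Adding 1 keeps the denominators positive when A or B is 0, and A / (A + 1) < 1
    keeps the final estimate strict.\<close>
  have e1: "0 < \<epsilon> / (2 * (A + 1))" and e2: "0 < \<epsilon> / (2 * (B + 1))" using \<epsilon> AB by simp_all
  obtain \<delta> where d: "0 < \<delta>" and D0: "\<forall>(n::nat) (l::nat \<Rightarrow> real) (r::nat \<Rightarrow> real).
        (\<forall>i<n. c \<le> l i \<and> l i \<le> r i \<and> r i \<le> d) \<longrightarrow>
        (\<forall>i<n. \<forall>j<n. i \<noteq> j \<longrightarrow> {l i<..<r i} \<inter> {l j<..<r j} = {}) \<longrightarrow>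
        (\<Sum>i<n. r i - l i) < \<delta> \<longrightarrow> (\<Sum>i<n. \<bar>f (r i) - f (l i)\<bar>) < \<epsilon> / (2 * (A + 1))"
    using f[unfolded abs_cont_on_def, THEN spec, THEN mp, OF e1] by (elim exE conjE) (rule that)
  obtain \<delta>' where d': "0 < \<delta>'" and D0': "\<forall>(n::nat) (l::nat \<Rightarrow> real) (r::nat \<Rightarrow> real).
        (\<forall>i<n. c \<le> l i \<and> l i \<le> r i \<and> r i \<le> d) \<longrightarrow>
        (\<forall>i<n. \<forall>j<n. i \<noteq> j \<longrightarrow> {l i<..<r i} \<inter> {l j<..<r j} = {}) \<longrightarrow>
        (\<Sum>i<n. r i - l i) < \<delta>' \<longrightarrow> (\<Sum>i<n. \<bar>g (r i) - g (l i)\<bar>) < \<epsilon> / (2 * (B + 1))"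
    using g[unfolded abs_cont_on_def, THEN spec, THEN mp, OF e2] by (elim exE conjE) (rule that)
  show "\<exists>\<delta>>0. \<forall>(n::nat) (l::nat \<Rightarrow> real) (r::nat \<Rightarrow> real).
        (\<forall>i<n. c \<le> l i \<and> l i \<le> r i \<and> r i \<le> d) \<longrightarrow>
        (\<forall>i<n. \<forall>j<n. i \<noteq> j \<longrightarrow> {l i<..<r i} \<inter> {l j<..<r j} = {}) \<longrightarrow>
        (\<Sum>i<n. r i - l i) < \<delta> \<longrightarrow> (\<Sum>i<n. \<bar>k (r i) - k (l i)\<bar>) < \<epsilon>"
  proof (intro exI[of _ "min \<delta> \<delta>'"] conjI allI impI)
    show "0 < min \<delta> \<delta>'" using d d' by simp
    fix n :: nat and l r :: "nat \<Rightarrow> real"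
    assume lr: "\<forall>i<n. c \<le> l i \<and> l i \<le> r i \<and> r i \<le> d"
      and dj: "\<forall>i<n. \<forall>j<n. i \<noteq> j \<longrightarrow> {l i<..<r i} \<inter> {l j<..<r j} = {}"
      and s: "(\<Sum>i<n. r i - l i) < min \<delta> \<delta>'"
    have F: "(\<Sum>i<n. \<bar>f (r i) - f (l i)\<bar>) < \<epsilon> / (2 * (A + 1))"
      by (rule D0[THEN spec, THEN spec, THEN spec, THEN mp, THEN mp, THEN mp, OF lr dj]) (use s in simp)
    have G: "(\<Sum>i<n. \<bar>g (r i) - g (l i)\<bar>) < \<epsilon> / (2 * (B + 1))"
      by (rule D0'[THEN spec, THEN spec, THEN spec, THEN mp, THEN mp, THEN mp, OF lr dj]) (use s in simp)
    have "(\<Sum>i<n. \<bar>k (r i) - k (l i)\<bar>) \<le> (\<Sum>i<n. A * \<bar>f (r i) - f (l i)\<bar> + B * \<bar>g (r i) - g (l i)\<bar>)"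
      by (rule sum_mono) (use lr le in auto)
    also have "\<dots> = A * (\<Sum>i<n. \<bar>f (r i) - f (l i)\<bar>) + B * (\<Sum>i<n. \<bar>g (r i) - g (l i)\<bar>)"
      by (simp add: sum.distrib sum_distrib_left)
    also have "\<dots> \<le> A * (\<epsilon> / (2 * (A + 1))) + B * (\<epsilon> / (2 * (B + 1)))"
      using F G AB by (intro add_mono mult_left_mono) auto
    also have "\<dots> < \<epsilon>"
    proof -
      have "A * (\<epsilon> / (2 * (A + 1))) < \<epsilon> / 2" "B * (\<epsilon> / (2 * (B + 1))) < \<epsilon> / 2"
        using AB \<epsilon> by (simp_all add: field_simps)
      then show ?thesis by linarith
    qed
    finally show "(\<Sum>i<n. \<bar>k (r i) - k (l i)\<bar>) < \<epsilon>" .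
  qed
qed

lemma abs_cont_on_id: "abs_cont_on c d (\<lambda>x. x)"
  unfolding abs_cont_on_def
proof (intro allI impI)
  fix \<epsilon> :: real assume \<epsilon>: "0 < \<epsilon>"
  show "\<exists>\<delta>>0. \<forall>(n::nat) (l::nat \<Rightarrow> real) (r::nat \<Rightarrow> real).
        (\<forall>i<n. c \<le> l i \<and> l i \<le> r i \<and> r i \<le> d) \<longrightarrow>
        (\<forall>i<n. \<forall>j<n. i \<noteq> j \<longrightarrow> {l i<..<r i} \<inter> {l j<..<r j} = {}) \<longrightarrow>
        (\<Sum>i<n. r i - l i) < \<delta> \<longrightarrow> (\<Sum>i<n. \<bar>r i - l i\<bar>) < \<epsilon>"
  proof (intro exI[of _ \<epsilon>] conjI allI impI \<epsilon>)
    fix n :: nat and l r :: "nat \<Rightarrow> real"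
    assume lr: "\<forall>i<n. c \<le> l i \<and> l i \<le> r i \<and> r i \<le> d" and s: "(\<Sum>i<n. r i - l i) < \<epsilon>"
    have "(\<Sum>i<n. \<bar>r i - l i\<bar>) = (\<Sum>i<n. r i - l i)"
      by (rule sum.cong) (use lr in auto)
    then show "(\<Sum>i<n. \<bar>r i - l i\<bar>) < \<epsilon>" using s by simp
  qed
qed

lemma abs_cont_on_subset:
  assumes ac: "abs_cont_on c d f" and sub: "c \<le> c'" "d' \<le> d"
  shows "abs_cont_on c' d' f"
  unfolding abs_cont_on_def
proof (intro allI impI)
  fix \<epsilon> :: real assume \<epsilon>: "0 < \<epsilon>"
  obtain \<delta> where d: "0 < \<delta>" and D0: "\<forall>(n::nat) (l::nat \<Rightarrow> real) (r::nat \<Rightarrow> real).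
        (\<forall>i<n. c \<le> l i \<and> l i \<le> r i \<and> r i \<le> d) \<longrightarrow>
        (\<forall>i<n. \<forall>j<n. i \<noteq> j \<longrightarrow> {l i<..<r i} \<inter> {l j<..<r j} = {}) \<longrightarrow>
        (\<Sum>i<n. r i - l i) < \<delta> \<longrightarrow> (\<Sum>i<n. \<bar>f (r i) - f (l i)\<bar>) < \<epsilon>"
    using ac[unfolded abs_cont_on_def, THEN spec, THEN mp, OF \<epsilon>] by (elim exE conjE) (rule that)
  show "\<exists>\<delta>>0. \<forall>(n::nat) (l::nat \<Rightarrow> real) (r::nat \<Rightarrow> real).
        (\<forall>i<n. c' \<le> l i \<and> l i \<le> r i \<and> r i \<le> d') \<longrightarrow>
        (\<forall>i<n. \<forall>j<n. i \<noteq> j \<longrightarrow> {l i<..<r i} \<inter> {l j<..<r j} = {}) \<longrightarrow>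
        (\<Sum>i<n. r i - l i) < \<delta> \<longrightarrow> (\<Sum>i<n. \<bar>f (r i) - f (l i)\<bar>) < \<epsilon>"
  proof (intro exI[of _ \<delta>] conjI allI impI d)
    fix n :: nat and l r :: "nat \<Rightarrow> real"
    assume lr: "\<forall>i<n. c' \<le> l i \<and> l i \<le> r i \<and> r i \<le> d'"
      and dj: "\<forall>i<n. \<forall>j<n. i \<noteq> j \<longrightarrow> {l i<..<r i} \<inter> {l j<..<r j} = {}"
      and s: "(\<Sum>i<n. r i - l i) < \<delta>"
    have "\<forall>i<n. c \<le> l i \<and> l i \<le> r i \<and> r i \<le> d" using lr sub by fastforce
    from D0[THEN spec, THEN spec, THEN spec, THEN mp, THEN mp, THEN mp, OF this dj s]
    show "(\<Sum>i<n. \<bar>f (r i) - f (l i)\<bar>) < \<epsilon>" .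
  qed
qed

lemma abs_cont_on_cong:
  assumes "abs_cont_on c d f" "\<And>x. c \<le> x \<Longrightarrow> x \<le> d \<Longrightarrow> k x = f x"
  shows "abs_cont_on c d k"
  by (rule abs_cont_on_dominated[OF assms(1,1), of 1 0]) (use assms(2) in auto)

lemma abs_cont_on_lincomb:
  assumes "abs_cont_on c d f" "abs_cont_on c d g"
  shows "abs_cont_on c d (\<lambda>x. \<alpha> * f x + \<beta> * g x)"
proof (rule abs_cont_on_dominated[OF assms, of "\<bar>\<alpha>\<bar>" "\<bar>\<beta>\<bar>"])
  fix x y
  have "\<alpha> * f y + \<beta> * g y - (\<alpha> * f x + \<beta> * g x) = \<alpha> * (f y - f x) + \<beta> * (g y - g x)"
    by (simp add: algebra_simps)
  then show "\<bar>\<alpha> * f y + \<beta> * g y - (\<alpha> * f x + \<beta> * g x)\<bar> \<le> \<bar>\<alpha>\<bar> * \<bar>f y - f x\<bar> + \<bar>\<beta>\<bar> * \<bar>g y - g x\<bar>"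
    by (metis abs_mult abs_triangle_ineq)
qed auto

lemma abs_cont_on_imp_continuous_on:
  assumes "abs_cont_on c d f"
  shows "continuous_on {c..d} f"
  unfolding continuous_on_iff
proof (intro ballI allI impI)
  fix x \<epsilon> :: real assume x: "x \<in> {c..d}" and \<epsilon>: "0 < \<epsilon>"
  obtain \<delta> where d: "0 < \<delta>" and D0: "\<forall>(n::nat) (l::nat \<Rightarrow> real) (r::nat \<Rightarrow> real).
        (\<forall>i<n. c \<le> l i \<and> l i \<le> r i \<and> r i \<le> d) \<longrightarrow>
        (\<forall>i<n. \<forall>j<n. i \<noteq> j \<longrightarrow> {l i<..<r i} \<inter> {l j<..<r j} = {}) \<longrightarrow>
        (\<Sum>i<n. r i - l i) < \<delta> \<longrightarrow> (\<Sum>i<n. \<bar>f (r i) - f (l i)\<bar>) < \<epsilon>"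
    using assms[unfolded abs_cont_on_def, THEN spec, THEN mp, OF \<epsilon>] by (elim exE conjE) (rule that)
  show "\<exists>\<delta>>0. \<forall>x'\<in>{c..d}. dist x' x < \<delta> \<longrightarrow> dist (f x') (f x) < \<epsilon>"
  proof (intro exI[of _ \<delta>] conjI ballI impI d)
    fix y assume y: "y \<in> {c..d}" "dist y x < \<delta>"
    have "(\<Sum>i<(1::nat). \<bar>f (max x y) - f (min x y)\<bar>) < \<epsilon>"
      by (rule D0[THEN spec[of _ "1::nat"], THEN spec[of _ "\<lambda>i. min x y"], THEN spec[of _ "\<lambda>i. max x y"], THEN mp, THEN mp, THEN mp])
        (use x y in \<open>auto simp: dist_real_def\<close>)
    then have "\<bar>f (max x y) - f (min x y)\<bar> < \<epsilon>" by simp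
    then show "dist (f y) (f x) < \<epsilon>"
      by (cases "x \<le> y") (simp_all add: dist_real_def max_def min_def abs_minus_commute)
  qed
qed

lemma abs_cont_on_mult:
  assumes f: "abs_cont_on c d f" and g: "abs_cont_on c d g"
  shows "abs_cont_on c d (\<lambda>x. f x * g x)"
proof -
  have "bounded (f ` {c..d})" "bounded (g ` {c..d})"
    using abs_cont_on_imp_continuous_on[OF f] abs_cont_on_imp_continuous_on[OF g]
    by (auto intro!: compact_imp_bounded compact_continuous_image)
  then obtain A B where A: "\<And>x. x \<in> {c..d} \<Longrightarrow> \<bar>f x\<bar> \<le> A" and B: "\<And>x. x \<in> {c..d} \<Longrightarrow> \<bar>g x\<bar> \<le> B"
    unfolding bounded_iff by (auto simp del: atLeastAtMost_iff)
  show ?thesis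
  proof (rule abs_cont_on_dominated[OF f g, of "\<bar>B\<bar>" "\<bar>A\<bar>"])
    fix x y assume xy: "c \<le> x" "x \<le> y" "y \<le> d"
    have "f y * g y - f x * g x = g y * (f y - f x) + f x * (g y - g x)" by (simp add: algebra_simps)
    then have "\<bar>f y * g y - f x * g x\<bar> \<le> \<bar>g y\<bar> * \<bar>f y - f x\<bar> + \<bar>f x\<bar> * \<bar>g y - g x\<bar>"
      by (metis abs_mult abs_triangle_ineq)
    also have "\<dots> \<le> \<bar>B\<bar> * \<bar>f y - f x\<bar> + \<bar>A\<bar> * \<bar>g y - g x\<bar>"
      using A[of x] B[of y] xy by (intro add_mono mult_right_mono) auto
    finally show "\<bar>f y * g y - f x * g x\<bar> \<le> \<bar>B\<bar> * \<bar>f y - f x\<bar> + \<bar>A\<bar> * \<bar>g y - g x\<bar>" .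
  qed auto
qed

lemma abs_cont_on_C1:
  assumes der: "\<And>x. x \<in> {c..d} \<Longrightarrow> (f has_vector_derivative f' x) (at x within {c..d})"
    and cont: "continuous_on {c..d} f'"
  shows "abs_cont_on c d f"
proof -
  have "bounded (f' ` {c..d})"
    using cont by (auto intro!: compact_imp_bounded compact_continuous_image)
  then obtain A where A: "\<And>x. x \<in> {c..d} \<Longrightarrow> \<bar>f' x\<bar> \<le> A"
    unfolding bounded_iff by (auto simp del: atLeastAtMost_iff)
  show ?thesis
  proof (rule abs_cont_on_dominated[OF abs_cont_on_id abs_cont_on_id, of "\<bar>A\<bar>" 0])
    fix x y assume xy: "c \<le> x" "x \<le> y" "y \<le> d"
    have "(f' has_integral (f y - f x)) {x..y}"
      using xy by (intro fundamental_theorem_of_calculus has_vector_derivative_within_subset[OF der]) auto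
    then have "norm (f y - f x) \<le> \<bar>A\<bar> * measure lborel (cbox x y)"
    proof (intro has_integral_bound[of "\<bar>A\<bar>" f' _ x y])
      show "norm (f' t) \<le> \<bar>A\<bar>" if "t \<in> cbox x y" for t
        using order_trans[OF A[of t] abs_ge_self] that xy by simp
    qed simp_all
    then show "\<bar>f y - f x\<bar> \<le> \<bar>A\<bar> * \<bar>y - x\<bar> + 0 * \<bar>y - x\<bar>" using xy by simp
  qed auto
qed

section \<open>The derivative within [0,1] of an absolutely continuous function\<close>

lemma deriv01_eqI:
  assumes "(f has_vector_derivative D) (at x within {0..1})" "x \<in> {0..1}"
  shows "deriv01 f x = D"
  using vector_derivative_within_cbox[of 0 1 x f D] assms by (simp add: deriv01_def)

lemma deriv01_has_vector_derivative:
  assumes "f differentiable (at x within {0..1})"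
  shows "(f has_vector_derivative deriv01 f x) (at x within {0..1})"
  using assms unfolding deriv01_def by (simp add: vector_derivative_works)

text \<open>At \<open>c\<close> and \<open>d\<close> the derivative within [0,1] can depend on
  values of \<open>f\<close> outside [c,d], so both endpoints are put into the null set.\<close>

lemma abs_cont_on_deriv01_ae:
  assumes ac: "abs_cont_on c d f" and cd: "0 \<le> c" "c \<le> d" "d \<le> 1"
  obtains N where "negligible N" "c \<in> N" "d \<in> N"
    "\<And>x. x \<in> {c..d} - N \<Longrightarrow> (f has_vector_derivative deriv01 f x) (at x within {0..1})"
proof -
  let ?N = "{x \<in> {c<..<d}. \<not> f differentiable (at x)} \<union> {c, d}"
  show thesis
  proof (rule that[of ?N])
    show "negligible ?N" using abs_cont_on_differentiable_ae[OF ac cd(2)] by (intro negligible_Un) auto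
    fix x assume "x \<in> {c..d} - ?N"
    then have "f differentiable (at x)" by auto
    then show "(f has_vector_derivative deriv01 f x) (at x within {0..1})"
      by (rule deriv01_has_vector_derivative[OF differentiable_at_withinI])
  qed auto
qed

lemma abs_cont_on_deriv01_has_integral:
  assumes ac: "abs_cont_on c d f" and cd: "0 \<le> c" "c \<le> d" "d \<le> 1"
  shows "(deriv01 f has_integral (f d - f c)) {c..d}"
proof -
  obtain N where N: "negligible N" "\<And>x. x \<in> {c..d} - N \<Longrightarrow> (f has_vector_derivative deriv01 f x) (at x within {0..1})"
    using abs_cont_on_deriv01_ae[OF assms] by metis
  show ?thesis
    by (rule fundamental_theorem_of_calculus_abs_cont[OF ac cd(2) N(1)])
      (rule has_vector_derivative_within_subset[OF N(2)], use cd in auto)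
qed

text \<open>\<open>f\<close> is the integral of its almost everywhere derivative, hence of the
  continuous \<open>q\<close>, and the integral of a continuous function is differentiable
  everywhere. This upgrades identities modulo null sets to pointwise ones. At x = c > 0 the
  derivative within [0,1] would look to the left of [c,1], which explains the last
  condition.\<close>

lemma abs_cont_on_continuous_deriv01:
  assumes ac: "abs_cont_on c 1 f" and c: "0 \<le> c" "c < 1" and q: "continuous_on {c..1} q"
    and N: "negligible N" "\<And>x. x \<in> {c<..<1} - N \<Longrightarrow> deriv01 f x = q x"
    and x: "x \<in> {c..1}" "c = 0 \<or> c < x"
  shows "(f has_vector_derivative q x) (at x within {0..1})"
proof -
  have eq: "f y = f c + integral {c..y} q" if y: "y \<in> {c..1}" for y
  proof -
    have "(deriv01 f has_integral (f y - f c)) {c..y}"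
      by (rule abs_cont_on_deriv01_has_integral[OF abs_cont_on_subset[OF ac]]) (use y c in auto)
    then have "(q has_integral (f y - f c)) {c..y}"
      by (rule has_integral_spike[of "N \<union> {c, 1}", rotated 2]) (use N y in \<open>auto intro!: negligible_Un\<close>)
    then show ?thesis by (simp add: integral_unique)
  qed
  have "((\<lambda>y. f c + integral {c..y} q) has_vector_derivative q x) (at x within {c..1})"
    using integral_has_vector_derivative[OF q x(1)] by (auto intro!: derivative_eq_intros)
  then have "(f has_vector_derivative q x) (at x within {c..1})"
    by (rule has_vector_derivative_transform_within[of _ _ _ _ 1]) (use eq[symmetric] x in simp_all)
  moreover have "at x within {c..1} = at x within {0..1}"
  proof (cases "c = 0")
    case False
    then have "c < x" using x by simp
    then show ?thesis by (intro at_within_nhd[of x "{c<..}"]) (use c in auto)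
  qed simp
  ultimately show ?thesis by simp
qed

section \<open>Null sets, square integrability and the Cauchy-Schwarz inequality\<close>

lemma AE_lebesgue_on_negligible:
  assumes "AE x in lebesgue_on S. P x" "S \<in> sets lebesgue"
  obtains N where "negligible N" "\<And>x. x \<in> S - N \<Longrightarrow> P x"
proof -
  have "AE x in lebesgue. x \<in> S \<longrightarrow> P x"
    using assms AE_restrict_space_iff[of S lebesgue P] by simp
  then obtain N where "N \<in> null_sets lebesgue" "{x \<in> space lebesgue. \<not> (x \<in> S \<longrightarrow> P x)} \<subseteq> N"
    unfolding eventually_ae_filter by blast
  then show thesis by (intro that[of N]) (auto simp: negligible_iff_null_sets)
qed

lemma negligible_AE_lebesgue_on:
  assumes "negligible N" "\<And>x. x \<in> S - N \<Longrightarrow> P x" "S \<in> sets lebesgue"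
  shows "AE x in lebesgue_on S. P x"
proof -
  have "N \<in> null_sets lebesgue" using assms by (simp add: negligible_iff_null_sets)
  then have "AE x in lebesgue. x \<notin> N" by (rule AE_not_in)
  then have "AE x in lebesgue. x \<in> S \<longrightarrow> P x" by (rule AE_mp) (use assms(2) in \<open>auto intro!: AE_I2\<close>)
  then show ?thesis using assms(3) AE_restrict_space_iff[of S lebesgue P] by simp
qed

lemma borel_measurable_lebesgue_on_AE:
  fixes f g :: "real \<Rightarrow> real"
  assumes f: "f \<in> borel_measurable (lebesgue_on S)" and ae: "AE x in lebesgue_on S. f x = g x"
    and S: "S \<in> sets lebesgue"
  shows "g \<in> borel_measurable (lebesgue_on S)"
proof -
  have "(\<lambda>x. if x \<in> S then f x else 0) \<in> borel_measurable lebesgue"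
    using f S by (simp add: borel_measurable_if)
  moreover have "AE x in lebesgue. (if x \<in> S then f x else 0) = (if x \<in> S then g x else 0)"
    using ae S AE_restrict_space_iff[of S lebesgue "\<lambda>x. f x = g x"] by auto
  ultimately have "(\<lambda>x. if x \<in> S then g x else 0) \<in> borel_measurable lebesgue"
    by (rule borel_measurable_AE)
  then show ?thesis using S by (simp add: borel_measurable_if)
qed

lemma L2_on_AE:
  assumes f: "f \<in> L2_on S" and ae: "AE x in lebesgue_on S. f x = g x" and S: "S \<in> sets lebesgue"
  shows "g \<in> L2_on S"
proof -
  have g: "g \<in> borel_measurable (lebesgue_on S)"
    using borel_measurable_lebesgue_on_AE[OF _ ae S] f by (simp add: L2_on_def)
  have "integrable (lebesgue_on S) (\<lambda>x. (g x)\<^sup>2)"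
    by (rule integrable_cong_AE_imp[of _ "\<lambda>x. (f x)\<^sup>2"]) (use f g ae in \<open>auto simp: L2_on_def\<close>)
  with g show ?thesis by (simp add: L2_on_def)
qed

lemma integrable_mult_L2:
  fixes f g :: "'a \<Rightarrow> real"
  assumes "f \<in> borel_measurable M" "integrable M (\<lambda>x. (f x)\<^sup>2)" "g \<in> borel_measurable M" "integrable M (\<lambda>x. (g x)\<^sup>2)"
  shows "integrable M (\<lambda>x. f x * g x)"
proof (rule Bochner_Integration.integrable_bound)
  show "integrable M (\<lambda>x. (f x)\<^sup>2 + (g x)\<^sup>2)" using assms by simp
  show "(\<lambda>x. f x * g x) \<in> borel_measurable M" using assms by simp
  have "\<bar>f x * g x\<bar> \<le> (f x)\<^sup>2 + (g x)\<^sup>2" for x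
  proof -
    have "0 \<le> \<bar>f x\<bar> * \<bar>g x\<bar>" by simp
    then show ?thesis using sum_squares_bound[of "\<bar>f x\<bar>" "\<bar>g x\<bar>"] unfolding abs_mult power2_abs by linarith
  qed
  then show "AE x in M. norm (f x * g x) \<le> norm ((f x)\<^sup>2 + (g x)\<^sup>2)" by (intro AE_I2) simp
qed

text \<open>Behind both Cauchy-Schwarz inequalities, the one for integrals and the one for the
  energy seminorm. Degenerate and negative leading coefficients are excluded by the hypothesis
  itself.\<close>

lemma discriminant_le:
  fixes A B C :: real
  assumes "\<And>t. 0 \<le> A + 2 * t * B + t\<^sup>2 * C"
  shows "B\<^sup>2 \<le> A * C"
proof (cases "C = 0")
  case True
  have "B = 0"
  proof (rule ccontr)
    assume B: "B \<noteq> 0"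
    define t where "t = - (A + 1) / (2 * B)"
    have "2 * t * B = - (A + 1)" using B by (simp add: t_def)
    then show False using assms[of t] True by simp
  qed
  then show ?thesis using True by simp
next
  case False
  have A: "0 \<le> A" using assms[of 0] by simp
  have C: "0 < C"
  proof (rule ccontr)
    assume "\<not> 0 < C"
    then have C: "C < 0" using False by simp
    \<comment> \<open>A \<open>t\<close> of at least 1 for which - C t exceeds 2 |B| + A + 1, so
      that the quadratic becomes negative.\<close>
    define t where "t = (2 * \<bar>B\<bar> + A + 1) / (- C) + 1"
    have t: "1 \<le> t" "t * (- C) = 2 * \<bar>B\<bar> + A + 1 - C" using C A by (auto simp: t_def field_simps)
    have "t\<^sup>2 * (- C) = t * (t * (- C))" by (simp add: power2_eq_square)
    also have "\<dots> = t * (2 * \<bar>B\<bar> + A + 1 - C)" by (simp only: t(2))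
    also have "\<dots> = 2 * t * \<bar>B\<bar> + t * (A + 1 - C)" by (simp add: algebra_simps)
    finally have "t\<^sup>2 * (- C) = 2 * t * \<bar>B\<bar> + t * (A + 1 - C)" .
    moreover have "A + 1 - C \<le> t * (A + 1 - C)" using t(1) A C by (simp add: mult_le_cancel_right1)
    moreover have "2 * t * B \<le> 2 * t * \<bar>B\<bar>" using t by simp
    ultimately show False using assms[of t] C by simp
  qed
  have "0 \<le> A + 2 * (- B / C) * B + (- B / C)\<^sup>2 * C" by (rule assms)
  also have "\<dots> = A - B\<^sup>2 / C" using False by (simp add: power2_eq_square field_simps)
  finally show ?thesis using C by (simp add: field_simps)
qed

lemma integral_Cauchy_Schwarz:
  fixes f g :: "'a \<Rightarrow> real"
  assumes fg: "f \<in> borel_measurable M" "integrable M (\<lambda>x. (f x)\<^sup>2)" "g \<in> borel_measurable M" "integrable M (\<lambda>x. (g x)\<^sup>2)"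
  shows "(LINT x|M. f x * g x)\<^sup>2 \<le> (LINT x|M. (f x)\<^sup>2) * (LINT x|M. (g x)\<^sup>2)"
proof (rule discriminant_le)
  fix t :: real
  note i = integrable_mult_L2[OF fg]
  have "0 \<le> (LINT x|M. (f x + t * g x)\<^sup>2)" by simp
  also have "(\<lambda>x. (f x + t * g x)\<^sup>2) = (\<lambda>x. (f x)\<^sup>2 + 2 * t * (f x * g x) + t\<^sup>2 * (g x)\<^sup>2)"
    by (auto simp: power2_eq_square algebra_simps)
  also have "(LINT x|M. (f x)\<^sup>2 + 2 * t * (f x * g x) + t\<^sup>2 * (g x)\<^sup>2) =
      (LINT x|M. (f x)\<^sup>2) + 2 * t * (LINT x|M. f x * g x) + t\<^sup>2 * (LINT x|M. (g x)\<^sup>2)"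
    using i fg by simp
  finally show "0 \<le> (LINT x|M. (f x)\<^sup>2) + 2 * t * (LINT x|M. f x * g x) + t\<^sup>2 * (LINT x|M. (g x)\<^sup>2)" .
qed

lemma lebesgue_on_Ioo_has_integral:
  fixes f :: "real \<Rightarrow> real"
  assumes "integrable (lebesgue_on {a<..<b}) f"
  shows "(f has_integral (LINT x|lebesgue_on {a<..<b}. f x)) {a..b}"
  using has_integral_integral_lebesgue_on[OF assms] by (simp add: has_integral_Icc_iff_Ioo)

lemma integrable_lebesgue_on_mono:
  fixes f :: "real \<Rightarrow> real"
  assumes "integrable (lebesgue_on S) f" "T \<subseteq> S" "T \<in> sets lebesgue" "S \<in> sets lebesgue"
  shows "integrable (lebesgue_on T) f"
proof -
  have "set_integrable lebesgue S f"
    using assms by (simp add: set_integrable_def integrable_restrict_space)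
  then have "set_integrable lebesgue T f" using assms set_integrable_subset by blast
  then show ?thesis using assms by (simp add: set_integrable_def integrable_restrict_space)
qed

lemma measurable_lebesgue_on_mono:
  fixes f :: "real \<Rightarrow> real"
  assumes "f \<in> borel_measurable (lebesgue_on S)" "T \<subseteq> S"
  shows "f \<in> borel_measurable (lebesgue_on T)"
  using measurable_restrict_mono[OF assms] .

lemma integral_tail_tendsto:
  fixes f :: "real \<Rightarrow> real"
  assumes "f integrable_on {0..1}"
  shows "((\<lambda>e. integral {e..1} f) \<longlongrightarrow> integral {0..1} f) (at_right 0)"
proof -
  have "continuous_on {0..1} (\<lambda>e. integral {e..1} f)" by (rule indefinite_integral_continuous_1'[OF assms])
  then have "((\<lambda>e. integral {e..1} f) \<longlongrightarrow> integral {0..1} f) (at 0 within {0..1})"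
    by (auto simp: continuous_on_def)
  then show ?thesis using at_within_Icc_at_right[of 0 "1::real"] by simp
qed

section \<open>Degenerate weights\<close>

lemma deriv01_cong:
  assumes "open U" "x \<in> U" "x \<in> {0..1}" "\<And>y. y \<in> U \<Longrightarrow> y \<in> {0..1} \<Longrightarrow> f y = g y"
  shows "deriv01 f x = deriv01 g x"
proof -
  obtain d where d: "0 < d" "ball x d \<subseteq> U" using assms(1,2) openE by blast
  \<comment> \<open>\<open>vector_derivative\<close> chooses some \<open>D\<close>, so the
    equivalence of the two predicates gives equal values even at points where no derivative
    exists.\<close>
  have "(f has_vector_derivative D) (at x within {0..1}) = (g has_vector_derivative D) (at x within {0..1})" for D
  proof
    assume "(f has_vector_derivative D) (at x within {0..1})"
    then show "(g has_vector_derivative D) (at x within {0..1})"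
      by (rule has_vector_derivative_transform_within[OF _ d(1) assms(3)])
        (use d assms(4) in \<open>force simp: dist_commute\<close>)
  next
    assume "(g has_vector_derivative D) (at x within {0..1})"
    then show "(f has_vector_derivative D) (at x within {0..1})"
      by (rule has_vector_derivative_transform_within[OF _ d(1) assms(3)])
        (use d assms(4)[symmetric] in \<open>force simp: dist_commute\<close>)
  qed
  then show ?thesis unfolding deriv01_def vector_derivative_def by simp
qed

lemma has_real_derivative_interior:
  assumes "(f has_vector_derivative D) (at x within {0..1})" "x \<in> {0<..<1}"
  shows "(f has_real_derivative D) (at x)"
  using assms at_within_Icc_at[of 0 x 1] by (simp add: has_real_derivative_iff_has_vector_derivative)

lemma L2_mult_square:
  assumes "g \<in> L2"
  shows "(\<lambda>x. x\<^sup>2 * g x) \<in> L2"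
proof -
  have m: "(\<lambda>x. x\<^sup>2 * g x) \<in> borel_measurable (lebesgue_on {0<..<1})"
  proof (rule borel_measurable_times)
    show "(\<lambda>x::real. x\<^sup>2) \<in> borel_measurable (lebesgue_on {0<..<1})"
      by (intro continuous_imp_measurable_on_sets_lebesgue continuous_intros) simp
  qed (use assms in \<open>simp add: L2_on_def\<close>)
  have "integrable (lebesgue_on {0<..<1}) (\<lambda>x. (x\<^sup>2 * g x)\<^sup>2)"
  proof (rule Bochner_Integration.integrable_bound)
    show "integrable (lebesgue_on {0<..<1}) (\<lambda>x. (g x)\<^sup>2)" using assms by (simp add: L2_on_def)
    show "(\<lambda>x. (x\<^sup>2 * g x)\<^sup>2) \<in> borel_measurable (lebesgue_on {0<..<1})" using m by simp
    have "(x\<^sup>2 * g x)\<^sup>2 \<le> (g x)\<^sup>2" if "x \<in> {0<..<1}" for x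
    proof -
      have "(x\<^sup>2)\<^sup>2 \<le> 1" using that by (simp add: power_le_one)
      then show ?thesis using mult_right_mono[of "(x\<^sup>2)\<^sup>2" 1 "(g x)\<^sup>2"] by (simp add: power_mult_distrib)
    qed
    then show "AE x in lebesgue_on {0<..<1}. norm ((x\<^sup>2 * g x)\<^sup>2) \<le> norm ((g x)\<^sup>2)"
      by (intro AE_I2) (simp add: space_lebesgue_on)
  qed
  with m show ?thesis by (simp add: L2_on_def)
qed

lemma integrable_L2_weighted:
  assumes "f \<in> L2" "g \<in> L2"
  shows "integrable (lebesgue_on {0<..<1}) (\<lambda>x. f x * x\<^sup>2 * g x)"
  using integrable_mult_L2[of f "lebesgue_on {0<..<1}" "\<lambda>x. x\<^sup>2 * g x"] L2_mult_square[OF assms(2)] assms(1)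
  by (simp add: L2_on_def mult.assoc)

text \<open>The part that the weak and the strong energy space share. Only local absolute continuity
  of u' on (0,1] is kept, so estimates anchored at x = 1 can be proved once for both.\<close>

definition weighted_space :: "(real \<Rightarrow> real) \<Rightarrow> (real \<Rightarrow> real) set" where
  "weighted_space a = {u. abs_cont_on 0 1 u \<and> u 0 = 0 \<and> u 1 = 0 \<and> deriv01 u \<in> L2 \<and>
     (\<forall>c\<in>{0<..<1}. abs_cont_on c 1 (deriv01 u)) \<and> deriv01 u 1 = 0 \<and>
     (\<lambda>x. sqrt (a x) * deriv01 (deriv01 u) x) \<in> L2}"

definition curvature_energy :: "(real \<Rightarrow> real) \<Rightarrow> (real \<Rightarrow> real) \<Rightarrow> real" where
  "curvature_energy a u = (LINT x|lebesgue_on {0<..<1}. a x * (deriv01 (deriv01 u) x)\<^sup>2)"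

text \<open>The estimates for both kinds of degeneracy rest on x |a'| <= K a, where \<open>K\<close>
  in (0,2) may be any such constant. The strict bound K < 2 makes x^(1 - K) integrable at 0.\<close>

locale degenerate_weight =
  fixes a :: "real \<Rightarrow> real" and K :: real
  assumes a_differentiable: "x \<in> {0<..1} \<Longrightarrow> a differentiable (at x within {0..1})"
    and continuous_deriv_a: "continuous_on {0<..1} (deriv01 a)"
    and a_zero: "a 0 = 0"
    and a_pos: "x \<in> {0<..1} \<Longrightarrow> 0 < a x"
    and deriv_a_le: "x \<in> {0<..1} \<Longrightarrow> x * \<bar>deriv01 a x\<bar> \<le> K * a x"
    and K: "0 < K" "K < 2"
begin

lemma a_deriv: "x \<in> {0<..1} \<Longrightarrow> (a has_vector_derivative deriv01 a x) (at x within {0..1})"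
  by (rule deriv01_has_vector_derivative[OF a_differentiable])

lemma continuous_a: "continuous_on {0<..1} a"
  unfolding continuous_on_eq_continuous_within
proof
  fix x :: real assume x: "x \<in> {0<..1}"
  have "continuous (at x within {0..1}) a" by (rule has_vector_derivative_continuous[OF a_deriv[OF x]])
  then show "continuous (at x within {0<..1}) a" by (rule continuous_within_subset) auto
qed

lemma a1_pos: "0 < a 1" using a_pos by simp

text \<open>The degeneracy bound says that (log a)' <= K / t, so a(t) / t^K has nonpositive
  derivative. Near 0 the weight is therefore bounded below by a multiple of t^K.\<close>

lemma a_powr_decreasing:
  assumes "0 < x" "x \<le> y" "y \<le> 1"
  shows "a y * y powr (-K) \<le> a x * x powr (-K)"
proof (rule DERIV_nonpos_imp_decreasing_open[OF assms(2), of "\<lambda>t. a t * t powr (-K)"])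
  fix t assume t: "x < t" "t < y"
  then have t01: "t \<in> {0<..<1}" "0 < t" using assms by auto
  have "(a has_real_derivative deriv01 a t) (at t)"
    by (rule has_real_derivative_interior[OF a_deriv]) (use t01 in auto)
  then have "((\<lambda>t. a t * t powr (-K)) has_real_derivative deriv01 a t * t powr (-K) + (- K * t powr (-K - 1)) * a t) (at t)"
    by (intro DERIV_mult has_real_derivative_powr t01)
  moreover have "deriv01 a t * t powr (-K) + (- K * t powr (-K - 1)) * a t \<le> 0"
  proof -
    have pw: "t powr (-K) = t * t powr (-K - 1)" using powr_mult_base[of t "-K - 1"] t01 by simp
    have "deriv01 a t * t powr (-K) + (- K * t powr (-K - 1)) * a t = t powr (-K - 1) * (t * deriv01 a t - K * a t)"
      unfolding pw by (simp add: algebra_simps)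
    moreover have "t * deriv01 a t - K * a t \<le> 0"
    proof -
      have "t * deriv01 a t \<le> t * \<bar>deriv01 a t\<bar>" using t01(2) by (intro mult_left_mono) auto
      moreover have "t * \<bar>deriv01 a t\<bar> \<le> K * a t" by (rule deriv_a_le) (use t01 in simp)
      ultimately show ?thesis by linarith
    qed
    ultimately show ?thesis by (simp add: mult_nonneg_nonpos)
  qed
  ultimately show "\<exists>D. ((\<lambda>t. a t * t powr (-K)) has_real_derivative D) (at t) \<and> D \<le> 0" by blast
next
  show "continuous_on {x..y} (\<lambda>t. a t * t powr (-K))"
    by (intro continuous_intros continuous_on_subset[OF continuous_a]) (use assms in auto)
qed

section \<open>Gradient bounds from the comparison of the weight with a power\<close>

lemma inverse_a_le:
  assumes "0 < s" "s \<le> x" "x \<le> 1"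
  shows "1 / a s \<le> (x powr K / a x) * s powr (-K)"
proof -
  have "a x * x powr (-K) \<le> a s * s powr (-K)" using a_powr_decreasing[OF assms] .
  then have "a x * x powr (-K) * x powr K \<le> a s * s powr (-K) * x powr K"
    by (rule mult_right_mono) simp
  moreover have "x powr (-K) * x powr K = 1" using assms by (simp add: powr_add[symmetric])
  ultimately have "a x \<le> a s * s powr (-K) * x powr K" by (simp add: mult.assoc)
  moreover have "0 < a x" "0 < a s" using a_pos assms by auto
  ultimately show ?thesis by (simp add: field_simps)
qed

lemma weighted_L2_energy:
  assumes "(\<lambda>x. sqrt (a x) * h x) \<in> L2"
  shows "integrable (lebesgue_on {0<..<1}) (\<lambda>x. a x * (h x)\<^sup>2)"
    "(LINT x|lebesgue_on {0<..<1}. (sqrt (a x) * h x)\<^sup>2) = (LINT x|lebesgue_on {0<..<1}. a x * (h x)\<^sup>2)"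
proof -
  have eq: "(sqrt (a x) * h x)\<^sup>2 = a x * (h x)\<^sup>2" if "x \<in> space (lebesgue_on {0<..<1})" for x
    using that a_pos[of x] by (simp add: space_lebesgue_on power_mult_distrib)
  show "integrable (lebesgue_on {0<..<1}) (\<lambda>x. a x * (h x)\<^sup>2)"
    by (rule iffD1[OF Bochner_Integration.integrable_cong[OF refl eq]]) (use assms in \<open>simp_all add: L2_on_def\<close>)
  show "(LINT x|lebesgue_on {0<..<1}. (sqrt (a x) * h x)\<^sup>2) = (LINT x|lebesgue_on {0<..<1}. a x * (h x)\<^sup>2)"
    by (rule Bochner_Integration.integral_cong[OF refl eq])
qed

text \<open>Cauchy-Schwarz for g' = (sqrt a g') (1 / sqrt a). In both applications the majorant
  \<rho> of 1/a is a multiple of a power, so \<open>R\<close> is explicit, and the interval starts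
  at 0 or ends at 1, according to the end at which g vanishes.\<close>

lemma increment_sq_le:
  assumes g: "abs_cont_on y x g" "0 \<le> y" "y < x" "x \<le> 1"
    and L: "(\<lambda>s. sqrt (a s) * deriv01 g s) \<in> L2"
    and \<rho>: "(\<rho> has_integral R) {y..x}" "\<And>s. s \<in> {y<..<x} \<Longrightarrow> 1 / a s \<le> \<rho> s"
  shows "(g x - g y)\<^sup>2 \<le> (LINT s|lebesgue_on {0<..<1}. a s * (deriv01 g s)\<^sup>2) * R"
proof -
  let ?S = "{y<..<x}" and ?F = "\<lambda>s. sqrt (a s) * deriv01 g s" and ?G = "\<lambda>s. 1 / sqrt (a s)"
  have S: "?S \<subseteq> {0<..<1}" using g by auto
  have ap: "0 < a s" if "s \<in> ?S" for s using that a_pos[of s] g by auto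
  have F: "?F \<in> borel_measurable (lebesgue_on ?S)" "integrable (lebesgue_on ?S) (\<lambda>s. (?F s)\<^sup>2)"
    using L unfolding L2_on_def
    by (auto intro!: measurable_lebesgue_on_mono[OF _ S] integrable_lebesgue_on_mono[OF _ S] simp del: greaterThanLessThan_iff)
  have "continuous_on ?S ?G"
  proof (intro continuous_intros continuous_on_subset[OF continuous_a])
    show "{y<..<x} \<subseteq> {0<..1}" using g by auto
    show "\<forall>s\<in>{y<..<x}. sqrt (a s) \<noteq> 0" using ap by fastforce
  qed
  then have G: "?G \<in> borel_measurable (lebesgue_on ?S)"
    by (intro continuous_imp_measurable_on_sets_lebesgue) auto
  have G2: "(?G s)\<^sup>2 = 1 / a s" if "s \<in> ?S" for s using ap[OF that] by (simp add: power_divide)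
  have \<rho>': "(\<rho> has_integral R) ?S" using \<rho>(1) by (simp add: has_integral_Icc_iff_Ioo)
  \<comment> \<open>For y = 0 this function may blow up at the endpoint; its integrability comes
    from the majorant.\<close>
  have "(\<lambda>s. (?G s)\<^sup>2) absolutely_integrable_on ?S"
  proof (rule measurable_bounded_by_integrable_imp_absolutely_integrable)
    show "(\<lambda>s. (?G s)\<^sup>2) \<in> borel_measurable (lebesgue_on ?S)" using G by simp
    show "\<rho> integrable_on ?S" using \<rho>' by blast
    show "norm ((?G s)\<^sup>2) \<le> \<rho> s" if "s \<in> ?S" for s
      using \<rho>(2)[OF that] ap[OF that] by (simp add: G2[OF that])
  qed simp
  then have Gi: "integrable (lebesgue_on ?S) (\<lambda>s. (?G s)\<^sup>2)"
    by (simp add: set_integrable_def integrable_restrict_space)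
  have "(LINT s|lebesgue_on ?S. ?F s * ?G s) = g x - g y"
  proof -
    have "((\<lambda>s. ?F s * ?G s) has_integral (LINT s|lebesgue_on ?S. ?F s * ?G s)) {y..x}"
      by (rule lebesgue_on_Ioo_has_integral[OF integrable_mult_L2[OF F G Gi]])
    then have "(deriv01 g has_integral (LINT s|lebesgue_on ?S. ?F s * ?G s)) {y..x}"
      by (rule has_integral_spike[of "{y, x}", rotated 2]) (use ap in \<open>auto simp: less_le\<close>)
    moreover have "(deriv01 g has_integral (g x - g y)) {y..x}"
      by (rule abs_cont_on_deriv01_has_integral) (use g in auto)
    ultimately show ?thesis by (rule has_integral_unique)
  qed
  then have "(g x - g y)\<^sup>2 \<le> (LINT s|lebesgue_on ?S. (?F s)\<^sup>2) * (LINT s|lebesgue_on ?S. (?G s)\<^sup>2)"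
    using integral_Cauchy_Schwarz[OF F G Gi] by simp
  also have "\<dots> \<le> (LINT s|lebesgue_on {0<..<1}. a s * (deriv01 g s)\<^sup>2) * R"
  proof (rule mult_mono)
    have i1: "((\<lambda>s. (?F s)\<^sup>2) has_integral (LINT s|lebesgue_on ?S. (?F s)\<^sup>2)) {y..x}"
      by (rule lebesgue_on_Ioo_has_integral[OF F(2)])
    have i2: "((\<lambda>s. (?F s)\<^sup>2) has_integral (LINT s|lebesgue_on {0<..<1}. (?F s)\<^sup>2)) {0..1}"
      by (rule lebesgue_on_Ioo_has_integral) (use L in \<open>simp add: L2_on_def\<close>)
    have "(LINT s|lebesgue_on ?S. (?F s)\<^sup>2) \<le> (LINT s|lebesgue_on {0<..<1}. (?F s)\<^sup>2)"
      by (rule has_integral_subset_le[OF _ i1 i2]) (use g in auto)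
    then show "(LINT s|lebesgue_on ?S. (?F s)\<^sup>2) \<le> (LINT s|lebesgue_on {0<..<1}. a s * (deriv01 g s)\<^sup>2)"
      by (simp only: weighted_L2_energy(2)[OF L])
    have "((\<lambda>s. (?G s)\<^sup>2) has_integral (LINT s|lebesgue_on ?S. (?G s)\<^sup>2)) ?S"
      by (rule has_integral_integral_lebesgue_on[OF Gi]) simp
    then show "(LINT s|lebesgue_on ?S. (?G s)\<^sup>2) \<le> R"
      by (rule has_integral_le[OF _ \<rho>']) (use \<rho>(2) G2 in simp)
    show "0 \<le> (LINT s|lebesgue_on {0<..<1}. a s * (deriv01 g s)\<^sup>2)"
      unfolding weighted_L2_energy(2)[OF L, symmetric] by simp
  qed simp
  finally show ?thesis .
qed

text \<open>The closed form is (1 - x^(1 - K)) / (1 - K), but a logarithm at K = 1. Keeping the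
  integral treats all K in (0,2) alike.\<close>

definition W :: "real \<Rightarrow> real" where
  "W x = integral {x..1} (\<lambda>s. s powr (-K))"

lemma continuous_powr_K: "0 < e \<Longrightarrow> continuous_on {e..1} (\<lambda>s. s powr (-K))"
  by (intro continuous_intros) auto

lemma W_has_integral: "0 < x \<Longrightarrow> ((\<lambda>s. s powr (-K)) has_integral W x) {x..1}"
  unfolding W_def by (intro integrable_integral integrable_continuous_real continuous_powr_K)

text \<open>The integrand decreases and the interval is shorter than 1. Crude, but enough to send
  the boundary terms e^2 \<open>W e\<close> to 0 when K < 2.\<close>

lemma W_le: assumes "0 < x" "x \<le> 1" shows "W x \<le> x powr (-K)"
proof -
  have "W x \<le> x powr (-K) * (1 - x)"
  proof (rule has_integral_le[OF W_has_integral[OF assms(1)]])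
    show "((\<lambda>s. x powr (-K)) has_integral x powr (-K) * (1 - x)) {x..1}"
      using has_integral_const_real[of "x powr (-K)" x 1] assms by (simp add: mult.commute)
    show "s powr (-K) \<le> x powr (-K)" if "s \<in> {x..1}" for s
      using that assms K by (intro powr_mono2') auto
  qed
  also have "\<dots> \<le> x powr (-K) * 1" using assms by (intro mult_left_mono) auto
  finally show ?thesis by simp
qed

text \<open>Exchanging the order of integration over (0,1) would give the integral of s^(1 - K),
  that is 1 / (2 - K). The antiderivative \<open>?\<Phi>\<close> replaces the exchange: the two
  powers in its derivative cancel. This is the origin of 2 - K in the final constants.\<close>

lemma integral_W_le:
  assumes e: "0 < e" "e \<le> 1"
  shows "\<exists>I. (W has_integral I) {e..1} \<and> I \<le> 1 / (2 - K)"
proof -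
  let ?\<Phi> = "\<lambda>x. x * W x + x powr (2 - K) / (2 - K)"
  have "(W has_integral (?\<Phi> 1 - ?\<Phi> e)) {e..1}"
  proof (rule fundamental_theorem_of_calculus[OF e(2)])
    fix x assume x: "x \<in> {e..1}"
    have "((\<lambda>u. integral {u..1} (\<lambda>s. s powr (-K))) has_vector_derivative - (x powr (-K))) (at x within {e..1})"
      by (rule integral_has_vector_derivative'[OF continuous_powr_K[OF e(1)] x])
    then have W': "(W has_real_derivative - (x powr (-K))) (at x within {e..1})"
      unfolding W_def[abs_def] has_real_derivative_iff_has_vector_derivative .
    have p: "((\<lambda>x. x powr (2 - K)) has_real_derivative (2 - K) * x powr (1 - K)) (at x within {e..1})"
      using has_field_derivative_at_within[OF has_real_derivative_powr[of x "2 - K"]] x e by simp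
    have "x powr (1 - K) = x * x powr (-K)" using powr_mult_base[of x "-K"] x e by simp
    then have "(?\<Phi> has_real_derivative W x) (at x within {e..1})"
      using K x e by (auto intro!: derivative_eq_intros W' p)
    then show "(?\<Phi> has_vector_derivative W x) (at x within {e..1})"
      by (simp add: has_real_derivative_iff_has_vector_derivative)
  qed
  moreover have "0 \<le> W e" unfolding W_def by (rule integral_nonneg) (use e in \<open>auto intro!: integrable_continuous_real continuous_powr_K\<close>)
  moreover have "W 1 = 0" by (simp add: W_def)
  moreover have "?\<Phi> 1 - ?\<Phi> e \<le> 1 / (2 - K)"
  proof -
    have "0 \<le> e * W e" "0 \<le> e powr (2 - K) / (2 - K)" using \<open>0 \<le> W e\<close> e K by simp_all
    then show ?thesis using \<open>W 1 = 0\<close> by simp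
  qed
  ultimately show ?thesis by blast
qed

context
  fixes u :: "real \<Rightarrow> real"
  assumes u: "u \<in> weighted_space a"
begin

lemma continuous_deriv_u: "0 < e \<Longrightarrow> continuous_on {e..1} (deriv01 u)"
proof -
  assume e: "0 < e"
  show "continuous_on {e..1} (deriv01 u)"
  proof (cases "e < 1")
    case True
    then show ?thesis using u e by (intro abs_cont_on_imp_continuous_on) (auto simp: weighted_space_def)
  next
    case False
    then have "{e..1} \<subseteq> {1}" by auto
    then show ?thesis using continuous_on_subset continuous_on_sing by blast
  qed
qed

lemma weighted_space_deriv:
  assumes x: "x \<in> {0<..1}"
  shows "(u has_vector_derivative deriv01 u x) (at x within {0..1})"
  by (rule abs_cont_on_continuous_deriv01[of "x/2" u "deriv01 u" "{}"])
    (use u x continuous_deriv_u[of "x/2"] in \<open>auto simp: weighted_space_def intro: abs_cont_on_subset[of 0 1]\<close>)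

lemma curvature_energy_nonneg: "0 \<le> curvature_energy a u"
proof -
  have "(\<lambda>x. sqrt (a x) * deriv01 (deriv01 u) x) \<in> L2" using u by (simp add: weighted_space_def)
  from weighted_L2_energy(2)[OF this, symmetric] show ?thesis unfolding curvature_energy_def by simp
qed

text \<open>u' is integrated from 1, where it vanishes in the weak and in the strong case, with a(s)
  >= a(1) s^K.\<close>

lemma deriv_sq_le:
  assumes x: "0 < x" "x < 1"
  shows "(deriv01 u x)\<^sup>2 \<le> curvature_energy a u * (W x / a 1)"
proof -
  have "(deriv01 u 1 - deriv01 u x)\<^sup>2 \<le> curvature_energy a u * (W x / a 1)"
    unfolding curvature_energy_def
  proof (rule increment_sq_le[of x 1 _ "\<lambda>s. s powr (-K) / a 1"])
    show "((\<lambda>s. s powr (-K) / a 1) has_integral W x / a 1) {x..1}"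
      by (rule has_integral_divide[OF W_has_integral[OF x(1)]])
    show "1 / a s \<le> s powr (-K) / a 1" if "s \<in> {x<..<1}" for s
      using inverse_a_le[of s 1] that x by simp
  qed (use u x in \<open>auto simp: weighted_space_def\<close>)
  then show ?thesis using u by (simp add: weighted_space_def)
qed

text \<open>u' is integrated from 0, which takes u'(0) = 0 and, for the integral of s^(-K), K < 1.
  The comparison with a power is anchored at \<open>x\<close> instead of 1, so a(x) appears in the
  denominator and later cancels against |a'| <= K a / x.\<close>

lemma deriv_sq_le_origin:
  assumes "abs_cont_on 0 1 (deriv01 u)" "deriv01 u 0 = 0" "K < 1" and x: "0 < x" "x \<le> 1"
  shows "(deriv01 u x)\<^sup>2 \<le> curvature_energy a u * (x / (a x * (1 - K)))"
proof -
  have b: "(deriv01 u x - deriv01 u 0)\<^sup>2 \<le> curvature_energy a u * ((x powr K / a x) * (x powr (-K + 1) / (-K + 1)))"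
    unfolding curvature_energy_def
  proof (rule increment_sq_le[of 0 x _ "\<lambda>s. (x powr K / a x) * s powr (-K)"])
    show "((\<lambda>s. (x powr K / a x) * s powr (-K)) has_integral (x powr K / a x) * (x powr (-K + 1) / (-K + 1))) {0..x}"
      by (rule has_integral_mult_right[OF has_integral_powr_from_0]) (use assms in auto)
    show "1 / a s \<le> x powr K / a x * s powr (-K)" if "s \<in> {0<..<x}" for s
      using inverse_a_le[of s x] that x by simp
  qed (use u x abs_cont_on_subset[OF assms(1)] in \<open>auto simp: weighted_space_def\<close>)
  have R: "(x powr K / a x) * (x powr (-K + 1) / (-K + 1)) = x / (a x * (1 - K))"
  proof -
    have "x powr K * x powr (-K + 1) = x" using x by (simp add: powr_add[symmetric])
    then show ?thesis unfolding times_divide_times_eq by simp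
  qed
  show ?thesis using b unfolding R assms(2) diff_0_right .
qed

lemma integral_deriv_sq_le:
  assumes e: "0 < e" "e < 1"
  shows "integral {e..1} (\<lambda>x. (deriv01 u x)\<^sup>2) \<le> curvature_energy a u / (a 1 * (2 - K))"
proof -
  obtain I where I: "(W has_integral I) {e..1}" "I \<le> 1 / (2 - K)" using integral_W_le[of e] e by auto
  have i: "(\<lambda>x. (deriv01 u x)\<^sup>2) integrable_on {e..1}"
    by (intro integrable_continuous_real continuous_intros continuous_deriv_u e)
  have "integral {e..1} (\<lambda>x. (deriv01 u x)\<^sup>2) \<le> (curvature_energy a u / a 1) * I"
  proof (rule has_integral_le[OF integrable_integral[OF i] has_integral_mult_right[OF I(1)]])
    fix x assume x: "x \<in> {e..1}"
    show "(deriv01 u x)\<^sup>2 \<le> curvature_energy a u / a 1 * W x"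
    proof (cases "x = 1")
      case True
      then show ?thesis using u by (simp add: weighted_space_def W_def)
    next
      case False
      then show ?thesis using deriv_sq_le[of x] x e by simp
    qed
  qed
  also have "\<dots> \<le> (curvature_energy a u / a 1) * (1 / (2 - K))"
    by (rule mult_left_mono[OF I(2)]) (use curvature_energy_nonneg a1_pos in simp)
  finally show ?thesis by simp
qed

lemma deriv_L2_le:
  "(LINT x|lebesgue_on {0<..<1}. (deriv01 u x)\<^sup>2) \<le> curvature_energy a u / (a 1 * (2 - K))"
proof -
  have i: "((\<lambda>x. (deriv01 u x)\<^sup>2) has_integral (LINT x|lebesgue_on {0<..<1}. (deriv01 u x)\<^sup>2)) {0..1}"
    by (rule lebesgue_on_Ioo_has_integral) (use u in \<open>simp add: weighted_space_def L2_on_def\<close>)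
  have "\<forall>\<^sub>F e in at_right 0. integral {e..1} (\<lambda>x. (deriv01 u x)\<^sup>2) \<le> curvature_energy a u / (a 1 * (2 - K))"
    using integral_deriv_sq_le by (auto simp: eventually_at_right_field intro!: exI[of _ 1])
  from tendsto_upperbound[OF integral_tail_tendsto this] i show ?thesis
    by (auto simp: integral_unique)
qed

end

end

section \<open>The multiplier inequality\<close>

lemma H2_deriv:
  assumes "p \<in> H2"
  shows "abs_cont_on 0 1 p" "abs_cont_on 0 1 (deriv01 p)" "deriv01 (deriv01 p) \<in> L2"
    "\<And>x. x \<in> {0..1} \<Longrightarrow> (p has_vector_derivative deriv01 p x) (at x within {0..1})"
proof -
  show p: "abs_cont_on 0 1 p" and p': "abs_cont_on 0 1 (deriv01 p)" and "deriv01 (deriv01 p) \<in> L2"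
    using assms by (auto simp: H2_def H1_def)
  show "(p has_vector_derivative deriv01 p x) (at x within {0..1})" if "x \<in> {0..1}" for x
    by (rule abs_cont_on_continuous_deriv01[OF p _ _ abs_cont_on_imp_continuous_on[OF p'] negligible_empty])
      (use that in auto)
qed

lemma abs_cont_on_imp_bounded:
  assumes "abs_cont_on c d f"
  obtains B where "0 \<le> B" "\<And>x. x \<in> {c..d} \<Longrightarrow> \<bar>f x\<bar> \<le> B"
proof -
  have "bounded (f ` {c..d})"
    using abs_cont_on_imp_continuous_on[OF assms] by (intro compact_imp_bounded compact_continuous_image) auto
  then obtain B where "\<And>x. x \<in> {c..d} \<Longrightarrow> \<bar>f x\<bar> \<le> B"
    unfolding bounded_iff by (auto simp del: atLeastAtMost_iff)
  then show thesis using that[of "\<bar>B\<bar>"] by force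
qed

lemma continuous_on_imp_L2:
  assumes v: "continuous_on {0..1} v"
  shows "v \<in> L2"
proof -
  have "v \<in> borel_measurable (lebesgue_on {0<..<1})"
    by (rule continuous_imp_measurable_on_sets_lebesgue[OF continuous_on_subset[OF v]]) auto
  moreover have "(\<lambda>x. (v x)\<^sup>2) absolutely_integrable_on {0<..<1}"
    using absolutely_integrable_continuous_real[of 0 1 "\<lambda>x. (v x)\<^sup>2"] v
    by (simp add: continuous_intros flip: absolutely_integrable_on_Icc_iff_Ioo)
  ultimately show ?thesis by (simp add: L2_on_def set_integrable_def integrable_restrict_space)
qed

context degenerate_weight
begin

text \<open>The domain provides p = a u'' almost everywhere. As p / a is continuous on (0,1], u' is
  continuously differentiable there and the identity holds at each point, in particular at 1, where
  the trace is read off.\<close>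

lemma dom_A_second_deriv:
  assumes u: "u \<in> weighted_space a" and p: "p \<in> H2"
    and ae: "AE x in lebesgue_on {0<..<1}. p x = a x * deriv01 (deriv01 u) x"
    and x: "x \<in> {0<..1}"
  shows "(deriv01 u has_vector_derivative p x / a x) (at x within {0..1})"
    "a x * deriv01 (deriv01 u) x = p x"
proof -
  obtain N where N: "negligible N" "\<And>x. x \<in> {0<..<1} - N \<Longrightarrow> p x = a x * deriv01 (deriv01 u) x"
    using AE_lebesgue_on_negligible[OF ae] by auto
  have ap: "0 < a s" if "x/2 \<le> s" "s \<le> 1" for s using that x a_pos[of s] by auto
  show D: "(deriv01 u has_vector_derivative p x / a x) (at x within {0..1})"
  proof (rule abs_cont_on_continuous_deriv01[of "x/2" "deriv01 u" "\<lambda>x. p x / a x" N])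
    show "abs_cont_on (x/2) 1 (deriv01 u)" using u x by (auto simp: weighted_space_def)
    show "continuous_on {x/2..1} (\<lambda>x. p x / a x)"
      using abs_cont_on_imp_continuous_on[OF H2_deriv(1)[OF p]] x ap
      by (intro continuous_intros continuous_on_subset[OF continuous_a]) (auto intro: continuous_on_subset simp: less_le)
    show "deriv01 (deriv01 u) s = p s / a s" if "s \<in> {x/2<..<1} - N" for s
      using N(2)[of s] ap[of s] that x by (auto simp: field_simps)
  qed (use x N in auto)
  show "a x * deriv01 (deriv01 u) x = p x"
    using deriv01_eqI[OF D] ap[of x] x by simp
qed

text \<open>The product inside \<open>op_A\<close> is 0 at x = 0 and can differ there from
  \<open>p\<close>. Both derivatives are taken at interior points and are local, so this value has
  no influence.\<close>

lemma op_A_eq: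
  assumes u: "u \<in> weighted_space a" and p: "p \<in> H2"
    and ae: "AE x in lebesgue_on {0<..<1}. p x = a x * deriv01 (deriv01 u) x"
    and x: "x \<in> {0<..<1}"
  shows "op_A a u x = deriv01 (deriv01 p) x"
proof -
  have first: "deriv01 (\<lambda>x. a x * deriv01 (deriv01 u) x) y = deriv01 p y" if "y \<in> {0<..<1}" for y
    by (rule deriv01_cong[of "{0<..}"]) (use that dom_A_second_deriv(2)[OF u p ae] in auto)
  show ?thesis
    unfolding op_A_def by (rule deriv01_cong[of "{0<..<1}"]) (use x first in auto)
qed

lemma op_A_L2:
  assumes "u \<in> weighted_space a" "p \<in> H2" "AE x in lebesgue_on {0<..<1}. p x = a x * deriv01 (deriv01 u) x"
  shows "op_A a u \<in> L2"
  by (rule L2_on_AE[OF H2_deriv(3)[OF assms(2)]])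
    (use op_A_eq[OF assms] in \<open>auto intro!: AE_I2 simp: space_lebesgue_on\<close>)

text \<open>
  \<open>\<Phi>\<close> collects the boundary terms of all integrations by parts in the integral of \<open>(a u'')'' x\<^sup>2 u'\<close>.
  Writing \<open>p\<close> for \<open>a u''\<close> avoids the third derivative of \<open>u\<close> and leaves \<open>p'\<close> as the only factor
  that is merely absolutely continuous.
\<close>

lemma multiplier_identity:
  fixes p u :: "real \<Rightarrow> real"
  defines "\<Phi> \<equiv> \<lambda>x. deriv01 p x * (x\<^sup>2 * deriv01 u x) + (- 2 * p x * (x * deriv01 u x)
       + (- 1/2 * (x\<^sup>2 * (p x * p x) * (1 / a x)) + a x * (deriv01 u x * deriv01 u x)))"
  assumes u: "u \<in> weighted_space a" and p: "p \<in> H2"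
    and ae: "AE x in lebesgue_on {0<..<1}. p x = a x * deriv01 (deriv01 u) x"
    and e: "0 < e" "e < 1"
  shows "((\<lambda>x. deriv01 (deriv01 p) x * x\<^sup>2 * deriv01 u x - 3 * x * (p x)\<^sup>2 / a x
       + x\<^sup>2 * deriv01 a x * (p x)\<^sup>2 / (2 * (a x)\<^sup>2) + deriv01 a x * (deriv01 u x)\<^sup>2)
     has_integral \<Phi> 1 - \<Phi> e) {e..1}"
proof -
  note D = dom_A_second_deriv(1)[OF u p ae] and P = H2_deriv[OF p]
  have sub: "{e..1} \<subseteq> {0..1}" "{e..1} \<subseteq> {0<..1}" using e by auto
  have ap: "0 < a x" if "x \<in> {e..1}" for x using that e a_pos by auto
  have da: "(a has_real_derivative deriv01 a x) (at x within {e..1})" if "x \<in> {e..1}" for x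
    using has_vector_derivative_within_subset[OF a_deriv sub(1)] that sub
    by (auto simp: has_real_derivative_iff_has_vector_derivative)
  have dg: "(deriv01 u has_real_derivative p x / a x) (at x within {e..1})" if "x \<in> {e..1}" for x
    using has_vector_derivative_within_subset[OF D sub(1)] that sub
    by (auto simp: has_real_derivative_iff_has_vector_derivative)
  have dp: "(p has_real_derivative deriv01 p x) (at x within {e..1})" if "x \<in> {e..1}" for x
    using has_vector_derivative_within_subset[OF P(4) sub(1)] that sub
    by (auto simp: has_real_derivative_iff_has_vector_derivative)
  have acp: "abs_cont_on e 1 p" and acp': "abs_cont_on e 1 (deriv01 p)"
    using abs_cont_on_subset[OF P(1)] abs_cont_on_subset[OF P(2)] e by auto
  have acg: "abs_cont_on e 1 (deriv01 u)" using u e by (auto simp: weighted_space_def)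
  have ca: "continuous_on {e..1} a" "continuous_on {e..1} (deriv01 a)"
    using continuous_on_subset[OF continuous_a sub(2)] continuous_on_subset[OF continuous_deriv_a sub(2)] by auto
  have aca: "abs_cont_on e 1 a"
    by (rule abs_cont_on_C1[of e 1 a "deriv01 a"]) (use da ca in \<open>auto simp: has_real_derivative_iff_has_vector_derivative\<close>)
  have acinv: "abs_cont_on e 1 (\<lambda>x. 1 / a x)"
  proof (rule abs_cont_on_C1[of e 1 _ "\<lambda>x. - deriv01 a x / (a x)\<^sup>2"])
    show "((\<lambda>x. 1 / a x) has_vector_derivative - deriv01 a x / (a x)\<^sup>2) (at x within {e..1})" if x: "x \<in> {e..1}" for x
      unfolding has_real_derivative_iff_has_vector_derivative[symmetric]
      using ap[OF x] by (auto intro!: derivative_eq_intros da[OF x] simp: power2_eq_square)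
    show "continuous_on {e..1} (\<lambda>x. - deriv01 a x / (a x)\<^sup>2)"
      by (intro continuous_intros ca) (use ap in fastforce)
  qed
  have acsq: "abs_cont_on e 1 (\<lambda>x. x\<^sup>2)"
    unfolding power2_eq_square by (intro abs_cont_on_mult abs_cont_on_id)
  have acsum: "abs_cont_on e 1 (\<lambda>x. f x + g x)" if "abs_cont_on e 1 f" "abs_cont_on e 1 g" for f g
    using abs_cont_on_lincomb[OF that, of 1 1] by simp
  have acscale: "abs_cont_on e 1 (\<lambda>x. \<alpha> * f x)" if "abs_cont_on e 1 f" for f \<alpha>
    using abs_cont_on_lincomb[OF that that, of \<alpha> 0] by simp
  have ac\<Phi>: "abs_cont_on e 1 \<Phi>"
    unfolding \<Phi>_def by (intro acsum abs_cont_on_mult acscale acp acp' acg aca acinv acsq abs_cont_on_id)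
  obtain N where N: "negligible N" "\<And>x. x \<in> {e..1} - N \<Longrightarrow> (deriv01 p has_vector_derivative deriv01 (deriv01 p) x) (at x within {0..1})"
    using abs_cont_on_deriv01_ae[OF acp'] e by (metis less_eq_real_def order_refl)
  show ?thesis
  proof (rule fundamental_theorem_of_calculus_abs_cont[OF ac\<Phi> _ N(1)])
    fix x assume x: "x \<in> {e..1} - N"
    then have x': "x \<in> {e..1}" by simp
    have dp': "(deriv01 p has_real_derivative deriv01 (deriv01 p) x) (at x within {e..1})"
      using has_vector_derivative_within_subset[OF N(2)[OF x] sub(1)]
      by (simp add: has_real_derivative_iff_has_vector_derivative)
    have a0: "a x \<noteq> 0" using ap[OF x'] by simp
    have "(\<Phi> has_real_derivative
       deriv01 (deriv01 p) x * (x\<^sup>2 * deriv01 u x) + (2 * x * deriv01 u x + p x / a x * x\<^sup>2) * deriv01 p x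
       + ((- 2 * deriv01 p x) * (x * deriv01 u x) + (deriv01 u x + p x / a x * x) * (- 2 * p x)
       + (- 1/2 * ((2 * x * (p x * p x) + 2 * p x * deriv01 p x * x\<^sup>2) * (1 / a x) + (- deriv01 a x / (a x)\<^sup>2) * (x\<^sup>2 * (p x * p x)))
       + (deriv01 a x * (deriv01 u x * deriv01 u x) + 2 * deriv01 u x * (p x / a x) * a x)))) (at x within {e..1})"
      unfolding \<Phi>_def
      by (rule derivative_eq_intros dp' dg[OF x'] dp[OF x'] da[OF x'] a0 refl | simp add: power2_eq_square a0)+
    \<comment> \<open>The terms with p' other than p'' cancel in pairs, and so do the products p u'.
      Besides p'' x^2 u' only squares of p and of u' survive.\<close>
    moreover have "deriv01 (deriv01 p) x * (x\<^sup>2 * deriv01 u x) + (2 * x * deriv01 u x + p x / a x * x\<^sup>2) * deriv01 p x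
       + ((- 2 * deriv01 p x) * (x * deriv01 u x) + (deriv01 u x + p x / a x * x) * (- 2 * p x)
       + (- 1/2 * ((2 * x * (p x * p x) + 2 * p x * deriv01 p x * x\<^sup>2) * (1 / a x) + (- deriv01 a x / (a x)\<^sup>2) * (x\<^sup>2 * (p x * p x)))
       + (deriv01 a x * (deriv01 u x * deriv01 u x) + 2 * deriv01 u x * (p x / a x) * a x)))
      = deriv01 (deriv01 p) x * x\<^sup>2 * deriv01 u x - 3 * x * (p x)\<^sup>2 / a x
       + x\<^sup>2 * deriv01 a x * (p x)\<^sup>2 / (2 * (a x)\<^sup>2) + deriv01 a x * (deriv01 u x)\<^sup>2"
      using a0 by (simp add: field_simps power2_eq_square)
    ultimately have "(\<Phi> has_real_derivative deriv01 (deriv01 p) x * x\<^sup>2 * deriv01 u x - 3 * x * (p x)\<^sup>2 / a x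
       + x\<^sup>2 * deriv01 a x * (p x)\<^sup>2 / (2 * (a x)\<^sup>2) + deriv01 a x * (deriv01 u x)\<^sup>2) (at x within {e..1})"
      by (rule DERIV_cong)
    then show "(\<Phi> has_vector_derivative deriv01 (deriv01 p) x * x\<^sup>2 * deriv01 u x - 3 * x * (p x)\<^sup>2 / a x
       + x\<^sup>2 * deriv01 a x * (p x)\<^sup>2 / (2 * (a x)\<^sup>2) + deriv01 a x * (deriv01 u x)\<^sup>2) (at x within {e..1})"
      by (simp add: has_real_derivative_iff_has_vector_derivative)
  qed (use e in auto)
qed

text \<open>At 1 the condition u'(1) = 0 reduces \<open>\<Phi>\<close> to - a(1) u''(1)^2 / 2. At e
  the term a u'^2 enters with a favourable sign and is dropped; the others are kept in absolute
  value. The 3 comes from 3 x p^2 / a with x <= 1, the K/2 from the term with a' p^2 by x |a'| <= K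
  a.\<close>

lemma multiplier_inequality_truncated:
  assumes u: "u \<in> weighted_space a" and p: "p \<in> H2"
    and ae: "AE x in lebesgue_on {0<..<1}. p x = a x * deriv01 (deriv01 u) x"
    and e: "0 < e" "e < 1"
    and R: "integral {e..1} (\<lambda>x. \<bar>deriv01 a x\<bar> * (deriv01 u x)\<^sup>2) \<le> R"
  shows "a 1 * (deriv01 (deriv01 u) 1)\<^sup>2 / 2 \<le>
    - integral {e..1} (\<lambda>x. deriv01 (deriv01 p) x * x\<^sup>2 * deriv01 u x) + (3 + K/2) * curvature_energy a u + R
    + (\<bar>deriv01 p e\<bar> * e\<^sup>2 * \<bar>deriv01 u e\<bar> + 2 * \<bar>p e\<bar> * e * \<bar>deriv01 u e\<bar> + e\<^sup>2 * (p e)\<^sup>2 / (2 * a e))"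
proof -
  let ?g = "deriv01 u" and ?J = "\<lambda>x. deriv01 (deriv01 p) x * x\<^sup>2 * deriv01 u x"
  let ?Q = "\<lambda>x. 3 * x * (p x)\<^sup>2 / a x - x\<^sup>2 * deriv01 a x * (p x)\<^sup>2 / (2 * (a x)\<^sup>2) - deriv01 a x * (?g x)\<^sup>2"
  let ?B = "\<lambda>x. (3 + K/2) * (a x * (deriv01 ?g x)\<^sup>2) + \<bar>deriv01 a x\<bar> * (?g x)\<^sup>2"
  have sub: "{e..1} \<subseteq> {0..1}" "{e..1} \<subseteq> {0<..1}" using e by auto
  have ap: "0 < a x" if "x \<in> {e..1}" for x using that e a_pos by auto
  have h: "a x * deriv01 ?g x = p x" if "x \<in> {e..1}" for x
    by (rule dom_A_second_deriv(2)[OF u p ae]) (use that e in auto)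
  have gL: "?g \<in> L2" and hL: "(\<lambda>x. sqrt (a x) * deriv01 ?g x) \<in> L2" and g1: "?g 1 = 0"
    using u by (auto simp: weighted_space_def)
  have Ji: "?J integrable_on {e..1}"
  proof -
    have "?J integrable_on {0..1}"
      using lebesgue_on_Ioo_has_integral[OF integrable_L2_weighted[OF H2_deriv(3)[OF p] gL]] by blast
    then show ?thesis using integrable_on_subinterval sub(1) by blast
  qed
  define \<Phi> where "\<Phi> = (\<lambda>x. deriv01 p x * (x\<^sup>2 * deriv01 u x) + (- 2 * p x * (x * deriv01 u x)
       + (- 1/2 * (x\<^sup>2 * (p x * p x) * (1 / a x)) + a x * (deriv01 u x * deriv01 u x))))"
  have "((\<lambda>x. ?J x - 3 * x * (p x)\<^sup>2 / a x
       + x\<^sup>2 * deriv01 a x * (p x)\<^sup>2 / (2 * (a x)\<^sup>2) + deriv01 a x * (?g x)\<^sup>2)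
     has_integral \<Phi> 1 - \<Phi> e) {e..1}"
    unfolding \<Phi>_def by (rule multiplier_identity[OF u p ae e])
  from has_integral_diff[OF integrable_integral[OF Ji] this]
  have Q: "(?Q has_integral integral {e..1} ?J - (\<Phi> 1 - \<Phi> e)) {e..1}"
    by (rule has_integral_eq[rotated]) (simp add: algebra_simps)
  have Ei: "(\<lambda>x. a x * (deriv01 ?g x)\<^sup>2) integrable_on {0..1}"
    "integral {0..1} (\<lambda>x. a x * (deriv01 ?g x)\<^sup>2) = curvature_energy a u"
    using lebesgue_on_Ioo_has_integral[OF weighted_L2_energy(1)[OF hL]] by (auto simp: curvature_energy_def)
  have Ei': "(\<lambda>x. a x * (deriv01 ?g x)\<^sup>2) integrable_on {e..1}" using integrable_on_subinterval Ei(1) sub(1) by blast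
  have Ele: "integral {e..1} (\<lambda>x. a x * (deriv01 ?g x)\<^sup>2) \<le> curvature_energy a u"
    unfolding Ei(2)[symmetric]
  proof (rule integral_subset_le[OF sub(1) Ei' Ei(1)])
    have "0 \<le> a x * (deriv01 ?g x)\<^sup>2" if "x \<in> {0..1}" for x
      using that a_pos[of x] a_zero by (cases "x = 0") auto
    then show "\<forall>x\<in>{0..1}. 0 \<le> a x * (deriv01 ?g x)\<^sup>2" by blast
  qed
  have ci: "(\<lambda>x. \<bar>deriv01 a x\<bar> * (?g x)\<^sup>2) integrable_on {e..1}"
    by (intro integrable_continuous_real continuous_intros continuous_deriv_u[OF u e(1)] continuous_on_subset[OF continuous_deriv_a sub(2)])
  have B: "(?B has_integral (3 + K/2) * integral {e..1} (\<lambda>x. a x * (deriv01 ?g x)\<^sup>2) + integral {e..1} (\<lambda>x. \<bar>deriv01 a x\<bar> * (?g x)\<^sup>2)) {e..1}"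
    by (intro has_integral_add has_integral_mult_right integrable_integral Ei' ci)
  have "integral {e..1} ?J - (\<Phi> 1 - \<Phi> e) \<le> (3 + K/2) * integral {e..1} (\<lambda>x. a x * (deriv01 ?g x)\<^sup>2) + integral {e..1} (\<lambda>x. \<bar>deriv01 a x\<bar> * (?g x)\<^sup>2)"
  proof (rule has_integral_le[OF Q B])
    fix x assume x: "x \<in> {e..1}"
    have x01: "0 < x" "x \<le> 1" using x e by auto
    define E where "E = (p x)\<^sup>2 / a x"
    have "E = a x * (deriv01 ?g x)\<^sup>2"
      using ap[OF x] unfolding E_def h[OF x, symmetric] by (simp add: power2_eq_square)
    moreover have "0 \<le> E" using ap[OF x] by (simp add: E_def)
    ultimately have E: "E = a x * (deriv01 ?g x)\<^sup>2" "0 \<le> E" .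
    have 1: "3 * x * (p x)\<^sup>2 / a x \<le> 3 * E"
      using mult_right_mono[OF x01(2) E(2)] by (simp add: E_def)
    have 2: "- (x\<^sup>2 * deriv01 a x * (p x)\<^sup>2 / (2 * (a x)\<^sup>2)) \<le> K/2 * E"
    proof -
      have "- (x * deriv01 a x) \<le> K * a x"
      proof -
        have "x * \<bar>deriv01 a x\<bar> \<le> K * a x" by (rule deriv_a_le) (use x01 in simp)
        moreover have "- (x * deriv01 a x) \<le> x * \<bar>deriv01 a x\<bar>" using x01 by (metis abs_ge_minus_self abs_mult abs_of_pos)
        ultimately show ?thesis by linarith
      qed
      then have "- (x * deriv01 a x) / a x \<le> K" using ap[OF x] by (simp add: field_simps)
      then have "(- (x * deriv01 a x) / a x) * (x * E / 2) \<le> K * (x * E / 2)"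
        by (rule mult_right_mono) (use x01 E in simp)
      also have "\<dots> \<le> K * (1 * E / 2)" using x01 E K by (intro mult_left_mono divide_right_mono mult_right_mono) auto
      also have "(- (x * deriv01 a x) / a x) * (x * E / 2) = - (x\<^sup>2 * deriv01 a x * (p x)\<^sup>2 / (2 * (a x)\<^sup>2))"
        by (simp add: E_def power2_eq_square mult_ac)
      finally show ?thesis by simp
    qed
    have 3: "- (deriv01 a x * (?g x)\<^sup>2) \<le> \<bar>deriv01 a x\<bar> * (?g x)\<^sup>2"
      using mult_right_mono[OF abs_ge_minus_self[of "deriv01 a x"], of "(?g x)\<^sup>2"] by simp
    show "?Q x \<le> ?B x" using 1 2 3 unfolding E(1)[symmetric] by (simp add: algebra_simps)
  qed
  also have "\<dots> \<le> (3 + K/2) * curvature_energy a u + R"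
    using Ele R K by (intro add_mono mult_left_mono) auto
  finally have main: "integral {e..1} ?J - \<Phi> 1 + \<Phi> e \<le> (3 + K/2) * curvature_energy a u + R" by simp
  have \<Phi>1: "\<Phi> 1 = - (a 1 * (deriv01 ?g 1)\<^sup>2 / 2)"
    using h[of 1] e a1_pos by (simp add: \<Phi>_def g1 power2_eq_square flip: h) 
  have "- \<Phi> e \<le> \<bar>deriv01 p e\<bar> * e\<^sup>2 * \<bar>?g e\<bar> + 2 * \<bar>p e\<bar> * e * \<bar>?g e\<bar> + e\<^sup>2 * (p e)\<^sup>2 / (2 * a e)"
  proof -
    have "- (deriv01 p e * (e\<^sup>2 * ?g e)) \<le> \<bar>deriv01 p e\<bar> * e\<^sup>2 * \<bar>?g e\<bar>"
      using abs_ge_minus_self[of "deriv01 p e * (e\<^sup>2 * ?g e)"] by (simp add: abs_mult mult.assoc)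
    moreover have "p e * (e * ?g e) \<le> \<bar>p e\<bar> * e * \<bar>?g e\<bar>"
      using abs_ge_self[of "p e * (e * ?g e)"] e by (simp add: abs_mult mult.assoc)
    moreover have "0 \<le> a e * (?g e * ?g e)" using ap[of e] e by simp
    moreover have "1/2 * (e\<^sup>2 * (p e * p e) * (1 / a e)) = e\<^sup>2 * (p e)\<^sup>2 / (2 * a e)" by (simp add: power2_eq_square)
    ultimately show ?thesis unfolding \<Phi>_def by linarith
  qed
  with main show ?thesis unfolding \<Phi>1 by linarith
qed

text \<open>The limit e -> 0 of the truncated inequality. \<open>p\<close> and p' are bounded, being
  continuous on [0,1], and e |u'(e)| tends to 0 by the gradient bound from x = 1, so the boundary
  terms disappear. Here the weight x^2 meets K < 2.\<close>

lemma multiplier_inequality: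
  assumes u: "u \<in> weighted_space a" and p: "p \<in> H2"
    and ae: "AE x in lebesgue_on {0<..<1}. p x = a x * deriv01 (deriv01 u) x"
    and R: "\<And>e. 0 < e \<Longrightarrow> e < 1 \<Longrightarrow> integral {e..1} (\<lambda>x. \<bar>deriv01 a x\<bar> * (deriv01 u x)\<^sup>2) \<le> R"
  shows "a 1 * (deriv01 (deriv01 u) 1)\<^sup>2 / 2 \<le>
    (LINT x|lebesgue_on {0<..<1}. - op_A a u x * x\<^sup>2 * deriv01 u x) + (3 + K/2) * curvature_energy a u + R"
proof -
  let ?g = "deriv01 u" and ?J = "\<lambda>x. deriv01 (deriv01 p) x * x\<^sup>2 * deriv01 u x" and ?N = "curvature_energy a u"
  have gL: "?g \<in> L2" using u by (auto simp: weighted_space_def)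
  obtain P where P: "0 \<le> P" "\<And>x. x \<in> {0..1} \<Longrightarrow> \<bar>p x\<bar> \<le> P"
    using abs_cont_on_imp_bounded[OF H2_deriv(1)[OF p]] by metis
  obtain P' where P': "0 \<le> P'" "\<And>x. x \<in> {0..1} \<Longrightarrow> \<bar>deriv01 p x\<bar> \<le> P'"
    using abs_cont_on_imp_bounded[OF H2_deriv(2)[OF p]] by metis
  \<comment> \<open>A majorant of e |u'(e)|: the gradient bound gives e^2 u'(e)^2 <= e^2 e^(-K)
    times energy over a(1).\<close>
  define \<eta> where "\<eta> e = sqrt (e powr (2 - K) * (?N / a 1))" for e
  define b where "b e = (P' + 2 * P) * \<eta> e + P\<^sup>2 / (2 * a 1) * e powr (2 - K)" for e
  have pw: "e\<^sup>2 * e powr (-K) = e powr (2 - K)" if "0 < e" for e :: real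
    using that powr_add[of e 2 "-K"] by (simp add: powr_numeral)
  have bound: "\<bar>deriv01 p e\<bar> * e\<^sup>2 * \<bar>?g e\<bar> + 2 * \<bar>p e\<bar> * e * \<bar>?g e\<bar> + e\<^sup>2 * (p e)\<^sup>2 / (2 * a e) \<le> b e"
    if e: "0 < e" "e < 1" for e
  proof -
    have "(e * \<bar>?g e\<bar>)\<^sup>2 \<le> e\<^sup>2 * (?N * (e powr (-K) / a 1))"
    proof -
      have "(?g e)\<^sup>2 \<le> ?N * (W e / a 1)" by (rule deriv_sq_le[OF u e])
      also have "\<dots> \<le> ?N * (e powr (-K) / a 1)"
        using W_le[of e] e a1_pos curvature_energy_nonneg[OF u] by (intro mult_left_mono divide_right_mono) auto
      finally have "(?g e)\<^sup>2 \<le> ?N * (e powr (-K) / a 1)" .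
      then show ?thesis unfolding power_mult_distrib power2_abs by (rule mult_left_mono) simp
    qed
    also have "\<dots> = e powr (2 - K) * (?N / a 1)" unfolding pw[OF e(1), symmetric] by simp
    finally have eg: "e * \<bar>?g e\<bar> \<le> \<eta> e" unfolding \<eta>_def by (rule real_le_rsqrt)
    have "0 \<le> \<eta> e" using eg e by (meson abs_ge_zero less_imp_le mult_nonneg_nonneg order_trans)
    have "e\<^sup>2 * \<bar>?g e\<bar> \<le> e * \<bar>?g e\<bar>" using e by (simp add: power2_eq_square mult_left_le_one_le mult.assoc)
    then have "\<bar>deriv01 p e\<bar> * (e\<^sup>2 * \<bar>?g e\<bar>) \<le> P' * \<eta> e"
      using P'(2)[of e] P'(1) e eg by (intro mult_mono) auto
    moreover have "\<bar>p e\<bar> * (e * \<bar>?g e\<bar>) \<le> P * \<eta> e"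
      using P(2)[of e] P(1) e eg by (intro mult_mono) auto
    moreover have "e\<^sup>2 * (p e)\<^sup>2 / (2 * a e) \<le> P\<^sup>2 / (2 * a 1) * e powr (2 - K)"
    proof -
      have "1 / a e \<le> e powr (-K) / a 1" using inverse_a_le[of e 1] e by simp
      moreover have "(p e)\<^sup>2 \<le> P\<^sup>2" using power_mono[OF P(2)[of e], of 2] e by simp
      ultimately have "(e\<^sup>2 * (p e)\<^sup>2 / 2) * (1 / a e) \<le> (e\<^sup>2 * P\<^sup>2 / 2) * (e powr (-K) / a 1)"
        using a_pos[of e] e by (intro mult_mono divide_right_mono mult_left_mono) auto
      also have "\<dots> = P\<^sup>2 / (2 * a 1) * e powr (2 - K)" unfolding pw[OF e(1), symmetric] by simp
      finally show ?thesis by simp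
    qed
    ultimately show ?thesis unfolding b_def by (simp add: algebra_simps)
  qed
  have "((\<lambda>e. e powr (2 - K)) \<longlongrightarrow> 0) (at_right 0)"
    by (rule tendsto_zero_powrI[of _ _ _ "2 - K"]) (use K in \<open>auto simp: eventually_at_right_field intro!: tendsto_intros exI[of _ 1]\<close>)
  then have "(b \<longlongrightarrow> (P' + 2 * P) * sqrt (0 * (?N / a 1)) + P\<^sup>2 / (2 * a 1) * 0) (at_right 0)"
    unfolding b_def \<eta>_def by (intro tendsto_intros)
  then have b0: "(b \<longlongrightarrow> 0) (at_right 0)" by simp
  have Ji: "integrable (lebesgue_on {0<..<1}) ?J" by (rule integrable_L2_weighted[OF H2_deriv(3)[OF p] gL])
  note J = lebesgue_on_Ioo_has_integral[OF Ji]
  have lim: "((\<lambda>e. - integral {e..1} ?J + (3 + K/2) * ?N + R + b e) \<longlongrightarrow> - integral {0..1} ?J + (3 + K/2) * ?N + R + 0) (at_right 0)"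
    using J by (intro tendsto_intros integral_tail_tendsto b0) auto
  have "a 1 * (deriv01 (deriv01 u) 1)\<^sup>2 / 2 \<le> - integral {e..1} ?J + (3 + K/2) * ?N + R + b e" if "0 < e" "e < 1" for e
    using multiplier_inequality_truncated[OF u p ae that R[OF that]] bound[OF that] by linarith
  then have "\<forall>\<^sub>F e in at_right 0. a 1 * (deriv01 (deriv01 u) 1)\<^sup>2 / 2 \<le> - integral {e..1} ?J + (3 + K/2) * ?N + R + b e"
    by (auto simp: eventually_at_right_field intro!: exI[of _ 1])
  from tendsto_lowerbound[OF lim this]
  have "a 1 * (deriv01 (deriv01 u) 1)\<^sup>2 / 2 \<le> - integral {0..1} ?J + (3 + K/2) * ?N + R" by simp
  moreover have "(LINT x|lebesgue_on {0<..<1}. - op_A a u x * x\<^sup>2 * deriv01 u x) = (LINT x|lebesgue_on {0<..<1}. - ?J x)"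
    by (rule Bochner_Integration.integral_cong) (use op_A_eq[OF u p ae] in \<open>auto simp: space_lebesgue_on\<close>)
  ultimately show ?thesis using J by (simp add: integral_unique)
qed

text \<open>v v' is half the derivative of v^2. The boundary values vanish by v(1) = 0 and by the
  weight at 0, and what remains is the integral of - x v^2, at least that of - v^2. Hence the entry
  1 in the maximum multiplied by T.\<close>

lemma velocity_multiplier:
  assumes v: "v \<in> weighted_space a"
  shows "(LINT x|lebesgue_on {0<..<1}. v x * x\<^sup>2 * deriv01 v x) \<ge> - (LINT x|lebesgue_on {0<..<1}. (v x)\<^sup>2)"
proof -
  have vc: "continuous_on {0..1} v" using v by (auto simp: weighted_space_def intro: abs_cont_on_imp_continuous_on)
  have vL: "v \<in> L2" by (rule continuous_on_imp_L2[OF vc])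
  then have vi: "integrable (lebesgue_on {0<..<1}) (\<lambda>x. (v x)\<^sup>2)" by (simp add: L2_on_def)
  have i: "integrable (lebesgue_on {0<..<1}) (\<lambda>x. v x * x\<^sup>2 * deriv01 v x)"
    by (rule integrable_L2_weighted[OF vL]) (use v in \<open>simp add: weighted_space_def\<close>)
  note I = lebesgue_on_Ioo_has_integral[OF i] and V = lebesgue_on_Ioo_has_integral[OF vi]
  have "((\<lambda>x. x * (v x)\<^sup>2 + v x * x\<^sup>2 * deriv01 v x) has_integral (1\<^sup>2 * (v 1)\<^sup>2 / 2 - 0\<^sup>2 * (v 0)\<^sup>2 / 2)) {0..1}"
  \<comment> \<open>Continuity at 0 replaces differentiability there, which the weighted space does
    not give.\<close>
  proof (rule fundamental_theorem_of_calculus_interior)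
    show "continuous_on {0..1} (\<lambda>x. x\<^sup>2 * (v x)\<^sup>2 / 2)" by (intro continuous_intros vc) auto
    fix x :: real assume x: "x \<in> {0<..<1}"
    have "(v has_real_derivative deriv01 v x) (at x)"
      by (rule has_real_derivative_interior[OF weighted_space_deriv[OF v] x]) (use x in auto)
    then have "((\<lambda>x. x\<^sup>2 * (v x)\<^sup>2 / 2) has_real_derivative x * (v x)\<^sup>2 + v x * x\<^sup>2 * deriv01 v x) (at x)"
      by (auto intro!: derivative_eq_intros simp: power2_eq_square algebra_simps)
    then show "((\<lambda>x. x\<^sup>2 * (v x)\<^sup>2 / 2) has_vector_derivative x * (v x)\<^sup>2 + v x * x\<^sup>2 * deriv01 v x) (at x)"
      by (simp add: has_real_derivative_iff_has_vector_derivative)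
  qed simp
  moreover have "v 1 = 0" using v by (simp add: weighted_space_def)
  ultimately have F: "((\<lambda>x. x * (v x)\<^sup>2 + v x * x\<^sup>2 * deriv01 v x) has_integral 0) {0..1}" by simp
  have "0 \<le> (LINT x|lebesgue_on {0<..<1}. (v x)\<^sup>2) + (LINT x|lebesgue_on {0<..<1}. v x * x\<^sup>2 * deriv01 v x)"
    by (rule has_integral_le[OF F has_integral_add[OF V I]]) (auto intro!: mult_left_le_one_le)
  then show ?thesis by simp
qed

end

section \<open>Geometry of the energy space\<close>

lemma degenerate_weight_of_degeneracy_const:
  assumes "weakly_degenerate a \<or> strongly_degenerate a"
  shows "degenerate_weight a (degeneracy_const a)"
proof -
  have bdd: "bdd_above ((\<lambda>x. x * \<bar>deriv01 a x\<bar> / a x) ` {0<..1})"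
    and pos: "\<And>x. x \<in> {0<..1} \<Longrightarrow> 0 < a x"
    using assms by (auto simp: weakly_degenerate_def strongly_degenerate_def)
  show ?thesis
  proof
    show "x * \<bar>deriv01 a x\<bar> \<le> degeneracy_const a * a x" if x: "x \<in> {0<..1}" for x
    proof -
      have "x * \<bar>deriv01 a x\<bar> / a x \<le> degeneracy_const a"
        unfolding degeneracy_const_def by (rule cSUP_upper[OF x bdd])
      then show ?thesis using pos[OF x] by (simp add: pos_divide_le_eq)
    qed
    show "continuous_on {0<..1} (deriv01 a)"
    proof -
      have "{0<..1} \<subseteq> {0..1::real}" by auto
      then show ?thesis
        using assms continuous_on_subset[of "{0..1}" "deriv01 a"]
        unfolding weakly_degenerate_def strongly_degenerate_def by blast
    qed
    show "a differentiable (at x within {0..1})" if "x \<in> {0<..1}" for x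
      using assms that by (auto simp: weakly_degenerate_def strongly_degenerate_def)
  qed (use assms in \<open>auto simp: weakly_degenerate_def strongly_degenerate_def\<close>)
qed

section \<open>Linear combinations and norms in L2 and in the energy space\<close>

lemma L2_on_lincomb:
  assumes f: "f \<in> L2_on S" and g: "g \<in> L2_on S"
  shows "(\<lambda>x. \<alpha> * f x + \<beta> * g x) \<in> L2_on S"
    "(LINT x|lebesgue_on S. (\<alpha> * f x + \<beta> * g x)\<^sup>2) = \<alpha>\<^sup>2 * (LINT x|lebesgue_on S. (f x)\<^sup>2)
       + 2 * \<alpha> * \<beta> * (LINT x|lebesgue_on S. f x * g x) + \<beta>\<^sup>2 * (LINT x|lebesgue_on S. (g x)\<^sup>2)"
proof -
  have fg: "f \<in> borel_measurable (lebesgue_on S)" "integrable (lebesgue_on S) (\<lambda>x. (f x)\<^sup>2)"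
    "g \<in> borel_measurable (lebesgue_on S)" "integrable (lebesgue_on S) (\<lambda>x. (g x)\<^sup>2)"
    using f g by (auto simp: L2_on_def)
  note i = integrable_mult_L2[OF fg]
  have eq: "(\<lambda>x. (\<alpha> * f x + \<beta> * g x)\<^sup>2) = (\<lambda>x. \<alpha>\<^sup>2 * (f x)\<^sup>2 + 2 * \<alpha> * \<beta> * (f x * g x) + \<beta>\<^sup>2 * (g x)\<^sup>2)"
    by (auto simp: power2_eq_square algebra_simps)
  show "(\<lambda>x. \<alpha> * f x + \<beta> * g x) \<in> L2_on S"
    unfolding L2_on_def mem_Collect_eq eq using fg i by simp
  show "(LINT x|lebesgue_on S. (\<alpha> * f x + \<beta> * g x)\<^sup>2) = \<alpha>\<^sup>2 * (LINT x|lebesgue_on S. (f x)\<^sup>2)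
       + 2 * \<alpha> * \<beta> * (LINT x|lebesgue_on S. f x * g x) + \<beta>\<^sup>2 * (LINT x|lebesgue_on S. (g x)\<^sup>2)"
    unfolding eq using fg i by simp
qed

lemma L2_on_Minkowski:
  assumes f: "f \<in> L2_on S" and g: "g \<in> L2_on S"
  shows "sqrt (LINT x|lebesgue_on S. (f x + g x)\<^sup>2) \<le> sqrt (LINT x|lebesgue_on S. (f x)\<^sup>2) + sqrt (LINT x|lebesgue_on S. (g x)\<^sup>2)"
proof -
  let ?A = "LINT x|lebesgue_on S. (f x)\<^sup>2" and ?B = "LINT x|lebesgue_on S. f x * g x" and ?C = "LINT x|lebesgue_on S. (g x)\<^sup>2"
  have "?B\<^sup>2 \<le> ?A * ?C" using f g by (intro integral_Cauchy_Schwarz) (auto simp: L2_on_def)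
  then have "?B \<le> sqrt ?A * sqrt ?C" unfolding real_sqrt_mult[symmetric] by (rule real_le_rsqrt)
  moreover have "(sqrt ?A)\<^sup>2 = ?A" "(sqrt ?C)\<^sup>2 = ?C" by simp_all
  ultimately have "?A + 2 * ?B + ?C \<le> (sqrt ?A + sqrt ?C)\<^sup>2" unfolding power2_sum by linarith
  then have "(LINT x|lebesgue_on S. (f x + g x)\<^sup>2) \<le> (sqrt ?A + sqrt ?C)\<^sup>2"
    using L2_on_lincomb(2)[OF f g, of 1 1] by simp
  then show ?thesis by (intro real_le_lsqrt) auto
qed

locale degenerate_beam = degenerate_weight +
  assumes degenerate: "weakly_degenerate a \<or> strongly_degenerate a"
begin

lemma H2a0_weighted_space:
  assumes "u \<in> H2a0 a"
  shows "u \<in> weighted_space a"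
proof -
  have "abs_cont_on c 1 (deriv01 u)" if "c \<in> {0<..<1}" for c
    using assms degenerate that by (auto simp: H2a0_def intro: abs_cont_on_subset[of 0 1])
  moreover have "deriv01 u 1 = 0" using assms degenerate by (auto simp: H2a0_def)
  ultimately show ?thesis using assms by (auto simp: H2a0_def weighted_space_def H10_def H1_def)
qed

text \<open>In the strong case u'(0) may fail to exist, and \<open>deriv01\<close> is then an
  arbitrary value that need not be linear; hence the condition at 0.\<close>

lemma deriv01_lincomb:
  assumes u: "u \<in> H2a0 a" and w: "w \<in> H2a0 a" and x: "x \<in> {0..1}" "x = 0 \<Longrightarrow> weakly_degenerate a"
  shows "deriv01 (\<lambda>x. \<alpha> * u x + \<beta> * w x) x = \<alpha> * deriv01 u x + \<beta> * deriv01 w x"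
proof -
  have D: "(v has_vector_derivative deriv01 v x) (at x within {0..1})" if v: "v \<in> H2a0 a" for v
  proof (cases "x = 0")
    case True
    then have "abs_cont_on 0 1 (deriv01 v)" "abs_cont_on 0 1 v"
      using v x(2) by (auto simp: H2a0_def H10_def H1_def)
    then show ?thesis using x(1)
      by (intro abs_cont_on_continuous_deriv01[of 0 v "deriv01 v" "{}"] abs_cont_on_imp_continuous_on) auto
  next
    case False
    then show ?thesis by (intro weighted_space_deriv[OF H2a0_weighted_space[OF v]]) (use x in auto)
  qed
  show ?thesis
    by (rule deriv01_eqI[OF _ x(1)]) (auto intro!: derivative_eq_intros D u w)
qed

lemma deriv01_deriv01_lincomb:
  assumes u: "u \<in> H2a0 a" and w: "w \<in> H2a0 a"
  shows "AE x in lebesgue_on {0<..<1}. deriv01 (deriv01 (\<lambda>x. \<alpha> * u x + \<beta> * w x)) x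
    = \<alpha> * deriv01 (deriv01 u) x + \<beta> * deriv01 (deriv01 w) x"
proof -
  have ae: "AE x in lebesgue_on {0<..<1}. (deriv01 v has_vector_derivative deriv01 (deriv01 v) x) (at x within {0..1})"
    if v: "v \<in> H2a0 a" for v
  proof -
    \<comment> \<open>u' is absolutely continuous only on [c,1] with 0 < c < 1. The points 1/(n+2)
      stay strictly inside (0,1) and exhaust (0,1], so countably many null sets suffice.\<close>
    have "\<exists>N. negligible N \<and> (\<forall>x\<in>{1 / real (Suc (Suc n))..1} - N. (deriv01 v has_vector_derivative deriv01 (deriv01 v) x) (at x within {0..1}))" for n
    proof -
      have "abs_cont_on (1 / real (Suc (Suc n))) 1 (deriv01 v)"
        using H2a0_weighted_space[OF v] by (auto simp: weighted_space_def)
      then show ?thesis by (rule abs_cont_on_deriv01_ae) (auto simp: field_simps)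
    qed
    then obtain N where N: "\<And>n. negligible (N n)"
      "\<And>n x. x \<in> {1 / real (Suc (Suc n))..1} - N n \<Longrightarrow> (deriv01 v has_vector_derivative deriv01 (deriv01 v) x) (at x within {0..1})"
      by metis
    show ?thesis
    proof (rule negligible_AE_lebesgue_on[of "\<Union>(range N)"])
      show "negligible (\<Union>(range N))" using N(1) by (intro negligible_countable_Union) auto
      fix x :: real assume x: "x \<in> {0<..<1} - \<Union>(range N)"
      obtain n where "1 / real (Suc n) < x" using x nat_approx_posE[of x] by auto
      moreover have "1 / real (Suc (Suc n)) \<le> 1 / real (Suc n)" by (simp add: field_simps)
      ultimately have "1 / real (Suc (Suc n)) \<le> x" by linarith
      then show "(deriv01 v has_vector_derivative deriv01 (deriv01 v) x) (at x within {0..1})"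
        by (intro N(2)[of x n]) (use x in auto)
    qed simp
  qed
  have "AE x in lebesgue_on {0<..<1}. x \<in> {0<..<1}" by (rule AE_I2) (simp add: space_lebesgue_on)
  with ae[OF u] ae[OF w] show ?thesis
  proof eventually_elim
    case (elim x)
    have x: "x \<in> {0..1}" using elim(3) by simp
    have "((\<lambda>x. \<alpha> * deriv01 u x + \<beta> * deriv01 w x) has_vector_derivative
        \<alpha> * deriv01 (deriv01 u) x + \<beta> * deriv01 (deriv01 w) x) (at x within {0..1})"
      using elim by (auto intro!: derivative_eq_intros)
    then have "deriv01 (\<lambda>x. \<alpha> * deriv01 u x + \<beta> * deriv01 w x) x
        = \<alpha> * deriv01 (deriv01 u) x + \<beta> * deriv01 (deriv01 w) x"
      by (rule deriv01_eqI[OF _ x])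
    moreover have "deriv01 (deriv01 (\<lambda>x. \<alpha> * u x + \<beta> * w x)) x = deriv01 (\<lambda>x. \<alpha> * deriv01 u x + \<beta> * deriv01 w x) x"
      by (rule deriv01_cong[of "{0<..}"]) (use elim(3) deriv01_lincomb[OF u w] in auto)
    ultimately show ?case by simp
  qed
qed

lemma H2a0_lincomb:
  assumes u: "u \<in> H2a0 a" and w: "w \<in> H2a0 a"
  shows "(\<lambda>x. \<alpha> * u x + \<beta> * w x) \<in> H2a0 a"
proof -
  let ?v = "\<lambda>x. \<alpha> * u x + \<beta> * w x"
  note U = u[unfolded H2a0_def H10_def H1_def] and Ww = w[unfolded H2a0_def H10_def H1_def]
  have d: "deriv01 ?v x = \<alpha> * deriv01 u x + \<beta> * deriv01 w x" if "0 < x" "x \<le> 1" for x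
    using deriv01_lincomb[OF u w] that by simp
  have ac: "abs_cont_on 0 1 ?v" using U Ww by (intro abs_cont_on_lincomb) auto
  have "(\<lambda>x. \<alpha> * deriv01 u x + \<beta> * deriv01 w x) \<in> L2" using U Ww by (intro L2_on_lincomb) auto
  then have L: "deriv01 ?v \<in> L2"
    by (rule L2_on_AE) (use d in \<open>auto intro!: AE_I2 simp: space_lebesgue_on\<close>)
  have "(\<lambda>x. \<alpha> * (sqrt (a x) * deriv01 (deriv01 u) x) + \<beta> * (sqrt (a x) * deriv01 (deriv01 w) x)) \<in> L2"
    using U Ww by (intro L2_on_lincomb) auto
  then have L': "(\<lambda>x. sqrt (a x) * deriv01 (deriv01 ?v) x) \<in> L2"
  proof (rule L2_on_AE)
    show "AE x in lebesgue_on {0<..<1}. \<alpha> * (sqrt (a x) * deriv01 (deriv01 u) x) + \<beta> * (sqrt (a x) * deriv01 (deriv01 w) x)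
      = sqrt (a x) * deriv01 (deriv01 ?v) x"
      using deriv01_deriv01_lincomb[OF u w, of \<alpha> \<beta>] by eventually_elim (simp add: algebra_simps)
  qed simp
  have WD: "abs_cont_on 0 1 (deriv01 ?v) \<and> deriv01 ?v 0 = 0 \<and> deriv01 ?v 1 = 0" if wd: "weakly_degenerate a"
  proof -
    have d0: "deriv01 ?v x = \<alpha> * deriv01 u x + \<beta> * deriv01 w x" if "0 \<le> x" "x \<le> 1" for x
      using deriv01_lincomb[OF u w _ wd] that by simp
    show ?thesis
      using abs_cont_on_cong[OF abs_cont_on_lincomb[of 0 1 "deriv01 u" "deriv01 w" \<alpha> \<beta>] d0] d0[of 0] d0[of 1] U Ww wd by auto
  qed
  have SD: "(\<forall>c\<in>{0<..<1}. abs_cont_on c 1 (deriv01 ?v)) \<and> deriv01 ?v 1 = 0" if sd: "strongly_degenerate a"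
  proof -
    have "abs_cont_on c 1 (deriv01 ?v)" if c: "c \<in> {0<..<1}" for c
      by (rule abs_cont_on_cong[OF abs_cont_on_lincomb[of c 1 "deriv01 u" "deriv01 w" \<alpha> \<beta>]])
        (use U Ww sd c d in auto)
    then show ?thesis using d[of 1] U Ww sd by auto
  qed
  show ?thesis
    unfolding H2a0_def H10_def H1_def using ac L L' WD SD U Ww by simp
qed

lemma H0_lincomb: "z \<in> H0 a \<Longrightarrow> w \<in> H0 a \<Longrightarrow> lincomb \<alpha> z \<beta> w \<in> H0 a"
  unfolding H0_def lincomb_def by (auto intro: H2a0_lincomb L2_on_lincomb)

lemma H0_norm_sq:
  assumes "z \<in> H0 a"
  shows "(H0_norm a z)\<^sup>2 = curvature_energy a (fst z) + (LINT x|lebesgue_on {0<..<1}. (snd z x)\<^sup>2)"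
proof -
  have "fst z \<in> weighted_space a" using assms H2a0_weighted_space by (auto simp: H0_def)
  then have "0 \<le> curvature_energy a (fst z)" by (rule curvature_energy_nonneg)
  then show ?thesis unfolding H0_norm_def curvature_energy_def by simp
qed

lemma H0_norm_nonneg: "z \<in> H0 a \<Longrightarrow> 0 \<le> H0_norm a z"
  using curvature_energy_nonneg[OF H2a0_weighted_space, of "fst z"]
  unfolding H0_norm_def curvature_energy_def by (auto simp: H0_def)

text \<open>\<open>B\<close> is the inner product of the energy space. The existential quantifier
  stands outside the coefficients, so \<open>B\<close> is the same for all linear combinations;
  nothing else about it enters the triangle inequality.\<close>

lemma H0_norm_quadratic:
  assumes z: "z \<in> H0 a" and w: "w \<in> H0 a"
  shows "\<exists>B. \<forall>\<alpha> \<beta>. (H0_norm a (lincomb \<alpha> z \<beta> w))\<^sup>2 = \<alpha>\<^sup>2 * (H0_norm a z)\<^sup>2 + 2 * \<alpha> * \<beta> * B + \<beta>\<^sup>2 * (H0_norm a w)\<^sup>2"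
proof -
  let ?M = "lebesgue_on {0<..<1::real}"
  let ?F = "\<lambda>u x. sqrt (a x) * deriv01 (deriv01 u) x"
  have fz: "fst z \<in> H2a0 a" "snd z \<in> L2" and fw: "fst w \<in> H2a0 a" "snd w \<in> L2" using z w by (auto simp: H0_def)
  have F: "?F u \<in> L2" if "u \<in> H2a0 a" for u using that by (auto simp: H2a0_def)
  have ce: "curvature_energy a u = (LINT x|?M. (?F u x)\<^sup>2)" if "u \<in> H2a0 a" for u
    using weighted_L2_energy(2)[OF F[OF that]] by (simp add: curvature_energy_def)
  show ?thesis
  proof (intro exI allI)
    fix \<alpha> \<beta>
    have "curvature_energy a (\<lambda>x. \<alpha> * fst z x + \<beta> * fst w x) = (LINT x|?M. (\<alpha> * ?F (fst z) x + \<beta> * ?F (fst w) x)\<^sup>2)"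
      unfolding ce[OF H2a0_lincomb[OF fz(1) fw(1)]]
    proof (rule integral_cong_AE)
      show "(\<lambda>x. (?F (\<lambda>x. \<alpha> * fst z x + \<beta> * fst w x) x)\<^sup>2) \<in> borel_measurable ?M"
        using F[OF H2a0_lincomb[OF fz(1) fw(1), of \<alpha> \<beta>]] unfolding L2_on_def by (intro borel_measurable_power) blast
      show "(\<lambda>x. (\<alpha> * ?F (fst z) x + \<beta> * ?F (fst w) x)\<^sup>2) \<in> borel_measurable ?M"
        using L2_on_lincomb(1)[OF F[OF fz(1)] F[OF fw(1)]] unfolding L2_on_def by (intro borel_measurable_power) blast
      show "AE x in ?M. (?F (\<lambda>x. \<alpha> * fst z x + \<beta> * fst w x) x)\<^sup>2 = (\<alpha> * ?F (fst z) x + \<beta> * ?F (fst w) x)\<^sup>2"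
        using deriv01_deriv01_lincomb[OF fz(1) fw(1), of \<alpha> \<beta>] by eventually_elim (simp add: algebra_simps)
    qed
    then have "curvature_energy a (fst (lincomb \<alpha> z \<beta> w)) = \<alpha>\<^sup>2 * curvature_energy a (fst z)
       + 2 * \<alpha> * \<beta> * (LINT x|?M. ?F (fst z) x * ?F (fst w) x) + \<beta>\<^sup>2 * curvature_energy a (fst w)"
      unfolding L2_on_lincomb(2)[OF F[OF fz(1)] F[OF fw(1)]] ce[OF fz(1)] ce[OF fw(1)] by (simp add: lincomb_def)
    moreover have "(LINT x|?M. (snd (lincomb \<alpha> z \<beta> w) x)\<^sup>2) = \<alpha>\<^sup>2 * (LINT x|?M. (snd z x)\<^sup>2)
       + 2 * \<alpha> * \<beta> * (LINT x|?M. snd z x * snd w x) + \<beta>\<^sup>2 * (LINT x|?M. (snd w x)\<^sup>2)"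
      using L2_on_lincomb(2)[OF fz(2) fw(2), of \<alpha> \<beta>] by (simp add: lincomb_def)
    ultimately show "(H0_norm a (lincomb \<alpha> z \<beta> w))\<^sup>2 = \<alpha>\<^sup>2 * (H0_norm a z)\<^sup>2
      + 2 * \<alpha> * \<beta> * ((LINT x|?M. ?F (fst z) x * ?F (fst w) x) + (LINT x|?M. snd z x * snd w x)) + \<beta>\<^sup>2 * (H0_norm a w)\<^sup>2"
      unfolding H0_norm_sq[OF H0_lincomb[OF z w]] H0_norm_sq[OF z] H0_norm_sq[OF w] by (simp add: algebra_simps)
  qed
qed

text \<open>Symmetry, the triangle inequality and stability under linear combinations of
  \<open>H0_dist\<close> reduce to this estimate, once differences of states are rewritten as a
  \<open>lincomb\<close> by identities between functions.\<close>

lemma H0_norm_lincomb_le: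
  assumes z: "z \<in> H0 a" and w: "w \<in> H0 a"
  shows "H0_norm a (lincomb \<alpha> z \<beta> w) \<le> \<bar>\<alpha>\<bar> * H0_norm a z + \<bar>\<beta>\<bar> * H0_norm a w"
proof -
  obtain B where B: "\<And>\<alpha> \<beta>. (H0_norm a (lincomb \<alpha> z \<beta> w))\<^sup>2 = \<alpha>\<^sup>2 * (H0_norm a z)\<^sup>2 + 2 * \<alpha> * \<beta> * B + \<beta>\<^sup>2 * (H0_norm a w)\<^sup>2"
    using H0_norm_quadratic[OF z w] by blast
  note n = H0_norm_nonneg[OF z] H0_norm_nonneg[OF w]
  have "0 \<le> (H0_norm a z)\<^sup>2 + 2 * t * B + t\<^sup>2 * (H0_norm a w)\<^sup>2" for t
  proof -
    have "0 \<le> (H0_norm a (lincomb 1 z t w))\<^sup>2" by simp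
    then show ?thesis unfolding B by simp
  qed
  then have "B\<^sup>2 \<le> (H0_norm a z)\<^sup>2 * (H0_norm a w)\<^sup>2" by (rule discriminant_le)
  then have "\<bar>B\<bar> \<le> \<bar>H0_norm a z * H0_norm a w\<bar>"
    by (simp only: abs_le_square_iff power_mult_distrib)
  then have "\<bar>B\<bar> \<le> H0_norm a z * H0_norm a w" using n by simp
  then have "\<bar>\<alpha> * \<beta>\<bar> * \<bar>B\<bar> \<le> \<bar>\<alpha> * \<beta>\<bar> * (H0_norm a z * H0_norm a w)" by (rule mult_left_mono) simp
  then have "\<alpha> * \<beta> * B \<le> (\<bar>\<alpha>\<bar> * H0_norm a z) * (\<bar>\<beta>\<bar> * H0_norm a w)"
    using abs_ge_self[of "\<alpha> * \<beta> * B"] by (simp add: abs_mult mult_ac)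
  moreover have "(\<bar>\<alpha>\<bar> * H0_norm a z)\<^sup>2 = \<alpha>\<^sup>2 * (H0_norm a z)\<^sup>2" "(\<bar>\<beta>\<bar> * H0_norm a w)\<^sup>2 = \<beta>\<^sup>2 * (H0_norm a w)\<^sup>2"
    by (simp_all add: power_mult_distrib)
  ultimately have "(H0_norm a (lincomb \<alpha> z \<beta> w))\<^sup>2 \<le> (\<bar>\<alpha>\<bar> * H0_norm a z + \<bar>\<beta>\<bar> * H0_norm a w)\<^sup>2"
    unfolding B power2_sum by linarith
  then show ?thesis by (rule power2_le_imp_le) (use n in simp)
qed

lemma H0_dist_nonneg: "x \<in> H0 a \<Longrightarrow> y \<in> H0 a \<Longrightarrow> 0 \<le> H0_dist a x y"
  unfolding H0_dist_def by (intro H0_norm_nonneg H0_lincomb)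

lemma H0_dist_triangle:
  assumes "x \<in> H0 a" "y \<in> H0 a" "z \<in> H0 a"
  shows "H0_dist a x z \<le> H0_dist a x y + H0_dist a y z"
proof -
  have "lincomb 1 x (-1) z = lincomb 1 (lincomb 1 x (-1) y) 1 (lincomb 1 y (-1) z)"
    by (auto simp: lincomb_def)
  then show ?thesis
    using H0_norm_lincomb_le[OF H0_lincomb[OF assms(1,2), of 1 "-1"] H0_lincomb[OF assms(2,3), of 1 "-1"], of 1 1]
    by (simp add: H0_dist_def)
qed

lemma H0_dist_commute:
  assumes "x \<in> H0 a" "y \<in> H0 a"
  shows "H0_dist a x y = H0_dist a y x"
proof -
  have "H0_dist a p q \<le> H0_dist a q p" if "p \<in> H0 a" "q \<in> H0 a" for p q
  proof -
    have "lincomb 1 p (-1) q = lincomb (-1) (lincomb 1 q (-1) p) 0 p" by (auto simp: lincomb_def)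
    then show ?thesis
      using H0_norm_lincomb_le[OF H0_lincomb[OF that(2,1), of 1 "-1"] that(1), of "-1" 0] by (simp add: H0_dist_def)
  qed
  then show ?thesis using assms by (intro antisym)
qed

lemma H0_dist_self: assumes "x \<in> H0 a" shows "H0_dist a x x = 0"
proof -
  have "lincomb 1 x (-1) x = lincomb 0 x 0 x" by (auto simp: lincomb_def)
  then have "H0_dist a x x \<le> 0" using H0_norm_lincomb_le[OF assms assms, of 0 0] by (simp add: H0_dist_def)
  then show ?thesis using H0_dist_nonneg[OF assms assms] by simp
qed

lemma H0_norm_le_dist:
  assumes "x \<in> H0 a" "y \<in> H0 a"
  shows "H0_norm a x \<le> H0_norm a y + H0_dist a x y"
proof -
  have "x = lincomb 1 (lincomb 1 x (-1) y) 1 y" by (cases x) (auto simp: lincomb_def)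
  then show ?thesis
    using H0_norm_lincomb_le[OF H0_lincomb[OF assms, of 1 "-1"] assms(2), of 1 1] by (simp add: H0_dist_def)
qed

lemma H0_dist_lincomb_le:
  assumes "x \<in> H0 a" "x' \<in> H0 a" "y \<in> H0 a" "y' \<in> H0 a"
  shows "H0_dist a (lincomb \<alpha> x \<beta> y) (lincomb \<alpha> x' \<beta> y') \<le> \<bar>\<alpha>\<bar> * H0_dist a x x' + \<bar>\<beta>\<bar> * H0_dist a y y'"
proof -
  have "lincomb 1 (lincomb \<alpha> x \<beta> y) (-1) (lincomb \<alpha> x' \<beta> y') = lincomb \<alpha> (lincomb 1 x (-1) x') \<beta> (lincomb 1 y (-1) y')"
    by (auto simp: lincomb_def algebra_simps)
  then show ?thesis
    using H0_norm_lincomb_le[OF H0_lincomb[OF assms(1,2), of 1 "-1"] H0_lincomb[OF assms(3,4), of 1 "-1"], of \<alpha> \<beta>]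
    by (simp add: H0_dist_def)
qed

text \<open>Distance 0 means that the difference of the first components has zero curvature energy.
  The gradient bound then makes its derivative vanish on (0,1), and the value 0 at x = 1 makes the
  difference vanish itself. So the trace, a pointwise quantity, is well defined on classes of
  states.\<close>

lemma H0_eq_fst:
  assumes z: "z \<in> H0 a" and w: "w \<in> H0 a" and eq: "H0_eq a z w" and x: "x \<in> {0..1}"
  shows "fst z x = fst w x"
proof -
  define d where "d = fst (lincomb 1 z (-1) w)"
  have dH: "d \<in> weighted_space a"
    using H0_lincomb[OF z w, of 1 "-1"] H2a0_weighted_space by (auto simp: d_def H0_def mem_Times_iff)
  have "curvature_energy a d \<le> (H0_norm a (lincomb 1 z (-1) w))\<^sup>2"
    unfolding H0_norm_sq[OF H0_lincomb[OF z w]] d_def by simp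
  then have "curvature_energy a d = 0"
    using eq curvature_energy_nonneg[OF dH] by (simp add: H0_eq_def H0_dist_def)
  then have d0: "deriv01 d s = 0" if "0 < s" "s < 1" for s using deriv_sq_le[OF dH that] by simp
  have dc: "continuous_on {0..1} d" using dH by (auto simp: weighted_space_def intro: abs_cont_on_imp_continuous_on)
  have "d x = d 1"
  proof (cases "x = 1")
    case False
    have "d 1 = d x"
    proof (rule DERIV_isconst2[of x 1])
      show "x < 1" using x False by simp
      show "continuous_on {x..1} d" using continuous_on_subset[OF dc] x by auto
      show "(d has_real_derivative 0) (at t)" if "x < t" "t < 1" for t
        using has_real_derivative_interior[OF weighted_space_deriv[OF dH], of t] d0[of t] that x by auto
    qed (use x in auto)
    then show ?thesis by simp
  qed simp
  moreover have "d 1 = 0" using dH by (simp add: weighted_space_def)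
  ultimately show ?thesis by (simp add: d_def lincomb_def)
qed

lemma H0_eq_trace:
  assumes "z \<in> H0 a" "w \<in> H0 a" "H0_eq a z w"
  shows "deriv01 (deriv01 (fst z)) 1 = deriv01 (deriv01 (fst w)) 1"
proof -
  have first: "deriv01 (fst z) y = deriv01 (fst w) y" if "y \<in> {0..1}" for y
    by (rule deriv01_cong[of UNIV]) (use H0_eq_fst[OF assms] that in auto)
  show ?thesis by (rule deriv01_cong[of UNIV]) (use first in auto)
qed

text \<open>The functional of the multiplier method, made bilinear by separating velocity and
  displacement. Its derivative along an orbit follows from a product rule, and boundedness makes it
  independent of representatives.\<close>

definition multiplier_form :: "state \<Rightarrow> state \<Rightarrow> real" where
  "multiplier_form z w = (LINT x|lebesgue_on {0<..<1}. snd z x * x\<^sup>2 * deriv01 (fst w) x)"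

lemma multiplier_form_integrable:
  assumes "z \<in> H0 a" "w \<in> H0 a"
  shows "integrable (lebesgue_on {0<..<1}) (\<lambda>x. snd z x * x\<^sup>2 * deriv01 (fst w) x)"
  using assms H2a0_weighted_space by (intro integrable_L2_weighted) (auto simp: H0_def weighted_space_def)

lemma multiplier_form_sq_le:
  assumes z: "z \<in> H0 a" and w: "w \<in> H0 a"
  shows "(multiplier_form z w)\<^sup>2 \<le> (LINT x|lebesgue_on {0<..<1}. (snd z x)\<^sup>2) * (curvature_energy a (fst w) / (a 1 * (2 - K)))"
proof -
  let ?M = "lebesgue_on {0<..<1::real}" and ?g = "deriv01 (fst w)"
  have W: "fst w \<in> weighted_space a" using w H2a0_weighted_space by (auto simp: H0_def)
  have g: "?g \<in> L2" using W by (simp add: weighted_space_def)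
  have v: "snd z \<in> L2" using z by (auto simp: H0_def)
  have xg: "(\<lambda>x. x\<^sup>2 * ?g x) \<in> L2" by (rule L2_mult_square[OF g])
  have "(LINT x|?M. snd z x * (x\<^sup>2 * ?g x))\<^sup>2 \<le> (LINT x|?M. (snd z x)\<^sup>2) * (LINT x|?M. (x\<^sup>2 * ?g x)\<^sup>2)"
    by (rule integral_Cauchy_Schwarz) (use v xg in \<open>auto simp: L2_on_def\<close>)
  also have "\<dots> \<le> (LINT x|?M. (snd z x)\<^sup>2) * (curvature_energy a (fst w) / (a 1 * (2 - K)))"
  proof (rule mult_left_mono)
    have "(LINT x|?M. (x\<^sup>2 * ?g x)\<^sup>2) \<le> (LINT x|?M. (?g x)\<^sup>2)"
    proof (rule integral_mono)
      show "(x\<^sup>2 * ?g x)\<^sup>2 \<le> (?g x)\<^sup>2" if "x \<in> space ?M" for x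
      proof -
        have "(x\<^sup>2)\<^sup>2 \<le> 1" using that by (simp add: power_le_one space_lebesgue_on)
        then show ?thesis using mult_right_mono[of "(x\<^sup>2)\<^sup>2" 1 "(?g x)\<^sup>2"] by (simp add: power_mult_distrib)
      qed
    qed (use g xg in \<open>auto simp: L2_on_def\<close>)
    also have "\<dots> \<le> curvature_energy a (fst w) / (a 1 * (2 - K))" by (rule deriv_L2_le[OF W])
    finally show "(LINT x|?M. (x\<^sup>2 * ?g x)\<^sup>2) \<le> curvature_energy a (fst w) / (a 1 * (2 - K))" .
  qed simp
  finally show ?thesis by (simp add: multiplier_form_def mult.assoc)
qed

lemma multiplier_form_bound:
  obtains C where "0 \<le> C" "\<And>z w. z \<in> H0 a \<Longrightarrow> w \<in> H0 a \<Longrightarrow> \<bar>multiplier_form z w\<bar> \<le> C * (H0_norm a z * H0_norm a w)"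
proof -
  define c where "c = 1 / (a 1 * (2 - K))"
  have c: "0 \<le> c" using a1_pos K by (simp add: c_def)
  show thesis
  proof (rule that[of "sqrt c"])
    fix z w assume z: "z \<in> H0 a" and w: "w \<in> H0 a"
    have "fst z \<in> weighted_space a" "fst w \<in> weighted_space a" using z w H2a0_weighted_space by (auto simp: H0_def)
    then have N: "0 \<le> curvature_energy a (fst z)" "0 \<le> curvature_energy a (fst w)" by (auto intro: curvature_energy_nonneg)
    have "(multiplier_form z w)\<^sup>2 \<le> (LINT x|lebesgue_on {0<..<1}. (snd z x)\<^sup>2) * (c * curvature_energy a (fst w))"
      using multiplier_form_sq_le[OF z w] by (simp add: c_def)
    also have "\<dots> \<le> (H0_norm a z)\<^sup>2 * (c * (H0_norm a w)\<^sup>2)"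
      unfolding H0_norm_sq[OF z] H0_norm_sq[OF w] using N c by (intro mult_mono mult_left_mono) auto
    also have "\<dots> = (sqrt c * (H0_norm a z * H0_norm a w))\<^sup>2" using c by (simp add: power_mult_distrib)
    finally have "\<bar>multiplier_form z w\<bar> \<le> \<bar>sqrt c * (H0_norm a z * H0_norm a w)\<bar>" by (simp only: abs_le_square_iff)
    also have "\<dots> = sqrt c * (H0_norm a z * H0_norm a w)"
      using c H0_norm_nonneg[OF z] H0_norm_nonneg[OF w] by (intro abs_of_nonneg mult_nonneg_nonneg) auto
    finally show "\<bar>multiplier_form z w\<bar> \<le> sqrt c * (H0_norm a z * H0_norm a w)" .
  qed (use c in simp)
qed

text \<open>With c = 1 / (a(1) (2 - K)) and m = max c 1, Cauchy-Schwarz gives V (c N) <= (m V) (m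
  N), and 4 N V <= (N + V)^2 supplies the factor 1/2. The maximum with 1 avoids the square root of
  c.\<close>

lemma multiplier_form_diag_le:
  assumes z: "z \<in> H0 a"
  shows "\<bar>multiplier_form z z\<bar> \<le> max (1 / (a 1 * (2 - K))) 1 / 2 * (H0_norm a z)\<^sup>2"
proof -
  define m where "m = max (1 / (a 1 * (2 - K))) 1"
  define V where "V = (LINT x|lebesgue_on {0<..<1}. (snd z x)\<^sup>2)"
  define N where "N = curvature_energy a (fst z)"
  have N: "0 \<le> N" using z H2a0_weighted_space by (auto simp: H0_def N_def intro!: curvature_energy_nonneg)
  have V: "0 \<le> V" by (simp add: V_def)
  have NV: "(H0_norm a z)\<^sup>2 = N + V" using H0_norm_sq[OF z] by (simp add: N_def V_def)
  have "(multiplier_form z z)\<^sup>2 \<le> V * (1 / (a 1 * (2 - K)) * N)"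
    using multiplier_form_sq_le[OF z z] by (simp add: V_def N_def)
  also have "\<dots> \<le> (m * V) * (m * N)"
  proof (rule mult_mono)
    have "1 * V \<le> m * V" by (rule mult_right_mono) (use V in \<open>auto simp: m_def\<close>)
    then show "V \<le> m * V" by simp
    show "1 / (a 1 * (2 - K)) * N \<le> m * N" by (rule mult_right_mono) (use N in \<open>auto simp: m_def\<close>)
    show "0 \<le> m * V" using V by (simp add: m_def)
    show "0 \<le> 1 / (a 1 * (2 - K)) * N" using N a1_pos K by simp
  qed
  also have "\<dots> \<le> (m / 2 * (N + V))\<^sup>2"
  proof -
    have "4 * (N * V) \<le> (N + V)\<^sup>2" using sum_squares_bound[of N V] by (simp add: power2_sum)
    then have "(m / 2)\<^sup>2 * (4 * (N * V)) \<le> (m / 2)\<^sup>2 * (N + V)\<^sup>2" by (rule mult_left_mono) simp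
    then show ?thesis by (simp add: power2_eq_square algebra_simps)
  qed
  finally have "\<bar>multiplier_form z z\<bar> \<le> \<bar>m / 2 * (N + V)\<bar>" by (simp only: abs_le_square_iff)
  also have "\<dots> = m / 2 * (N + V)" using N V by (intro abs_of_nonneg mult_nonneg_nonneg) (auto simp: m_def)
  finally show ?thesis unfolding NV m_def .
qed

lemma multiplier_form_lincomb_left:
  assumes "x \<in> H0 a" "y \<in> H0 a" "w \<in> H0 a"
  shows "multiplier_form (lincomb \<alpha> x \<beta> y) w = \<alpha> * multiplier_form x w + \<beta> * multiplier_form y w"
proof -
  have "multiplier_form (lincomb \<alpha> x \<beta> y) w = (LINT s|lebesgue_on {0<..<1}.
      \<alpha> * (snd x s * s\<^sup>2 * deriv01 (fst w) s) + \<beta> * (snd y s * s\<^sup>2 * deriv01 (fst w) s))"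
    unfolding multiplier_form_def by (simp add: lincomb_def algebra_simps)
  also have "\<dots> = \<alpha> * multiplier_form x w + \<beta> * multiplier_form y w"
    using multiplier_form_integrable[OF assms(1,3)] multiplier_form_integrable[OF assms(2,3)]
    by (simp add: multiplier_form_def)
  finally show ?thesis .
qed

lemma multiplier_form_lincomb_right:
  assumes "x \<in> H0 a" "y \<in> H0 a" "w \<in> H0 a"
  shows "multiplier_form w (lincomb \<alpha> x \<beta> y) = \<alpha> * multiplier_form w x + \<beta> * multiplier_form w y"
proof -
  have "multiplier_form w (lincomb \<alpha> x \<beta> y) = (LINT s|lebesgue_on {0<..<1}.
      \<alpha> * (snd w s * s\<^sup>2 * deriv01 (fst x) s) + \<beta> * (snd w s * s\<^sup>2 * deriv01 (fst y) s))"
    unfolding multiplier_form_def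
  proof (rule Bochner_Integration.integral_cong[OF refl])
    fix s assume "s \<in> space (lebesgue_on {0<..<1::real})"
    then have "deriv01 (fst (lincomb \<alpha> x \<beta> y)) s = \<alpha> * deriv01 (fst x) s + \<beta> * deriv01 (fst y) s"
      using deriv01_lincomb[of "fst x" "fst y" s \<alpha> \<beta>] assms by (auto simp: lincomb_def H0_def space_lebesgue_on)
    then show "snd w s * s\<^sup>2 * deriv01 (fst (lincomb \<alpha> x \<beta> y)) s
        = \<alpha> * (snd w s * s\<^sup>2 * deriv01 (fst x) s) + \<beta> * (snd w s * s\<^sup>2 * deriv01 (fst y) s)"
      by (simp add: algebra_simps)
  qed
  also have "\<dots> = \<alpha> * multiplier_form w x + \<beta> * multiplier_form w y"
    using multiplier_form_integrable[OF assms(3,1)] multiplier_form_integrable[OF assms(3,2)]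
    by (simp add: multiplier_form_def)
  finally show ?thesis .
qed

end

section \<open>Orbits of the semigroup\<close>

locale beam_semigroup = degenerate_beam +
  fixes S :: "real \<Rightarrow> state \<Rightarrow> state"
  assumes contraction: "contraction_semigroup a S" and generator: "generated_by_cA a S"
begin

lemma semigroup_closed: "0 \<le> t \<Longrightarrow> z \<in> H0 a \<Longrightarrow> S t z \<in> H0 a"
  using contraction unfolding contraction_semigroup_def by blast

lemma semigroup_lincomb:
  "0 \<le> t \<Longrightarrow> z \<in> H0 a \<Longrightarrow> w \<in> H0 a \<Longrightarrow>
    H0_dist a (S t (lincomb \<alpha> z \<beta> w)) (lincomb \<alpha> (S t z) \<beta> (S t w)) = 0"
  using contraction unfolding contraction_semigroup_def H0_eq_def by blast

lemma semigroup_zero: "z \<in> H0 a \<Longrightarrow> H0_dist a (S 0 z) z = 0"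
  using contraction unfolding contraction_semigroup_def H0_eq_def by blast

lemma semigroup_add: "0 \<le> s \<Longrightarrow> 0 \<le> t \<Longrightarrow> z \<in> H0 a \<Longrightarrow> H0_dist a (S (s + t) z) (S s (S t z)) = 0"
  using contraction unfolding contraction_semigroup_def H0_eq_def by blast

lemma semigroup_norm: "0 \<le> t \<Longrightarrow> z \<in> H0 a \<Longrightarrow> H0_norm a (S t z) \<le> H0_norm a z"
  using contraction unfolding contraction_semigroup_def by blast

lemma semigroup_continuous: "z \<in> H0 a \<Longrightarrow> ((\<lambda>t. H0_dist a (S t z) z) \<longlongrightarrow> 0) (at_right 0)"
  using contraction unfolding contraction_semigroup_def by blast

lemma semigroup_nonexpansive:
  assumes t: "0 \<le> t" and x: "x \<in> H0 a" and y: "y \<in> H0 a"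
  shows "H0_dist a (S t x) (S t y) \<le> H0_dist a x y"
proof -
  have L: "lincomb 1 x (-1) y \<in> H0 a" "lincomb 1 (S t x) (-1) (S t y) \<in> H0 a"
    using x y t by (auto intro: H0_lincomb semigroup_closed)
  have "H0_norm a (lincomb 1 (S t x) (-1) (S t y)) \<le> H0_norm a (S t (lincomb 1 x (-1) y))"
    using H0_norm_le_dist[OF L(2) semigroup_closed[OF t L(1)]] semigroup_lincomb[OF t x y, of 1 "-1"]
      H0_dist_commute[OF L(2) semigroup_closed[OF t L(1)]] by simp
  also have "\<dots> \<le> H0_norm a (lincomb 1 x (-1) y)" by (rule semigroup_norm[OF t L(1)])
  finally show ?thesis by (simp add: H0_dist_def)
qed

text \<open>Its convergence to 0 says that \<open>w\<close> is the generator applied to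
  \<open>z\<close>. As a real function of the step it can be used as one error bound for all
  times.\<close>

definition quotient_error :: "state \<Rightarrow> state \<Rightarrow> real \<Rightarrow> real" where
  "quotient_error z w h = H0_dist a (lincomb (1 / h) (S h z) (- 1 / h) z) w"

context
  fixes z w :: state
  assumes z: "z \<in> H0 a" and w: "w \<in> H0 a" and lim: "(quotient_error z w \<longlongrightarrow> 0) (at_right 0)"
begin

text \<open>\<open>S t\<close> carries the difference quotient at time 0 to the one at time t
  without increasing the error. \<open>Y\<close> allows for the representatives
  \<open>S (t + h) z\<close> and \<open>S h (S t z)\<close>, which agree with
  \<open>S t (S h z)\<close> only up to seminorm 0.\<close>

lemma quotient_forward:
  assumes t: "0 \<le> t" and h: "0 < h" and Y: "Y \<in> H0 a" "H0_dist a Y (S t (S h z)) = 0"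
  shows "H0_dist a (lincomb (1 / h) Y (- 1 / h) (S t z)) (S t w) \<le> quotient_error z w h"
proof -
  let ?Q = "lincomb (1 / h) (S h z) (- 1 / h) z"
  let ?X = "lincomb (1 / h) Y (- 1 / h) (S t z)" and ?X' = "lincomb (1 / h) (S t (S h z)) (- 1 / h) (S t z)"
  have Sh: "S h z \<in> H0 a" using h z by (auto intro: semigroup_closed)
  have m: "?Q \<in> H0 a" "?X \<in> H0 a" "?X' \<in> H0 a" "S t ?Q \<in> H0 a" "S t w \<in> H0 a" "S t z \<in> H0 a" "S t (S h z) \<in> H0 a"
    using Sh z w t Y by (auto intro!: H0_lincomb semigroup_closed)
  have "H0_dist a ?X ?X' \<le> \<bar>1 / h\<bar> * H0_dist a Y (S t (S h z)) + \<bar>- 1 / h\<bar> * H0_dist a (S t z) (S t z)"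
    by (rule H0_dist_lincomb_le) (use m Y in auto)
  then have "H0_dist a ?X ?X' \<le> 0" using Y(2) H0_dist_self[OF m(6)] by simp
  moreover have "H0_dist a ?X' (S t ?Q) = 0"
    using semigroup_lincomb[OF t Sh z, of "1 / h" "- 1 / h"] H0_dist_commute[OF m(3,4)] by simp
  moreover have "H0_dist a (S t ?Q) (S t w) \<le> quotient_error z w h"
    unfolding quotient_error_def by (rule semigroup_nonexpansive[OF t m(1) w])
  ultimately show ?thesis
    using H0_dist_triangle[OF m(2,3,5)] H0_dist_triangle[OF m(3,4,5)] by linarith
qed

text \<open>The quotients at \<open>S t z\<close> converge to \<open>S t w\<close>, and the
  equivalence in \<open>generated_by_cA\<close> is read from the limit to the domain. It yields a
  representative in the domain, not \<open>S t z\<close> itself.\<close>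

lemma semigroup_orbit_in_domain:
  assumes t: "0 \<le> t"
  shows "\<exists>\<zeta>\<in>dom_cA a. H0_eq a \<zeta> (S t z) \<and> H0_eq a (op_cA a \<zeta>) (S t w)"
proof -
  have m: "S t z \<in> H0 a" "S t w \<in> H0 a" using z w t by (auto intro: semigroup_closed)
  have "((\<lambda>h. H0_dist a (lincomb (1 / h) (S h (S t z)) (- 1 / h) (S t z)) (S t w)) \<longlongrightarrow> 0) (at_right 0)"
  proof (rule tendsto_sandwich[OF _ _ tendsto_const lim])
    have "0 \<le> H0_dist a (lincomb (1 / h) (S h (S t z)) (- 1 / h) (S t z)) (S t w) \<and>
       H0_dist a (lincomb (1 / h) (S h (S t z)) (- 1 / h) (S t z)) (S t w) \<le> quotient_error z w h" if h: "0 < h" for h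
    proof
      have Sh: "S h z \<in> H0 a" using h z by (auto intro: semigroup_closed)
      have hm: "S h (S t z) \<in> H0 a" "S (h + t) z \<in> H0 a" "S t (S h z) \<in> H0 a"
        using h t m z Sh by (auto intro: semigroup_closed)
      show "0 \<le> H0_dist a (lincomb (1 / h) (S h (S t z)) (- 1 / h) (S t z)) (S t w)"
        using m hm by (intro H0_dist_nonneg H0_lincomb)
      have "H0_dist a (S h (S t z)) (S (h + t) z) = 0"
        using semigroup_add[of h t z] h t z H0_dist_commute[OF hm(1,2)] by simp
      moreover have "H0_dist a (S (h + t) z) (S t (S h z)) = 0"
        using semigroup_add[of t h z] h t z by (simp add: add.commute)
      ultimately have "H0_dist a (S h (S t z)) (S t (S h z)) = 0"
        using H0_dist_triangle[OF hm] H0_dist_nonneg[OF hm(1,3)] by linarith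
      then show "H0_dist a (lincomb (1 / h) (S h (S t z)) (- 1 / h) (S t z)) (S t w) \<le> quotient_error z w h"
        by (rule quotient_forward[OF t h hm(1)])
    qed
    then show "\<forall>\<^sub>F h in at_right 0. 0 \<le> H0_dist a (lincomb (1 / h) (S h (S t z)) (- 1 / h) (S t z)) (S t w)"
      "\<forall>\<^sub>F h in at_right 0. H0_dist a (lincomb (1 / h) (S h (S t z)) (- 1 / h) (S t z)) (S t w) \<le> quotient_error z w h"
      by (auto simp: eventually_at_right_field intro!: exI[of _ 1])
  qed
  then show ?thesis
    using generator m unfolding generated_by_cA_def by blast
qed

definition orbit_error :: "real \<Rightarrow> real" where
  "orbit_error h = quotient_error z w h + H0_dist a (S h w) w"

lemma orbit_error_tendsto: "(orbit_error \<longlongrightarrow> 0) (at_right 0)"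
  unfolding orbit_error_def[abs_def] using tendsto_add[OF lim semigroup_continuous[OF w]] by simp

text \<open>For s < t the quotient is a forward one based at s, so it approximates
  \<open>S s w\<close>. Moving on to \<open>S t w\<close> costs at most the distance from
  \<open>S h w\<close> to \<open>w\<close> with h = t - s, the second summand of
  \<open>orbit_error\<close>.\<close>

lemma quotient_two_sided:
  assumes s: "0 \<le> s" and t: "0 \<le> t" and st: "s \<noteq> t"
  shows "H0_dist a (lincomb (1 / (s - t)) (S s z) (- 1 / (s - t)) (S t z)) (S t w) \<le> orbit_error \<bar>s - t\<bar>"
proof -
  have m: "S s z \<in> H0 a" "S t z \<in> H0 a" "S s w \<in> H0 a" "S t w \<in> H0 a" "S \<bar>s - t\<bar> w \<in> H0 a" "S \<bar>s - t\<bar> z \<in> H0 a"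
    using z w s t by (auto intro: semigroup_closed)
  show ?thesis
  proof (cases "t < s")
    case True
    have eq: "H0_dist a (S s z) (S t (S (s - t) z)) = 0"
      using semigroup_add[of t "s - t" z] True t z by simp
    have "H0_dist a (lincomb (1 / (s - t)) (S s z) (- 1 / (s - t)) (S t z)) (S t w) \<le> quotient_error z w (s - t)"
      by (rule quotient_forward[OF t _ m(1) eq]) (use True in simp)
    then show ?thesis using H0_dist_nonneg[OF m(5) w] True by (simp add: orbit_error_def)
  next
    case False
    define h where "h = t - s"
    have h: "0 < h" "\<bar>s - t\<bar> = h" "s + h = t" using False st by (auto simp: h_def)
    have "lincomb (1 / (s - t)) (S s z) (- 1 / (s - t)) (S t z) = lincomb (1 / h) (S t z) (- 1 / h) (S s z)"
    proof -
      have "1 / (s - t) = - 1 / h" "- 1 / (s - t) = 1 / h"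
        using minus_divide_right[of 1 "t - s"] unfolding h_def by simp_all
      then show ?thesis by (simp only:) (simp add: lincomb_def add.commute)
    qed
    moreover have "H0_dist a (lincomb (1 / h) (S t z) (- 1 / h) (S s z)) (S s w) \<le> quotient_error z w h"
    proof (rule quotient_forward[OF s h(1) m(2)])
      show "H0_dist a (S t z) (S s (S h z)) = 0" using semigroup_add[of s h z] s h z by simp
    qed
    moreover have "H0_dist a (S s w) (S t w) \<le> H0_dist a (S h w) w"
    proof -
      have hw: "S h w \<in> H0 a" using h w by (auto intro: semigroup_closed)
      then have shw: "S s (S h w) \<in> H0 a" using s by (auto intro: semigroup_closed)
      have "H0_dist a (S s (S h w)) (S t w) = 0"
        using semigroup_add[of s h w] s h w H0_dist_commute[OF shw m(4)] by simp
      moreover have "H0_dist a (S s w) (S s (S h w)) \<le> H0_dist a (S h w) w"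
        using semigroup_nonexpansive[OF s w hw] H0_dist_commute[OF w hw] by simp
      ultimately show ?thesis using H0_dist_triangle[OF m(3) shw m(4)] by linarith
    qed
    moreover have "lincomb (1 / h) (S t z) (- 1 / h) (S s z) \<in> H0 a" using m by (intro H0_lincomb)
    ultimately show ?thesis
      using H0_dist_triangle[of "lincomb (1 / h) (S t z) (- 1 / h) (S s z)" "S s w" "S t w"] m
      by (simp add: orbit_error_def h(2))
  qed
qed

text \<open>Product rule for a bounded bilinear form b: b(Y,Y) - b(Z,Z) = b(Y - Z, Y) + b(Z, Y - Z),
  divided by s - t. The contraction property bounds all norms along the orbit by those of the
  data.\<close>

lemma multiplier_form_orbit_derivative:
  assumes t: "t \<in> {0..T}"
  shows "((\<lambda>s. multiplier_form (S s z) (S s z)) has_vector_derivative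
    multiplier_form (S t w) (S t z) + multiplier_form (S t z) (S t w)) (at t within {0..T})"
proof -
  obtain C where C: "0 \<le> C" "\<And>z w. z \<in> H0 a \<Longrightarrow> w \<in> H0 a \<Longrightarrow> \<bar>multiplier_form z w\<bar> \<le> C * (H0_norm a z * H0_norm a w)"
    using multiplier_form_bound by metis
  let ?nz = "H0_norm a z" and ?nw = "H0_norm a w" and ?Z = "S t z" and ?D = "S t w"
  let ?\<phi> = "\<lambda>s. multiplier_form (S s z) (S s z)"
  have t0: "0 \<le> t" using t by simp
  have Zt: "?Z \<in> H0 a" "?D \<in> H0 a" using z w t0 by (auto intro: semigroup_closed)
  have nn: "0 \<le> ?nz" "0 \<le> ?nw" using z w by (auto intro: H0_norm_nonneg)
  have diff_left: "\<bar>multiplier_form x v - multiplier_form y v\<bar> \<le> C * (H0_dist a x y * H0_norm a v)"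
    if "x \<in> H0 a" "y \<in> H0 a" "v \<in> H0 a" for x y v
    using C(2)[OF H0_lincomb[OF that(1,2), of 1 "-1"] that(3)] multiplier_form_lincomb_left[OF that, of 1 "-1"]
    by (simp add: H0_dist_def)
  have diff_right: "\<bar>multiplier_form v x - multiplier_form v y\<bar> \<le> C * (H0_norm a v * H0_dist a x y)"
    if "x \<in> H0 a" "y \<in> H0 a" "v \<in> H0 a" for x y v
    using C(2)[OF that(3) H0_lincomb[OF that(1,2), of 1 "-1"]] multiplier_form_lincomb_right[OF that, of 1 "-1"]
    by (simp add: H0_dist_def)
  \<comment> \<open>The three summands pay for replacing the quotient by the derivative in the first
    slot, the state at s by the state at t next to it, and the quotient by the derivative in the
    second slot.\<close>
  define G where "G = (\<lambda>r. C * (orbit_error r * ?nz) + C * (?nw * (r * (?nw + orbit_error r))) + C * (?nz * orbit_error r))"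
  have bound: "\<bar>(?\<phi> s - ?\<phi> t) / (s - t) - (multiplier_form ?D ?Z + multiplier_form ?Z ?D)\<bar> \<le> G \<bar>s - t\<bar>"
    if s: "s \<in> {0..T}" "s \<noteq> t" for s
  proof -
    let ?Y = "S s z"
    define \<delta> where "\<delta> = lincomb (1 / (s - t)) ?Y (- 1 / (s - t)) ?Z"
    have s0: "0 \<le> s" using s by simp
    have Y: "?Y \<in> H0 a" using z s0 by (auto intro: semigroup_closed)
    have d: "\<delta> \<in> H0 a" unfolding \<delta>_def using Y Zt by (intro H0_lincomb)
    have e: "H0_dist a \<delta> ?D \<le> orbit_error \<bar>s - t\<bar>"
      unfolding \<delta>_def by (rule quotient_two_sided) (use s0 t0 s in auto)
    have e0: "0 \<le> H0_dist a \<delta> ?D" by (rule H0_dist_nonneg[OF d Zt(2)])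
    have nY: "H0_norm a ?Y \<le> ?nz" "0 \<le> H0_norm a ?Y" using semigroup_norm[OF s0 z] H0_norm_nonneg[OF Y] by auto
    have nZ: "H0_norm a ?Z \<le> ?nz" "0 \<le> H0_norm a ?Z" using semigroup_norm[OF t0 z] H0_norm_nonneg[OF Zt(1)] by auto
    have nD: "H0_norm a ?D \<le> ?nw" "0 \<le> H0_norm a ?D" using semigroup_norm[OF t0 w] H0_norm_nonneg[OF Zt(2)] by auto
    have quot: "(?\<phi> s - ?\<phi> t) / (s - t) = multiplier_form \<delta> ?Y + multiplier_form ?Z \<delta>"
      unfolding \<delta>_def multiplier_form_lincomb_left[OF Y Zt(1) Y] multiplier_form_lincomb_right[OF Y Zt(1) Zt(1)]
      by (simp add: diff_divide_distrib)
    have "H0_dist a ?Y ?Z \<le> \<bar>s - t\<bar> * H0_norm a \<delta>"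
    proof -
      have "lincomb 1 ?Y (-1) ?Z = lincomb (s - t) \<delta> 0 \<delta>"
        using s(2) by (auto simp: lincomb_def \<delta>_def diff_divide_distrib[symmetric])
      then show ?thesis using H0_norm_lincomb_le[OF d d, of "s - t" 0] by (simp add: H0_dist_def)
    qed
    also have "\<dots> \<le> \<bar>s - t\<bar> * (?nw + orbit_error \<bar>s - t\<bar>)"
      using H0_norm_le_dist[OF d Zt(2)] nD e by (intro mult_left_mono) auto
    finally have YZ: "H0_dist a ?Y ?Z \<le> \<bar>s - t\<bar> * (?nw + orbit_error \<bar>s - t\<bar>)" .
    have "\<bar>multiplier_form \<delta> ?Y - multiplier_form ?D ?Y\<bar> \<le> C * (orbit_error \<bar>s - t\<bar> * ?nz)"
      by (rule order_trans[OF diff_left[OF d Zt(2) Y]]) (intro mult_left_mono mult_mono; use e e0 nY C(1) in linarith)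
    moreover have "\<bar>multiplier_form ?D ?Y - multiplier_form ?D ?Z\<bar> \<le> C * (?nw * (\<bar>s - t\<bar> * (?nw + orbit_error \<bar>s - t\<bar>)))"
      by (rule order_trans[OF diff_right[OF Y Zt(1) Zt(2)]])
        (intro mult_left_mono mult_mono; use YZ H0_dist_nonneg[OF Y Zt(1)] nD nn C(1) in linarith)
    moreover have "\<bar>multiplier_form ?Z \<delta> - multiplier_form ?Z ?D\<bar> \<le> C * (?nz * orbit_error \<bar>s - t\<bar>)"
      by (rule order_trans[OF diff_right[OF d Zt(2) Zt(1)]]) (intro mult_left_mono mult_mono; use e e0 nZ nn C(1) in linarith)
    ultimately show ?thesis unfolding quot G_def by linarith
  qed
  have abs_lim: "filterlim (\<lambda>s. \<bar>s - t\<bar>) (at_right 0) (at t within {0..T})"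
    unfolding filterlim_at
  proof
    show "\<forall>\<^sub>F s in at t within {0..T}. \<bar>s - t\<bar> \<in> {0<..} \<and> \<bar>s - t\<bar> \<noteq> 0"
      by (auto simp: eventually_at_filter)
    have "((\<lambda>s. \<bar>s - t\<bar>) \<longlongrightarrow> \<bar>t - t\<bar>) (at t within {0..T})" by (intro tendsto_intros)
    then show "((\<lambda>s. \<bar>s - t\<bar>) \<longlongrightarrow> 0) (at t within {0..T})" by simp
  qed
  have "(G \<longlongrightarrow> C * (0 * ?nz) + C * (?nw * (0 * (?nw + 0))) + C * (?nz * 0)) (at_right 0)"
    unfolding G_def by (intro tendsto_intros orbit_error_tendsto)
  then have "(G \<longlongrightarrow> 0) (at_right 0)" by simp
  from filterlim_compose[OF this abs_lim]
  have G0: "((\<lambda>s. G \<bar>s - t\<bar>) \<longlongrightarrow> 0) (at t within {0..T})" .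
  have "((\<lambda>s. (?\<phi> s - ?\<phi> t) / (s - t) - (multiplier_form ?D ?Z + multiplier_form ?Z ?D)) \<longlongrightarrow> 0) (at t within {0..T})"
  proof (rule Lim_null_comparison[OF _ G0])
    show "\<forall>\<^sub>F s in at t within {0..T}. norm ((?\<phi> s - ?\<phi> t) / (s - t) - (multiplier_form ?D ?Z + multiplier_form ?Z ?D)) \<le> G \<bar>s - t\<bar>"
      unfolding eventually_at_filter using bound by (auto intro!: always_eventually)
  qed
  then have "((\<lambda>s. (?\<phi> s - ?\<phi> t) / (s - t)) \<longlongrightarrow> multiplier_form ?D ?Z + multiplier_form ?Z ?D) (at t within {0..T})"
    by (rule LIM_zero_cancel)
  then show ?thesis
    unfolding has_real_derivative_iff_has_vector_derivative[symmetric] has_field_derivative_iff .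
qed

end

section \<open>Estimates for data in the domain of the generator\<close>

lemma dom_cA_energy_space:
  assumes "\<zeta> \<in> dom_cA a"
  shows "\<zeta> \<in> H0 a" "op_cA a \<zeta> \<in> H0 a"
proof -
  obtain u v where \<zeta>: "\<zeta> = (u, v)" "u \<in> dom_A a" "v \<in> H2a0 a" using assms by (auto simp: dom_cA_def)
  obtain p where p: "u \<in> H2a0 a" "p \<in> H2" "AE x in lebesgue_on {0<..<1}. p x = a x * deriv01 (deriv01 u) x"
    using \<zeta>(2) by (auto simp: dom_A_def)
  have "continuous_on {0..1} v"
    using H2a0_weighted_space[OF \<zeta>(3)] by (auto simp: weighted_space_def intro: abs_cont_on_imp_continuous_on)
  then have "v \<in> L2" by (rule continuous_on_imp_L2)
  then show "\<zeta> \<in> H0 a" using p \<zeta> by (simp add: H0_def)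
  have "op_A a u \<in> L2" by (rule op_A_L2[OF H2a0_weighted_space[OF p(1)] p(2,3)])
  then have "(\<lambda>x. - op_A a u x) \<in> L2" by (simp add: L2_on_def)
  then show "op_cA a \<zeta> \<in> H0 a" using \<zeta> by (simp add: H0_def op_cA_def)
qed

text \<open>The parameter \<rho> isolates the difference between weak and strong degeneracy. The
  curvature energy collects the coefficient (6 + K) / 2 + \<rho>, the kinetic part the coefficient
  1; their maximum lets both merge into the squared norm.\<close>

lemma domain_multiplier_inequality:
  assumes \<zeta>: "\<zeta> \<in> dom_cA a"
    and R: "\<And>u e. u \<in> H2a0 a \<Longrightarrow> 0 < e \<Longrightarrow> e < 1 \<Longrightarrow>
      integral {e..1} (\<lambda>x. \<bar>deriv01 a x\<bar> * (deriv01 u x)\<^sup>2) \<le> \<rho> * curvature_energy a u"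
  shows "a 1 * (deriv01 (deriv01 (fst \<zeta>)) 1)\<^sup>2 / 2 \<le>
    multiplier_form (op_cA a \<zeta>) \<zeta> + multiplier_form \<zeta> (op_cA a \<zeta>) + max 1 ((6 + K) / 2 + \<rho>) * (H0_norm a \<zeta>)\<^sup>2"
proof -
  obtain u v where \<zeta>': "\<zeta> = (u, v)" "u \<in> dom_A a" "v \<in> H2a0 a" using \<zeta> by (auto simp: dom_cA_def)
  obtain p where p: "u \<in> H2a0 a" "p \<in> H2" "AE x in lebesgue_on {0<..<1}. p x = a x * deriv01 (deriv01 u) x"
    using \<zeta>'(2) by (auto simp: dom_A_def)
  have uw: "u \<in> weighted_space a" by (rule H2a0_weighted_space[OF p(1)])
  define N where "N = curvature_energy a u"
  define V where "V = (LINT x|lebesgue_on {0<..<1}. (v x)\<^sup>2)"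
  define M where "M = max 1 ((6 + K) / 2 + \<rho>)"
  have "a 1 * (deriv01 (deriv01 u) 1)\<^sup>2 / 2 \<le> multiplier_form (op_cA a \<zeta>) \<zeta> + (3 + K/2) * N + \<rho> * N"
    using multiplier_inequality[OF uw p(2,3) R[OF p(1)]]
    by (simp add: multiplier_form_def op_cA_def \<zeta>' N_def)
  moreover have "0 \<le> multiplier_form \<zeta> (op_cA a \<zeta>) + V"
    using velocity_multiplier[OF H2a0_weighted_space[OF \<zeta>'(3)]]
    by (simp add: multiplier_form_def op_cA_def \<zeta>' V_def)
  moreover have "(3 + K/2) * N + \<rho> * N \<le> M * N"
  proof -
    have "((6 + K) / 2 + \<rho>) * N \<le> M * N"
      by (rule mult_right_mono) (use curvature_energy_nonneg[OF uw] in \<open>auto simp: M_def N_def\<close>)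
    then show ?thesis by (simp add: field_simps)
  qed
  moreover have "V \<le> M * V"
    using mult_right_mono[of 1 M V] by (simp add: M_def V_def)
  moreover have "(H0_norm a \<zeta>)\<^sup>2 = N + V"
    using H0_norm_sq[OF dom_cA_energy_space(1)[OF \<zeta>]] by (simp add: \<zeta>' N_def V_def)
  ultimately show ?thesis by (simp add: \<zeta>' M_def[symmetric] distrib_left)
qed

lemma multiplier_form_cong:
  assumes "x \<in> H0 a" "x' \<in> H0 a" "y \<in> H0 a" "y' \<in> H0 a" "H0_eq a x x'" "H0_eq a y y'"
  shows "multiplier_form x y = multiplier_form x' y'"
proof -
  obtain C where C: "\<And>z w. z \<in> H0 a \<Longrightarrow> w \<in> H0 a \<Longrightarrow> \<bar>multiplier_form z w\<bar> \<le> C * (H0_norm a z * H0_norm a w)"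
    using multiplier_form_bound by metis
  have "multiplier_form x y = multiplier_form x' y"
    using C[OF H0_lincomb[OF assms(1,2), of 1 "-1"] assms(3)] multiplier_form_lincomb_left[OF assms(1,2,3), of 1 "-1"] assms(5)
    by (simp add: H0_eq_def H0_dist_def)
  moreover have "multiplier_form x' y = multiplier_form x' y'"
    using C[OF assms(2) H0_lincomb[OF assms(3,4), of 1 "-1"]] multiplier_form_lincomb_right[OF assms(3,4,2), of 1 "-1"] assms(6)
    by (simp add: H0_eq_def H0_dist_def)
  ultimately show ?thesis by simp
qed

lemma H0_eq_trans:
  assumes "x \<in> H0 a" "y \<in> H0 a" "z \<in> H0 a" "H0_eq a x y" "H0_eq a y z"
  shows "H0_eq a x z"
  using H0_dist_triangle[OF assms(1-3)] H0_dist_nonneg[OF assms(1,3)] assms(4,5) by (simp add: H0_eq_def)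

lemma H0_eq_sym: "x \<in> H0 a \<Longrightarrow> y \<in> H0 a \<Longrightarrow> H0_eq a x y \<Longrightarrow> H0_eq a y x"
  using H0_dist_commute by (simp add: H0_eq_def)

lemma H0_eq_norm: "x \<in> H0 a \<Longrightarrow> y \<in> H0 a \<Longrightarrow> H0_eq a x y \<Longrightarrow> H0_norm a x = H0_norm a y"
  using H0_norm_le_dist[of x y] H0_norm_le_dist[of y x] H0_dist_commute[of x y] by (simp add: H0_eq_def)

text \<open>The values at 0 and T contribute m/2 each, whence m, and the leading 2 clears a(1) / 2.
  The gradient bound is required for every \<open>u\<close>, since the state varies with time.
  Square integrability of the trace in t will come from the L2 convergence by which traces are
  defined.\<close>

theorem classical_trace_bound:
  assumes z: "z \<in> dom_cA a" and T: "0 < T"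
    and Y: "\<And>t. 0 \<le> t \<Longrightarrow> (Y t, Yt t) \<in> H0 a \<and> H0_eq a (Y t, Yt t) (S t z)"
    and L: "(\<lambda>t. deriv01 (deriv01 (Y t)) 1) \<in> L2_on {0<..<T}"
    and R: "\<And>u e. u \<in> H2a0 a \<Longrightarrow> 0 < e \<Longrightarrow> e < 1 \<Longrightarrow>
      integral {e..1} (\<lambda>x. \<bar>deriv01 a x\<bar> * (deriv01 u x)\<^sup>2) \<le> \<rho> * curvature_energy a u"
  shows "a 1 * (LINT t|lebesgue_on {0<..<T}. (deriv01 (deriv01 (Y t)) 1)\<^sup>2)
    \<le> 2 * (T * max 1 ((6 + K) / 2 + \<rho>) + max (1 / (a 1 * (2 - K))) 1) * (H0_norm a z)\<^sup>2"
proof -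
  define M where "M = max 1 ((6 + K) / 2 + \<rho>)"
  define m where "m = max (1 / (a 1 * (2 - K))) 1"
  define w where "w = op_cA a z"
  let ?\<tau> = "\<lambda>t. deriv01 (deriv01 (Y t)) 1" and ?\<phi> = "\<lambda>t. multiplier_form (S t z) (S t z)"
  let ?\<phi>' = "\<lambda>t. multiplier_form (S t w) (S t z) + multiplier_form (S t z) (S t w)"
  have zH: "z \<in> H0 a" and wH: "w \<in> H0 a" using dom_cA_energy_space[OF z] by (auto simp: w_def)
  have "\<exists>\<zeta>\<in>dom_cA a. H0_eq a \<zeta> z \<and> H0_eq a (op_cA a \<zeta>) w"
    using z H0_dist_self[OF zH] H0_dist_self[OF wH] by (intro bexI[of _ z]) (auto simp: H0_eq_def w_def)
  then have lim: "(quotient_error z w \<longlongrightarrow> 0) (at_right 0)"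
    using generator zH wH unfolding generated_by_cA_def quotient_error_def[abs_def] by blast
  have point: "a 1 / 2 * (?\<tau> t)\<^sup>2 \<le> ?\<phi>' t + M * (H0_norm a z)\<^sup>2" if t: "t \<in> {0..T}" for t
  proof -
    have t0: "0 \<le> t" using t by simp
    \<comment> \<open>The pointwise inequality applies to states of the domain only, so it is
      evaluated at a representative that shares trace, multiplier forms and norm with the
      orbit.\<close>
    obtain \<zeta> where \<zeta>: "\<zeta> \<in> dom_cA a" "H0_eq a \<zeta> (S t z)" "H0_eq a (op_cA a \<zeta>) (S t w)"
      using semigroup_orbit_in_domain[OF zH wH lim t0] by blast
    note \<zeta>H = dom_cA_energy_space[OF \<zeta>(1)]
    have St: "S t z \<in> H0 a" "S t w \<in> H0 a" using zH wH t0 by (auto intro: semigroup_closed)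
    have "H0_eq a (Y t, Yt t) \<zeta>"
      using Y[OF t0] \<zeta>(2) St \<zeta>H H0_eq_trans H0_eq_sym by blast
    then have "?\<tau> t = deriv01 (deriv01 (fst \<zeta>)) 1"
      using H0_eq_trace[of "(Y t, Yt t)" \<zeta>] Y[OF t0] \<zeta>H by simp
    moreover have "multiplier_form (op_cA a \<zeta>) \<zeta> = multiplier_form (S t w) (S t z)"
      "multiplier_form \<zeta> (op_cA a \<zeta>) = multiplier_form (S t z) (S t w)"
      using multiplier_form_cong \<zeta> \<zeta>H St by blast+
    moreover have "H0_norm a \<zeta> \<le> H0_norm a z"
      using H0_eq_norm[OF \<zeta>H(1) St(1) \<zeta>(2)] semigroup_norm[OF t0 zH] by simp
    then have "M * (H0_norm a \<zeta>)\<^sup>2 \<le> M * (H0_norm a z)\<^sup>2"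
      by (intro mult_left_mono power_mono H0_norm_nonneg \<zeta>H) (auto simp: M_def)
    ultimately show ?thesis
      using domain_multiplier_inequality[OF \<zeta>(1) R] by (simp add: M_def)
  qed
  have "integrable (lebesgue_on {0<..<T}) (\<lambda>t. (?\<tau> t)\<^sup>2)" using L by (simp add: L2_on_def)
  from has_integral_mult_right[OF lebesgue_on_Ioo_has_integral[OF this], of "a 1 / 2"]
  have I1: "((\<lambda>t. a 1 / 2 * (?\<tau> t)\<^sup>2) has_integral a 1 / 2 * (LINT t|lebesgue_on {0<..<T}. (?\<tau> t)\<^sup>2)) {0..T}" .
  \<comment> \<open>The derivative exists at every time of [0,T], so the gauge integral returns the
    increment without continuity of the derivative in t.\<close>
  have "(?\<phi>' has_integral (?\<phi> T - ?\<phi> 0)) {0..T}"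
    by (rule fundamental_theorem_of_calculus) (use T multiplier_form_orbit_derivative[OF zH wH lim] in auto)
  moreover have "((\<lambda>t. M * (H0_norm a z)\<^sup>2) has_integral T * (M * (H0_norm a z)\<^sup>2)) {0..T}"
    using has_integral_const_real[of "M * (H0_norm a z)\<^sup>2" 0 T] T by simp
  ultimately have I2: "((\<lambda>t. ?\<phi>' t + M * (H0_norm a z)\<^sup>2) has_integral (?\<phi> T - ?\<phi> 0) + T * (M * (H0_norm a z)\<^sup>2)) {0..T}"
    by (rule has_integral_add)
  have "a 1 / 2 * (LINT t|lebesgue_on {0<..<T}. (?\<tau> t)\<^sup>2) \<le> (?\<phi> T - ?\<phi> 0) + T * (M * (H0_norm a z)\<^sup>2)"
    by (rule has_integral_le[OF I1 I2 point])
  moreover have "\<bar>?\<phi> t\<bar> \<le> m / 2 * (H0_norm a z)\<^sup>2" if t: "0 \<le> t" for t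
  proof -
    have "\<bar>?\<phi> t\<bar> \<le> m / 2 * (H0_norm a (S t z))\<^sup>2"
      unfolding m_def by (rule multiplier_form_diag_le[OF semigroup_closed[OF t zH]])
    also have "\<dots> \<le> m / 2 * (H0_norm a z)\<^sup>2"
      by (intro mult_left_mono power_mono semigroup_norm t zH H0_norm_nonneg semigroup_closed) (simp add: m_def)
    finally show ?thesis .
  qed
  from this[of T] this[of 0] have "?\<phi> T - ?\<phi> 0 \<le> m * (H0_norm a z)\<^sup>2" using T by simp
  ultimately have "a 1 / 2 * (LINT t|lebesgue_on {0<..<T}. (?\<tau> t)\<^sup>2) \<le> (T * M + m) * (H0_norm a z)\<^sup>2"
    by (simp add: algebra_simps)
  then have "a 1 * (LINT t|lebesgue_on {0<..<T}. (?\<tau> t)\<^sup>2) \<le> 2 * ((T * M + m) * (H0_norm a z)\<^sup>2)" by simp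
  then show ?thesis unfolding M_def m_def by (simp only: mult.assoc)
qed

end

section \<open>The trace estimate\<close>

context degenerate_beam
begin

text \<open>The pointwise bound at the origin makes Hardy's inequality unnecessary; the constant \<open>4 K / (1 - K)\<^sup>2\<close> is not sharp.\<close>

lemma weak_gradient_bound:
  assumes wd: "weakly_degenerate a" and K1: "K < 1" and u: "u \<in> H2a0 a" and e: "0 < e" "e < 1"
  shows "integral {e..1} (\<lambda>x. \<bar>deriv01 a x\<bar> * (deriv01 u x)\<^sup>2) \<le> 4 * K / (1 - K)\<^sup>2 * curvature_energy a u"
proof -
  let ?N = "curvature_energy a u"
  have W: "u \<in> weighted_space a" by (rule H2a0_weighted_space[OF u])
  have N: "0 \<le> ?N" by (rule curvature_energy_nonneg[OF W])
  have i: "(\<lambda>x. \<bar>deriv01 a x\<bar> * (deriv01 u x)\<^sup>2) integrable_on {e..1}"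
    by (intro integrable_continuous_real continuous_intros continuous_deriv_u[OF W e(1)] continuous_on_subset[OF continuous_deriv_a])
      (use e in auto)
  have "integral {e..1} (\<lambda>x. \<bar>deriv01 a x\<bar> * (deriv01 u x)\<^sup>2) \<le> K / (1 - K) * ?N * (1 - e)"
  proof (rule has_integral_le[OF integrable_integral[OF i]])
    show "((\<lambda>x. K / (1 - K) * ?N) has_integral K / (1 - K) * ?N * (1 - e)) {e..1}"
      using has_integral_const_real[of "K / (1 - K) * ?N" e 1] e by (simp add: mult.commute)
    fix x assume x: "x \<in> {e..1}"
    then have x01: "0 < x" "x \<le> 1" using e by auto
    have ax: "0 < a x" by (rule a_pos) (use x01 in simp)
    have "(deriv01 u x)\<^sup>2 \<le> ?N * (x / (a x * (1 - K)))"
      using deriv_sq_le_origin[OF W _ _ K1 x01] u wd by (simp add: H2a0_def)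
    moreover have "\<bar>deriv01 a x\<bar> \<le> K * a x / x"
      using deriv_a_le[of x] x01 by (simp add: pos_le_divide_eq mult.commute)
    ultimately have "\<bar>deriv01 a x\<bar> * (deriv01 u x)\<^sup>2 \<le> (K * a x / x) * (?N * (x / (a x * (1 - K))))"
      using K ax x01 by (intro mult_mono) auto
    also have "\<dots> = K / (1 - K) * ?N" using ax x01 K1 by (simp add: field_simps)
    finally show "\<bar>deriv01 a x\<bar> * (deriv01 u x)\<^sup>2 \<le> K / (1 - K) * ?N" .
  qed
  also have "\<dots> \<le> K / (1 - K) * ?N * 1" by (rule mult_left_mono) (use e N K K1 in auto)
  also have "\<dots> \<le> 4 * K / (1 - K)\<^sup>2 * ?N * 1"
  proof (intro mult_right_mono)
    have "K * (1 - K) \<le> 4 * K" using K K1 by (intro order_trans[OF mult_left_le]) auto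
    then have "K * (1 - K) / (1 - K)\<^sup>2 \<le> 4 * K / (1 - K)\<^sup>2" by (rule divide_right_mono) simp
    moreover have "K * (1 - K) / (1 - K)\<^sup>2 = K / (1 - K)" using K1 by (simp add: power2_eq_square)
    ultimately show "K / (1 - K) \<le> 4 * K / (1 - K)\<^sup>2" by simp
  qed (use N in auto)
  finally show ?thesis by simp
qed

text \<open>Strong degeneracy gives no condition on u' at 0 but a bounded a'. So |a'| is replaced by
  its supremum, and u' is integrated by the bound anchored at x = 1.\<close>

lemma strong_gradient_bound:
  assumes sd: "strongly_degenerate a" and u: "u \<in> H2a0 a" and e: "0 < e" "e < 1"
  shows "integral {e..1} (\<lambda>x. \<bar>deriv01 a x\<bar> * (deriv01 u x)\<^sup>2)
    \<le> (SUP x\<in>{0..1}. \<bar>deriv01 a x\<bar>) / (a 1 * (2 - K)) * curvature_energy a u"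
proof -
  let ?A = "SUP x\<in>{0..1}. \<bar>deriv01 a x\<bar>"
  have W: "u \<in> weighted_space a" by (rule H2a0_weighted_space[OF u])
  have "continuous_on {0..1} (\<lambda>x. \<bar>deriv01 a x\<bar>)"
    using sd by (intro continuous_intros) (simp add: strongly_degenerate_def)
  then have "bdd_above ((\<lambda>x. \<bar>deriv01 a x\<bar>) ` {0..1})"
    by (intro bounded_imp_bdd_above compact_imp_bounded compact_continuous_image) auto
  then have A: "\<bar>deriv01 a x\<bar> \<le> ?A" if "x \<in> {0..1}" for x using that by (intro cSUP_upper)
  have A0: "0 \<le> ?A" using A[of 0] by simp
  have i: "(\<lambda>x. \<bar>deriv01 a x\<bar> * (deriv01 u x)\<^sup>2) integrable_on {e..1}"
    by (intro integrable_continuous_real continuous_intros continuous_deriv_u[OF W e(1)] continuous_on_subset[OF continuous_deriv_a])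
      (use e in auto)
  have j: "(\<lambda>x. (deriv01 u x)\<^sup>2) integrable_on {e..1}"
    by (intro integrable_continuous_real continuous_intros continuous_deriv_u[OF W e(1)])
  have "integral {e..1} (\<lambda>x. \<bar>deriv01 a x\<bar> * (deriv01 u x)\<^sup>2) \<le> ?A * integral {e..1} (\<lambda>x. (deriv01 u x)\<^sup>2)"
  proof (rule has_integral_le[OF integrable_integral[OF i] has_integral_mult_right[OF integrable_integral[OF j]]])
    fix x assume "x \<in> {e..1}"
    then show "\<bar>deriv01 a x\<bar> * (deriv01 u x)\<^sup>2 \<le> ?A * (deriv01 u x)\<^sup>2"
      using e by (intro mult_right_mono A) auto
  qed
  also have "\<dots> \<le> ?A * (curvature_energy a u / (a 1 * (2 - K)))"
    by (rule mult_left_mono[OF integral_deriv_sq_le[OF W e] A0])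
  finally show ?thesis by simp
qed

lemma energy_eq_H0_norm:
  assumes "(y t, yt t) \<in> H0 a"
  shows "energy a y yt t = 1/2 * (H0_norm a (y t, yt t))\<^sup>2"
proof -
  have "integrable (lebesgue_on {0<..<1}) (\<lambda>x. (yt t x)\<^sup>2)" using assms by (auto simp: H0_def L2_on_def)
  moreover have "integrable (lebesgue_on {0<..<1}) (\<lambda>x. a x * (deriv01 (deriv01 (y t)) x)\<^sup>2)"
    by (rule weighted_L2_energy(1)) (use assms in \<open>auto simp: H0_def H2a0_def\<close>)
  ultimately show ?thesis
    unfolding energy_def H0_norm_sq[OF assms] curvature_energy_def by simp
qed

text \<open>Each approximating classical solution may come with its own semigroup, but its bound
  involves only the norm of its data, so the semigroups need not be compared. The factor 4 is the 2
  of the classical bound times the 2 from the energy being half the squared norm.\<close>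

theorem mild_trace_bound:
  assumes T: "0 < T" and y: "mild_solution a z y yt" and tr: "trace_yxx a T z \<tau>"
    and R: "\<And>u e. u \<in> H2a0 a \<Longrightarrow> 0 < e \<Longrightarrow> e < 1 \<Longrightarrow>
      integral {e..1} (\<lambda>x. \<bar>deriv01 a x\<bar> * (deriv01 u x)\<^sup>2) \<le> \<rho> * curvature_energy a u"
  shows "a 1 * (LINT t|lebesgue_on {0<..<T}. (\<tau> t)\<^sup>2)
    \<le> 4 * (T * max 1 ((6 + K) / 2 + \<rho>) + max (1 / (a 1 * (2 - K))) 1) * energy a y yt 0"
proof -
  define c where "c = 2 * (T * max 1 ((6 + K) / 2 + \<rho>) + max (1 / (a 1 * (2 - K))) 1)"
  have c: "0 \<le> c" using T by (auto simp: c_def intro!: add_nonneg_nonneg)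
  obtain S where zH: "z \<in> H0 a" and S: "contraction_semigroup a S" "generated_by_cA a S"
    and Sy: "\<And>t. 0 \<le> t \<Longrightarrow> (y t, yt t) \<in> H0 a \<and> H0_eq a (y t, yt t) (S t z)"
    using y unfolding mild_solution_def by blast
  interpret beam_semigroup a K S by unfold_locales (fact S)+
  have energy: "energy a y yt 0 = 1/2 * (H0_norm a z)\<^sup>2"
  proof -
    \<comment> \<open>The orbit starts at the data only up to seminorm 0, so norms are compared, not
      states.\<close>
    have m: "(y 0, yt 0) \<in> H0 a" "S 0 z \<in> H0 a" using Sy[of 0] semigroup_closed[of 0 z] zH by auto
    have "H0_norm a (y 0, yt 0) = H0_norm a (S 0 z)" by (rule H0_eq_norm[OF m]) (use Sy[of 0] in simp)
    also have "\<dots> = H0_norm a z" by (rule H0_eq_norm[OF m(2) zH]) (simp add: H0_eq_def semigroup_zero[OF zH])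
    finally show ?thesis using energy_eq_H0_norm[where y = y and yt = yt and t = 0, OF m(1)] by simp
  qed
  obtain \<zeta> Y Yt where cl: "\<And>n. classical_solution a (\<zeta> n) (Y n) (Yt n)"
    and lim: "(\<lambda>n. H0_dist a (\<zeta> n) z) \<longlonglongrightarrow> 0"
    and L2: "L2_limit_on {0<..<T} (\<lambda>n t. deriv01 (deriv01 (Y n t)) 1) \<tau>"
    using tr unfolding trace_yxx_def by blast
  let ?f = "\<lambda>n t. deriv01 (deriv01 (Y n t)) 1" and ?M = "lebesgue_on {0<..<T}"
  have f: "?f n \<in> L2_on {0<..<T}" and \<tau>: "\<tau> \<in> L2_on {0<..<T}"
    and d: "(\<lambda>n. LINT t|?M. (?f n t - \<tau> t)\<^sup>2) \<longlonglongrightarrow> 0" for n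
    using L2 unfolding L2_limit_on_def by blast+
  have \<zeta>H: "\<zeta> n \<in> H0 a" for n using cl by (auto simp: classical_solution_def mild_solution_def)
  have classical: "a 1 * (LINT t|?M. (?f n t)\<^sup>2) \<le> c * (H0_norm a (\<zeta> n))\<^sup>2" for n
  proof -
    obtain S' where S': "contraction_semigroup a S'" "generated_by_cA a S'"
      and Y: "\<And>t. 0 \<le> t \<Longrightarrow> (Y n t, Yt n t) \<in> H0 a \<and> H0_eq a (Y n t, Yt n t) (S' t (\<zeta> n))"
      using cl[of n] unfolding classical_solution_def mild_solution_def by blast
    interpret approx: beam_semigroup a K S' by unfold_locales (fact S')+
    have "\<zeta> n \<in> dom_cA a" using cl[of n] by (simp add: classical_solution_def)
    from approx.classical_trace_bound[OF this T Y f R] show ?thesis by (simp only: c_def)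
  qed
  \<comment> \<open>Taking roots turns both sides into norms: Minkowski's inequality then controls
    the trace and the triangle inequality the data, and both errors vanish in the limit.\<close>
  have "sqrt (a 1) * sqrt (LINT t|?M. (\<tau> t)\<^sup>2)
      \<le> sqrt (a 1) * sqrt (LINT t|?M. (?f n t - \<tau> t)\<^sup>2) + sqrt c * (H0_norm a z + H0_dist a (\<zeta> n) z)" for n
  proof -
    have "(\<lambda>t. (-1) * ?f n t + 1 * \<tau> t) \<in> L2_on {0<..<T}" by (rule L2_on_lincomb(1)[OF f \<tau>])
    from L2_on_Minkowski[OF this f[of n]]
    have "sqrt (LINT t|?M. (\<tau> t)\<^sup>2) \<le> sqrt (LINT t|?M. (?f n t - \<tau> t)\<^sup>2) + sqrt (LINT t|?M. (?f n t)\<^sup>2)"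
      by (simp add: power2_commute)
    then have "sqrt (a 1) * sqrt (LINT t|?M. (\<tau> t)\<^sup>2)
        \<le> sqrt (a 1) * (sqrt (LINT t|?M. (?f n t - \<tau> t)\<^sup>2) + sqrt (LINT t|?M. (?f n t)\<^sup>2))"
      by (rule mult_left_mono) (use a1_pos in simp)
    moreover have "sqrt (a 1) * sqrt (LINT t|?M. (?f n t)\<^sup>2) \<le> sqrt c * H0_norm a (\<zeta> n)"
      using real_sqrt_le_mono[OF classical[of n]] H0_norm_nonneg[OF \<zeta>H] by (simp add: real_sqrt_mult)
    moreover have "sqrt c * H0_norm a (\<zeta> n) \<le> sqrt c * (H0_norm a z + H0_dist a (\<zeta> n) z)"
      by (rule mult_left_mono[OF H0_norm_le_dist[OF \<zeta>H zH]]) (use c in simp)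
    ultimately show ?thesis by (simp add: distrib_left)
  qed
  moreover have "(\<lambda>n. sqrt (a 1) * sqrt (LINT t|?M. (?f n t - \<tau> t)\<^sup>2) + sqrt c * (H0_norm a z + H0_dist a (\<zeta> n) z))
      \<longlonglongrightarrow> sqrt (a 1) * sqrt 0 + sqrt c * (H0_norm a z + 0)"
    by (intro tendsto_intros d lim)
  ultimately have "sqrt (a 1) * sqrt (LINT t|?M. (\<tau> t)\<^sup>2) \<le> sqrt c * H0_norm a z"
    using LIMSEQ_le_const by fastforce
  then have "(sqrt (a 1) * sqrt (LINT t|?M. (\<tau> t)\<^sup>2))\<^sup>2 \<le> (sqrt c * H0_norm a z)\<^sup>2"
    by (rule power_mono) (use a1_pos in simp)
  then have "a 1 * (LINT t|?M. (\<tau> t)\<^sup>2) \<le> c * (H0_norm a z)\<^sup>2"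
    using a1_pos c by (simp add: power_mult_distrib)
  also have "\<dots> = 2 * c * energy a y yt 0" by (simp add: energy)
  finally show ?thesis by (simp add: c_def)
qed

end

text \<open>In the strong case the derivative of the weight is continuous on [0,1], so the supremum
  is the maximum of |a'|.\<close>

theorem theorem3p5:
  fixes a :: "real \<Rightarrow> real" and K T :: real
    and y0 y1 :: "real \<Rightarrow> real" and y yt :: "real \<Rightarrow> real \<Rightarrow> real" and yxx1 :: "real \<Rightarrow> real"
  assumes "weakly_degenerate a \<or> strongly_degenerate a"
    and "K = degeneracy_const a"
    and "0 < T"
    and "mild_solution a (y0, y1) y yt"
    and "trace_yxx a T (y0, y1) yxx1"
  shows "(weakly_degenerate a \<longrightarrow>
           a 1 * (LINT t|lebesgue_on {0<..<T}. (yxx1 t)\<^sup>2)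
             \<le> 4 * (T * max 1 ((6 + K) / 2 + 4 * K / (1 - K)\<^sup>2)
                    + max (1 / (a 1 * (2 - K))) 1) * energy a y yt 0) \<and>
         (strongly_degenerate a \<longrightarrow>
           a 1 * (LINT t|lebesgue_on {0<..<T}. (yxx1 t)\<^sup>2)
             \<le> 4 * (T * max 1 ((6 + K) / 2
                               + (SUP x\<in>{0..1}. \<bar>deriv01 a x\<bar>) / (a 1 * (2 - K)))
                    + max (1 / (a 1 * (2 - K))) 1) * energy a y yt 0)"
proof -
  interpret degenerate_beam a K
    using degenerate_weight_of_degeneracy_const[OF assms(1)] assms(1,2)
    by (simp add: degenerate_beam_def degenerate_beam_axioms_def)
  show ?thesis
  proof (intro conjI impI)
    assume wd: "weakly_degenerate a"
    then have "K < 1" by (simp add: weakly_degenerate_def assms(2))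
    from mild_trace_bound[OF assms(3-5) weak_gradient_bound[OF wd this]]
    show "a 1 * (LINT t|lebesgue_on {0<..<T}. (yxx1 t)\<^sup>2)
             \<le> 4 * (T * max 1 ((6 + K) / 2 + 4 * K / (1 - K)\<^sup>2)
                    + max (1 / (a 1 * (2 - K))) 1) * energy a y yt 0" .
  next
    assume sd: "strongly_degenerate a"
    from mild_trace_bound[OF assms(3-5) strong_gradient_bound[OF sd]]
    show "a 1 * (LINT t|lebesgue_on {0<..<T}. (yxx1 t)\<^sup>2)
             \<le> 4 * (T * max 1 ((6 + K) / 2
                               + (SUP x\<in>{0..1}. \<bar>deriv01 a x\<bar>) / (a 1 * (2 - K)))
                    + max (1 / (a 1 * (2 - K))) 1) * energy a y yt 0" .
  qed
qed

end
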